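(* For every odd prime $q$ and every $\varepsilon>0$, there exists a constant $C_{\varepsilon,q}$ such that whenever $R\in q^{2\mathbb{N}}$ and a Schwartz function $F\colon\mathbb{Q}_q^2\to\mathbb{C}$ has Fourier support contained in $\Xi_{1/R}$, one has $$\int_{\mathbb{Q}_q^2}|F|^6\le C_{\varepsilon,q}(\log R)^{12+\varepsilon}\Big(\sum_{|\tau|=R^{-1/2}}\|F_\tau\|_{L^\infty(\mathbb{Q}_q^2)}^2\Big)^2\Big(\sum_{|\tau|=R^{-1/2}}\|F_\tau\|_{L^2(\mathbb{Q}_q^2)}^2\Big),$$ where the sums on the right-hand side are over all intervals $\tau\subset\mathbb{Z}_q$ of length $R^{-1/2}$.
   Context: $\mathbb{N}=\{1,2,3,\dots\}$ and $q^{2\mathbb{N}}=\{q^{2n}:n\in\mathbb{N}\}$. $|\cdot|$ is the $q$-adic norm on $\mathbb{Q}_q$ with $|q|=q^{-1}$; $\mathbb{Z}_q=\{x\in\mathbb{Q}_q:|x|\le 1\}$. Haar measure on $\mathbb{Q}_q$ is normalized so that $\mathbb{Z}_q$ has measure $1$, and $\mathbb{Q}_q^2$ carries the product measure. An interval in $\mathbb{Z}_q$ of length $q^{-b}$ is a set $\{\xi\in\mathbb{Z}_q:|\xi-a|\le q^{-b}\}$ with $a\in\mathbb{Z}_q$; $|\tau|$ denotes the length of the interval $\tau$. The additive character $\chi$ of $\mathbb{Q}_q$ is $\chi(x)=e^{2\pi i\sum_{j=k}^{-1}a_jq^j}$ for $x=\sum_{j=k}^\infty a_jq^j$, $a_j\in\{0,\dots,q-1\}$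 (so $\chi$ is trivial on $\mathbb{Z}_q$ and non-trivial on $q^{-1}\mathbb{Z}_q$), and the Fourier transform on $\mathbb{Q}_q^2$ is $\widehat f(\xi)=\int_{\mathbb{Q}_q^2}f(x)\chi(-x\cdot\xi)\,dx$. Schwartz functions on $\mathbb{Q}_q^2$ are finite linear combinations of indicator functions of squares $\{(x,y):|x-c_1|\le q^{-b},|y-c_2|\le q^{-b}\}$. A function $f$ has Fourier support in $\Omega$ if $\widehat f$ is supported in $\Omega$. For $\delta\in q^{-\mathbb{N}}$, $\Xi_\delta=\{(\xi,\eta)\in\mathbb{Q}_q^2:\xi\in\mathbb{Z}_q,\ |\eta-\xi^2|\le\delta\}$. For a Schwartz function $F$ and an interval $\tau\subset\mathbb{Z}_q$, $F_\tau$ is defined by $\widehat{F_\tau}=\widehat F\,1_{\tau\times\mathbb{Q}_q}$. *)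

theory Defs
  imports "HOL-Probability.Probability" "HOL-Algebra.Ring" "HOL-Computational_Algebra.Primes"
begin

text \<open>
  An element of the field of \<open>q\<close>-adic numbers is represented by its digits: the function \<open>x\<close>
  stands for the series with terms \<open>x j * q^j\<close> over all integers \<open>j\<close>, where \<open>0 \<le> x j < q\<close> and
  \<open>x j = 0\<close> for all sufficiently negative \<open>j\<close>.
\<close>

type_synonym padic = "int \<Rightarrow> nat"

definition padics :: "nat \<Rightarrow> padic set" where
  "padics q = {x. (\<forall>j. x j < q) \<and> (\<exists>k. \<forall>j<k. x j = 0)}"

text \<open>The (rational) sum of the terms of index less than \<open>n\<close>.\<close>

definition padic_trunc :: "nat \<Rightarrow> padic \<Rightarrow> int \<Rightarrow> real" where
  "padic_trunc q x n = (\<Sum>j | j < n \<and> x j \<noteq> 0. real (x j) * real q powi j)"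

text \<open>
  For \<open>r\<close> an integer divided by a power of \<open>q\<close>, of any sign, this is the digit of index \<open>j\<close> in the
  \<open>q\<close>-adic expansion of \<open>r\<close>. It depends only on \<open>r\<close> modulo \<open>q^(j+1)\<close>.
\<close>

definition digit :: "nat \<Rightarrow> real \<Rightarrow> int \<Rightarrow> nat" where
  "digit q r j = nat (\<lfloor>r / real q powi j\<rfloor> mod int q)"

definition padic_zero :: padic where
  "padic_zero = (\<lambda>j. 0)"

definition padic_one :: padic where
  "padic_one = (\<lambda>j. if j = 0 then 1 else 0)"

definition padic_add :: "nat \<Rightarrow> padic \<Rightarrow> padic \<Rightarrow> padic" where
  "padic_add q x y = (\<lambda>j. digit q (padic_trunc q x (j + 1) + padic_trunc q y (j + 1)) j)"

text \<open>The \<open>q\<close>-adic valuation; only used for \<open>x \<noteq> padic_zero\<close>.\<close>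

definition padic_ord :: "padic \<Rightarrow> int" where
  "padic_ord x = (THE k. x k \<noteq> 0 \<and> (\<forall>j<k. x j = 0))"

text \<open>
  If \<open>x\<close> and \<open>y\<close> are nonzero, truncating both at \<open>m\<close> changes the product by a multiple of
  \<open>q^(m + min (padic_ord x) (padic_ord y))\<close>, which is why the digit of index \<open>j\<close> is read off from
  the truncations at the index below.
\<close>

definition padic_mult :: "nat \<Rightarrow> padic \<Rightarrow> padic \<Rightarrow> padic" where
  "padic_mult q x y = (\<lambda>j.
     let m = j + 1 - min (padic_ord x) (padic_ord y)
     in digit q (padic_trunc q x m * padic_trunc q y m) j)"

definition Qp :: "nat \<Rightarrow> padic ring" where
  "Qp q = \<lparr>carrier = padics q, mult = padic_mult q, one = padic_one,
           zero = padic_zero, add = padic_add q\<rparr>"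

definition padic_norm :: "nat \<Rightarrow> padic \<Rightarrow> real" where
  "padic_norm q x = (if x = padic_zero then 0 else real q powi (- padic_ord x))"

definition Zp :: "nat \<Rightarrow> padic set" where
  "Zp q = {x \<in> carrier (Qp q). padic_norm q x \<le> 1}"

definition padic_cball :: "nat \<Rightarrow> padic \<Rightarrow> int \<Rightarrow> padic set" where
  "padic_cball q c b = {x \<in> carrier (Qp q). padic_norm q (x \<ominus>\<^bsub>Qp q\<^esub> c) \<le> real q powi (- b)}"

text \<open>The balls form a countable base of the topology, so they generate the Borel sets.\<close>

definition padic_borel :: "nat \<Rightarrow> padic measure" where
  "padic_borel q = sigma (carrier (Qp q)) {padic_cball q c b |c b. c \<in> carrier (Qp q)}"

definition normalized_haar :: "nat \<Rightarrow> padic measure \<Rightarrow> bool" where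
  "normalized_haar q M \<longleftrightarrow>
     sets M = sets (padic_borel q) \<and>
     (\<forall>a\<in>carrier (Qp q). \<forall>A\<in>sets M. emeasure M ((\<lambda>x. a \<oplus>\<^bsub>Qp q\<^esub> x) ` A) = emeasure M A) \<and>
     emeasure M (Zp q) = 1"

definition haar :: "nat \<Rightarrow> padic measure" where
  "haar q = (THE M. normalized_haar q M)"

definition haar2 :: "nat \<Rightarrow> (padic \<times> padic) measure" where
  "haar2 q = haar q \<Otimes>\<^sub>M haar q"

text \<open>The truncation at \<open>0\<close> is the fractional part.\<close>

definition padic_char :: "nat \<Rightarrow> padic \<Rightarrow> complex" where
  "padic_char q x = exp (2 * of_real pi * \<i> * of_real (padic_trunc q x 0))"

definition Qp2 :: "nat \<Rightarrow> (padic \<times> padic) set" where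
  "Qp2 q = carrier (Qp q) \<times> carrier (Qp q)"

definition padic_dot :: "nat \<Rightarrow> padic \<times> padic \<Rightarrow> padic \<times> padic \<Rightarrow> padic" where
  "padic_dot q x y = (fst x \<otimes>\<^bsub>Qp q\<^esub> fst y) \<oplus>\<^bsub>Qp q\<^esub> (snd x \<otimes>\<^bsub>Qp q\<^esub> snd y)"

definition fourier :: "nat \<Rightarrow> (padic \<times> padic \<Rightarrow> complex) \<Rightarrow> padic \<times> padic \<Rightarrow> complex" where
  "fourier q f \<xi> = (LINT x|haar2 q. f x * padic_char q (\<ominus>\<^bsub>Qp q\<^esub> padic_dot q x \<xi>))"

text \<open>Functions on the plane are extended by \<open>0\<close> outside \<^term>\<open>Qp2 q\<close>.\<close>

definition schwartz :: "nat \<Rightarrow> (padic \<times> padic \<Rightarrow> complex) \<Rightarrow> bool" where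
  "schwartz q f \<longleftrightarrow>
     (\<exists>(n::nat) (a::nat \<Rightarrow> complex) c d b.
        (\<forall>i<n. c i \<in> carrier (Qp q) \<and> d i \<in> carrier (Qp q)) \<and>
        f = (\<lambda>x. \<Sum>i<n. a i * indicator (padic_cball q (c i) (b i) \<times> padic_cball q (d i) (b i)) x))"

definition has_fourier_support :: "nat \<Rightarrow> (padic \<times> padic \<Rightarrow> complex) \<Rightarrow> (padic \<times> padic) set \<Rightarrow> bool" where
  "has_fourier_support q f \<Omega> \<longleftrightarrow> (\<forall>\<xi>\<in>Qp2 q. fourier q f \<xi> \<noteq> 0 \<longrightarrow> \<xi> \<in> \<Omega>)"

definition parabola_nbhd :: "nat \<Rightarrow> real \<Rightarrow> (padic \<times> padic) set" where
  "parabola_nbhd q \<delta> =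
     {(\<xi>, \<eta>) \<in> Qp2 q. \<xi> \<in> Zp q \<and> padic_norm q (\<eta> \<ominus>\<^bsub>Qp q\<^esub> (\<xi> [^]\<^bsub>Qp q\<^esub> (2::nat))) \<le> \<delta>}"

definition padic_intervals :: "nat \<Rightarrow> real \<Rightarrow> padic set set" where
  "padic_intervals q l =
     {\<tau>. \<exists>a\<in>Zp q. \<exists>b::nat. l = real q powi (- int b) \<and>
          \<tau> = {\<xi> \<in> Zp q. padic_norm q (\<xi> \<ominus>\<^bsub>Qp q\<^esub> a) \<le> real q powi (- int b)}}"

definition freq_restrict :: "nat \<Rightarrow> padic set \<Rightarrow> (padic \<times> padic \<Rightarrow> complex) \<Rightarrow> padic \<times> padic \<Rightarrow> complex" where
  "freq_restrict q \<tau> F =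
     (THE G. schwartz q G \<and>
             (\<forall>\<xi>\<in>Qp2 q. fourier q G \<xi> = fourier q F \<xi> * indicator (\<tau> \<times> carrier (Qp q)) \<xi>))"

definition L2_norm :: "nat \<Rightarrow> (padic \<times> padic \<Rightarrow> complex) \<Rightarrow> real" where
  "L2_norm q f = sqrt (LINT x|haar2 q. (cmod (f x))\<^sup>2)"

definition Linf_norm :: "nat \<Rightarrow> (padic \<times> padic \<Rightarrow> complex) \<Rightarrow> real" where
  "Linf_norm q f = enn2real (esssup (haar2 q) (\<lambda>x. ennreal (cmod (f x))))"

section \<open>Well-definedness\<close>

text \<open>
  The digit arithmetic makes \<^term>\<open>Qp q\<close> a field for prime \<open>q\<close> (lemma \<open>field_Qp\<close>), and the
  normalized Haar measure exists and is unique (lemma \<open>ex1_haar\<close>). Existence is shown by pushing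
  Lebesgue measure on the nonnegative reals forward along the map that reverses base-\<open>q\<close>
  expansions.

  In \<open>pcong q n r s\<close> the reals \<open>r\<close> and \<open>s\<close> differ by an integer multiple of \<open>q^n\<close>, and
  \<open>papprox q x r n\<close> says that \<open>x\<close> agrees with \<open>r\<close> modulo \<open>q^n\<close>.
\<close>

lemma powi_pos: "q \<ge> 2 \<Longrightarrow> real q powi j > 0" by simp

lemma floor_div_step:
  assumes "q \<ge> 2"
  shows "\<lfloor>r / real q powi (j+1)\<rfloor> = \<lfloor>r / real q powi j\<rfloor> div int q"
proof -
  have "r / real q powi (j+1) = (r / real q powi j) / real_of_int (int q)"
    using assms by (simp add: power_int_add field_simps)
  then show ?thesis by (metis floor_divide_real_eq_div of_nat_0_le_iff)
qed

lemma digit_eq: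
  assumes "q \<ge> 2"
  shows "real (digit q r j) = \<lfloor>r / real q powi j\<rfloor> - real q * \<lfloor>r / real q powi (j+1)\<rfloor>"
proof -
  have "int (digit q r j) = \<lfloor>r / real q powi j\<rfloor> mod int q"
    using assms by (simp add: digit_def)
  also have "\<dots> = \<lfloor>r / real q powi j\<rfloor> - int q * \<lfloor>r / real q powi (j+1)\<rfloor>"
    by (simp add: floor_div_step[OF assms] minus_mult_div_eq_mod)
  finally show ?thesis by (metis of_int_diff of_int_mult of_int_of_nat_eq)
qed

lemma digit_less: "q \<ge> 2 \<Longrightarrow> digit q r j < q"
  by (simp add: digit_def nat_less_iff)

lemma digit_sum:
  assumes "q \<ge> 2" "k \<le> n"
  shows "(\<Sum>j\<in>{k..<n}. real (digit q r j) * real q powi j)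
       = real q powi k * \<lfloor>r / real q powi k\<rfloor> - real q powi n * \<lfloor>r / real q powi n\<rfloor>"
  using assms(2)
proof (induction n rule: int_ge_induct)
  case base then show ?case by simp
next
  case (step i)
  have "{k..<i+1} = insert i {k..<i}" using step by auto
  then show ?case using step assms(1)
    by (simp add: digit_eq[OF assms(1)] power_int_add algebra_simps)
qed

lemma trunc_alt:
  assumes "\<forall>j<k. x j = 0"
  shows "padic_trunc q x n = (\<Sum>j\<in>{k..<n}. real (x j) * real q powi j)"
  unfolding padic_trunc_def
  by (rule sum.mono_neutral_left) (use assms not_le in \<open>auto simp: not_less\<close>)

definition pcong :: "nat \<Rightarrow> int \<Rightarrow> real \<Rightarrow> real \<Rightarrow> bool" where
  "pcong q n r s \<longleftrightarrow> (r - s) / real q powi n \<in> \<int>"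

definition pintegral :: "nat \<Rightarrow> int \<Rightarrow> real \<Rightarrow> bool" where
  "pintegral q k r \<longleftrightarrow> r / real q powi k \<in> \<int>"

lemma pcong_refl[simp]: "pcong q n r r" by (simp add: pcong_def)
lemma pcong_sym: "pcong q n r s \<Longrightarrow> pcong q n s r"
  unfolding pcong_def using Ints_minus by (metis minus_diff_eq minus_divide_left)
lemma pcong_trans: "pcong q n r s \<Longrightarrow> pcong q n s t \<Longrightarrow> pcong q n r t"
  unfolding pcong_def using Ints_add[of "(r-s)/real q powi n" "(s-t)/real q powi n"]
  by (simp add: add_divide_distrib[symmetric])
lemma pcong_add: "pcong q n r s \<Longrightarrow> pcong q n r' s' \<Longrightarrow> pcong q n (r+r') (s+s')"
  unfolding pcong_def using Ints_add[of "(r-s)/real q powi n" "(r'-s')/real q powi n"]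
  by (simp add: add_divide_distrib[symmetric] algebra_simps)
lemma pcong_minus: "pcong q n r s \<Longrightarrow> pcong q n (-r) (-s)"
  unfolding pcong_def using Ints_minus[of "(r-s)/real q powi n"] by (simp add: diff_divide_distrib)
lemma pintegral_iff: "pintegral q k r \<longleftrightarrow> pcong q k r 0" by (simp add: pintegral_def pcong_def)

lemma powi_Int: "0 \<le> m \<Longrightarrow> real q powi m \<in> \<int>"
  by (auto simp: power_int_def)

lemma pcong_mono:
  assumes "q \<ge> 2" "pcong q n r s" "m \<le> n" shows "pcong q m r s"
proof -
  have "(r - s) / real q powi m = ((r - s) / real q powi n) * real q powi (n - m)"
    using assms(1) by (simp add: power_int_diff)
  then show ?thesis using assms powi_Int[of "n-m" q] unfolding pcong_def by (metis Ints_mult diff_ge_0_iff_ge)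
qed

lemma pcong_scale:
  assumes "q \<ge> 2" "pintegral q k t" "pcong q n r s" shows "pcong q (n+k) (t * r) (t * s)"
proof -
  have "(t * r - t * s) / real q powi (n+k) = (t / real q powi k) * ((r-s) / real q powi n)"
    using assms(1) by (simp add: power_int_add right_diff_distrib diff_divide_distrib mult.commute)
  then show ?thesis using assms unfolding pcong_def pintegral_def by (metis Ints_mult)
qed

lemma pcong_mult:
  assumes "q \<ge> 2" "pcong q n r r'" "pcong q n s s'" "pintegral q k r" "pintegral q k s'"
  shows "pcong q (n+k) (r * s) (r' * s')"
proof -
  have "pcong q (n+k) (r * s) (r * s')" using pcong_scale[OF assms(1,4,3)] .
  moreover have "pcong q (n+k) (s' * r) (s' * r')" using pcong_scale[OF assms(1,5,2)] .
  ultimately show ?thesis by (metis pcong_trans mult.commute)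
qed

lemma pintegral_add: "pintegral q k r \<Longrightarrow> pintegral q k s \<Longrightarrow> pintegral q k (r+s)"
  unfolding pintegral_iff using pcong_add by fastforce
lemma pintegral_mult: "q \<ge> 2 \<Longrightarrow> pintegral q k r \<Longrightarrow> pintegral q l s \<Longrightarrow> pintegral q (k+l) (r * s)"
  unfolding pintegral_iff using pcong_scale[of q k r l s 0] by (simp add: pintegral_iff add.commute)
lemma pintegral_mono: "q \<ge> 2 \<Longrightarrow> pintegral q k r \<Longrightarrow> l \<le> k \<Longrightarrow> pintegral q l r"
  unfolding pintegral_iff using pcong_mono by blast
lemma pintegral_minus: "pintegral q k r \<Longrightarrow> pintegral q k (-r)"
  unfolding pintegral_iff using pcong_minus by fastforce

lemma digit_cong:
  assumes "q \<ge> 2" "pcong q n r s" "j < n" shows "digit q r j = digit q s j"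
proof -
  have "pcong q (j+1) r s" using pcong_mono assms by simp
  then obtain z where z: "(r - s) / real q powi (j+1) = real_of_int z" by (auto simp: pcong_def elim: Ints_cases)
  have "r = s + z * real q powi (j+1)" using z assms(1) by (simp add: field_simps)
  then have "r / real q powi j = s / real q powi j + real_of_int (z * int q)"
    using assms(1) by (simp add: power_int_add add_divide_distrib)
  then have "\<lfloor>r / real q powi j\<rfloor> = \<lfloor>s / real q powi j\<rfloor> + z * int q" by (metis floor_add_int)
  then show ?thesis by (simp add: digit_def)
qed

lemma digit_fin: "q \<ge> 2 \<Longrightarrow> pintegral q k r \<Longrightarrow> j < k \<Longrightarrow> digit q r j = 0"
  using digit_cong[of q k r 0 j] by (simp add: pintegral_iff digit_def)

lemma pintegral_floor:
  assumes "q \<ge> 2" "pintegral q k r" shows "real q powi k * \<lfloor>r / real q powi k\<rfloor> = r"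
proof -
  obtain z where z: "r / real q powi k = of_int z" using assms(2) by (auto simp: pintegral_def elim: Ints_cases)
  then have "r = of_int z * real q powi k" using assms(1) by (simp add: field_simps)
  then show ?thesis using z by simp
qed

lemma trunc_digit:
  assumes "q \<ge> 2" "pintegral q k r"
  shows "padic_trunc q (digit q r) n = r - real q powi n * \<lfloor>r / real q powi n\<rfloor>"
proof (cases "k \<le> n")
  case True
  have "padic_trunc q (digit q r) n = (\<Sum>j\<in>{k..<n}. real (digit q r j) * real q powi j)"
    using assms digit_fin by (intro trunc_alt) auto
  also have "\<dots> = real q powi k * \<lfloor>r / real q powi k\<rfloor> - real q powi n * \<lfloor>r / real q powi n\<rfloor>"
    using digit_sum[OF assms(1) True] .
  also have "real q powi k * \<lfloor>r / real q powi k\<rfloor> = r"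
    using pintegral_floor assms by blast
  finally show ?thesis .
next
  case False
  then have "pintegral q n r" using pintegral_mono assms by simp
  then have "real q powi n * \<lfloor>r / real q powi n\<rfloor> = r" 
    using pintegral_floor assms by blast
  moreover have "padic_trunc q (digit q r) n = 0"
    using trunc_alt[of k "digit q r" q n] digit_fin[OF assms] False by simp
  ultimately show ?thesis by simp
qed

lemma pcong_trunc_digit:
  assumes "q \<ge> 2" "pintegral q k r" shows "pcong q n (padic_trunc q (digit q r) n) r"
  unfolding trunc_digit[OF assms] pcong_def using assms(1) by simp

lemma trunc_local: "(\<forall>j<n. x j = y j) \<Longrightarrow> padic_trunc q x n = padic_trunc q y n"
  unfolding padic_trunc_def by (rule sum.cong) auto

lemma trunc_step:
  assumes "x \<in> padics q" shows "padic_trunc q x (n+1) = padic_trunc q x n + x n * real q powi n"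
proof -
  obtain k where k: "\<forall>j<k. x j = 0" using assms by (auto simp: padics_def)
  define k' where "k' = min k n"
  have k': "\<forall>j<k'. x j = 0" "k' \<le> n" using k by (auto simp: k'_def)
  have "{k'..<n+1} = insert n {k'..<n}" using k' by auto
  then show ?thesis by (simp add: trunc_alt[OF k'(1)])
qed

lemma trunc_range:
  assumes "q \<ge> 2" "x \<in> padics q"
  shows "0 \<le> padic_trunc q x n \<and> padic_trunc q x n < real q powi n"
proof -
  obtain k where k: "\<forall>j<k. x j = 0" using assms by (auto simp: padics_def)
  show ?thesis
  proof (cases "k \<le> n")
    case False then show ?thesis using assms trunc_alt[OF k] by simp
  next
    case True then show ?thesis
    proof (induction n rule: int_ge_induct)
      case base then show ?case using assms trunc_alt[OF k] by simp
    next
      case (step n)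
      have "x n < q" using assms by (simp add: padics_def)
      then have "real (x n) \<le> real q - 1" by linarith
      then have "x n * real q powi n \<le> (real q - 1) * real q powi n" 
        using assms(1) by (intro mult_right_mono) auto
      then have "padic_trunc q x n + x n * real q powi n < real q * real q powi n"
        using step by (simp add: algebra_simps)
      moreover have "real q powi (n + 1) = real q * real q powi n" using assms(1) by (simp add: power_int_add)
      ultimately show ?case unfolding trunc_step[OF assms(2)] using step by simp
    qed
  qed
qed

lemma trunc_fin:
  assumes "q \<ge> 2" "\<forall>j<k. x j = 0" shows "pintegral q k (padic_trunc q x n)"
proof -
  have "padic_trunc q x n / real q powi k = (\<Sum>j\<in>{k..<n}. real (x j) * real q powi (j-k))"
    unfolding trunc_alt[OF assms(2)] using assms(1)
    by (simp add: sum_divide_distrib power_int_diff)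
  also have "\<dots> \<in> \<int>" by (intro Ints_sum Ints_mult powi_Int) auto
  finally show ?thesis by (simp add: pintegral_def)
qed

lemma trunc_le_cg:
  assumes "q \<ge> 2" "x \<in> padics q" "m \<le> n" shows "pcong q m (padic_trunc q x n) (padic_trunc q x m)"
  using assms(3)
proof (induction n rule: int_ge_induct)
  case base then show ?case by simp
next
  case (step n)
  have "pcong q n (padic_trunc q x (n+1)) (padic_trunc q x n)"
    using assms(1) by (simp add: pcong_def trunc_step[OF assms(2)])
  then show ?case using step pcong_mono pcong_trans assms(1) by blast
qed

lemma digit_trunc:
  assumes "q \<ge> 2" "x \<in> padics q" "j < n" shows "digit q (padic_trunc q x n) j = x j"
proof -
  have "pcong q (j+1) (padic_trunc q x n) (padic_trunc q x (j+1))" using trunc_le_cg assms by simp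
  then have "digit q (padic_trunc q x n) j = digit q (padic_trunc q x (j+1)) j" 
    using digit_cong assms(1) by (metis less_add_one)
  also have "\<lfloor>padic_trunc q x (j+1) / real q powi j\<rfloor> = x j"
    using trunc_range[OF assms(1,2), of j] assms(1)
    by (simp add: trunc_step[OF assms(2)] add_divide_distrib floor_eq_iff)
  then have "digit q (padic_trunc q x (j+1)) j = x j"
    using assms(2) by (simp add: digit_def padics_def)
  finally show ?thesis .
qed

lemma padic_eqI:
  assumes "q \<ge> 2" "x \<in> padics q" "y \<in> padics q"
    "\<And>n. pcong q n (padic_trunc q x n) (padic_trunc q y n)"
  shows "x = y"
proof
  fix j
  show "x j = y j" using digit_trunc[OF assms(1,2), of j "j+1"] digit_trunc[OF assms(1,3), of j "j+1"]
    digit_cong[OF assms(1,4), of j "j+1"] by simp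
qed

lemma seq_limit:
  assumes q: "q \<ge> 2" and f: "\<And>n. pintegral q k (s n)" and c: "\<And>m n. m \<le> n \<Longrightarrow> pcong q m (s n) (s m)"
    and z: "\<And>j. z j = digit q (s (j+1)) j"
  shows "z \<in> padics q" "pcong q n (padic_trunc q z n) (s n)" "\<forall>j<k. z j = 0"
proof -
  show *: "\<forall>j<k. z j = 0" using digit_fin[OF q f] by (simp add: z)
  then show "z \<in> padics q" using digit_less[OF q] by (auto simp: padics_def z)
  have "padic_trunc q z n = padic_trunc q (digit q (s n)) n"
  proof (rule trunc_local, intro allI impI)
    fix j assume "j < n"
    then have "pcong q (j+1) (s n) (s (j+1))" using c by simp
    then show "z j = digit q (s n) j" unfolding z using digit_cong[OF q] by (metis less_add_one)
  qed
  then show "pcong q n (padic_trunc q z n) (s n)" by (simp add: pcong_trunc_digit[OF q f])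
qed

definition papprox :: "nat \<Rightarrow> padic \<Rightarrow> real \<Rightarrow> int \<Rightarrow> bool" where
  "papprox q x r n \<longleftrightarrow> pcong q n (padic_trunc q x n) r"

lemma papprox_trunc: "q \<ge> 2 \<Longrightarrow> x \<in> padics q \<Longrightarrow> n \<le> m \<Longrightarrow> papprox q x (padic_trunc q x m) n"
  unfolding papprox_def by (rule pcong_sym[OF trunc_le_cg])

lemma papprox_mono: 
  assumes "q \<ge> 2" "x \<in> padics q" "papprox q x r n" "m \<le> n" shows "papprox q x r m"
proof -
  have "pcong q m (padic_trunc q x n) r" using pcong_mono[OF assms(1) assms(3)[unfolded papprox_def] assms(4)] .
  then show ?thesis unfolding papprox_def by (rule pcong_trans[OF pcong_sym[OF trunc_le_cg[OF assms(1,2,4)]]])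
qed

lemma papprox_eqI:
  assumes "q \<ge> 2" "x \<in> padics q" "y \<in> padics q" "\<And>n. papprox q x (r n) n" "\<And>n. papprox q y (r n) n"
  shows "x = y"
  using padic_eqI[OF assms(1-3) pcong_trans[OF assms(4)[unfolded papprox_def] pcong_sym[OF assms(5)[unfolded papprox_def]]]] .

lemma papprox_cg: "papprox q x r n \<Longrightarrow> pcong q n r s \<Longrightarrow> papprox q x s n" unfolding papprox_def by (rule pcong_trans)

lemma lo: "x \<in> padics q \<Longrightarrow> \<exists>k. \<forall>j<k. x j = 0" by (auto simp: padics_def)

lemma add_props:
  assumes q: "q \<ge> 2" and x: "x \<in> padics q" and y: "y \<in> padics q"
  shows "padic_add q x y \<in> padics q" 
    "papprox q x r n \<Longrightarrow> papprox q y s n \<Longrightarrow> papprox q (padic_add q x y) (r+s) n"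
proof -
  obtain k1 k2 where k: "\<forall>j<k1. x j = 0" "\<forall>j<k2. y j = 0" using lo x y by blast
  define k where "k = min k1 k2"
  have k: "\<forall>j<k. x j = 0" "\<forall>j<k. y j = 0" using k by (auto simp: k_def)
  let ?s = "\<lambda>n. padic_trunc q x n + padic_trunc q y n"
  have 1: "\<And>n. pintegral q k (?s n)" by (intro pintegral_add trunc_fin[OF q] k)
  have 2: "\<And>m n. m \<le> n \<Longrightarrow> pcong q m (?s n) (?s m)" by (intro pcong_add trunc_le_cg[OF q] x y)
  note * = seq_limit[OF q 1 2, of "padic_add q x y"]
  show "padic_add q x y \<in> padics q" by (rule *(1), assumption, simp add: padic_add_def)
  have "pcong q n (padic_trunc q (padic_add q x y) n) (?s n)" for n by (rule *(2), assumption, simp add: padic_add_def)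
  then show "papprox q (padic_add q x y) (r+s) n" if "papprox q x r n" "papprox q y s n"
    unfolding papprox_def by (rule pcong_trans) (rule pcong_add[OF that[unfolded papprox_def]])
qed

lemma int_least:
  assumes "\<forall>j<(k::int). \<not> P j" "P j0" shows "\<exists>m. P m \<and> (\<forall>j<m. \<not> P j)"
proof -
  have "k \<le> j0" using assms by force
  define N where "N = (LEAST n::nat. P (k + int n))"
  have ex: "P (k + int (nat (j0 - k)))" using assms \<open>k \<le> j0\<close> by simp
  have "P (k + int N)" unfolding N_def by (rule LeastI, rule ex)
  moreover have "\<not> P j" if "j < k + int N" for j
  proof
    assume P: "P j"
    then have "k \<le> j" using assms by force
    then have "P (k + int (nat (j - k)))" using P by simp
    then have "N \<le> nat (j - k)" unfolding N_def by (rule Least_le)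
    then show False using that \<open>k \<le> j\<close> by linarith
  qed
  ultimately show ?thesis by blast
qed

lemma ord_props:
  assumes "x \<in> padics q" "x \<noteq> padic_zero"
  shows "x (padic_ord x) \<noteq> 0" "\<forall>j<padic_ord x. x j = 0"
proof -
  obtain k where k: "\<forall>j<k. x j = 0" using lo assms by blast
  obtain j0 where "x j0 \<noteq> 0" using assms by (auto simp: padic_zero_def)
  then obtain m where m: "x m \<noteq> 0" "\<forall>j<m. x j = 0" using int_least[of k "\<lambda>j. x j \<noteq> 0" j0] k by auto
  have "padic_ord x = m" unfolding padic_ord_def
  proof (rule the_equality)
    show "x m \<noteq> 0 \<and> (\<forall>j<m. x j = 0)" using m by blast
    fix k' assume k': "x k' \<noteq> 0 \<and> (\<forall>j<k'. x j = 0)"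
    have "\<not> k' < m" using m k' by auto
    moreover have "\<not> m < k'" using m k' by auto
    ultimately show "k' = m" by simp
  qed
  then show "x (padic_ord x) \<noteq> 0" "\<forall>j<padic_ord x. x j = 0" using m by auto
qed

lemma ord_ge:
  assumes "x \<in> padics q" "x \<noteq> padic_zero" "\<forall>j<k. x j = 0" shows "k \<le> padic_ord x"
  proof (rule ccontr)
  assume "\<not> k \<le> padic_ord x"
  then show False using ord_props(1)[OF assms(1,2)] assms(3) by simp
qed

lemma trunc_zero[simp]: "padic_trunc q padic_zero n = 0" by (simp add: padic_trunc_def padic_zero_def)
lemma zero_in[simp]: "q \<ge> 2 \<Longrightarrow> padic_zero \<in> padics q" by (auto simp: padics_def padic_zero_def)

lemma mult_zero: "padic_mult q padic_zero y = padic_zero" "padic_mult q y padic_zero = padic_zero"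
  unfolding padic_mult_def Let_def trunc_zero mult_zero_left mult_zero_right
  by (simp_all add: digit_def padic_zero_def)

lemma papprox_fin:
  assumes "q \<ge> 2" "papprox q x r n" "\<forall>j<k. x j = 0" "k \<le> n" shows "pintegral q k r"
proof -
  have "pcong q k (padic_trunc q x n) r" using pcong_mono[OF assms(1) assms(2)[unfolded papprox_def] assms(4)] .
  then show ?thesis using trunc_fin[OF assms(1,3), of n] unfolding pintegral_iff by (rule pcong_trans[OF pcong_sym])
qed

lemma mult_props:
  assumes q: "q \<ge> 2" and x: "x \<in> padics q" and y: "y \<in> padics q" 
    and k: "\<forall>j<k. x j = 0" "\<forall>j<k. y j = 0"
  shows "padic_mult q x y \<in> padics q" "\<forall>j<2*k. padic_mult q x y j = 0"
    "k \<le> n \<Longrightarrow> papprox q x r n \<Longrightarrow> papprox q y s n \<Longrightarrow> papprox q (padic_mult q x y) (r * s) (n+k)"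
proof -
  have a: "padic_mult q x y \<in> padics q \<and> (\<forall>j<2*k. padic_mult q x y j = 0) \<and>
    (\<forall>n\<ge>k. papprox q (padic_mult q x y) (padic_trunc q x n * padic_trunc q y n) (n+k))"
  proof (cases "x = padic_zero \<or> y = padic_zero")
    case True
    then have m: "padic_mult q x y = padic_zero" using mult_zero by auto
    have "padic_trunc q x n * padic_trunc q y n = 0" for n using True by auto
    then have "papprox q padic_zero (padic_trunc q x n * padic_trunc q y n) (n+k)" for n by (simp only: papprox_def trunc_zero pcong_refl)
    moreover have "padic_zero j = 0" for j by (simp add: padic_zero_def)
    ultimately show ?thesis unfolding m using zero_in[OF q] by blast
  next
    case False
    define e where "e = min (padic_ord x) (padic_ord y)"
    have e: "\<forall>j<e. x j = 0" "\<forall>j<e. y j = 0" using ord_props x y False by (auto simp: e_def)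
    have ke: "k \<le> e" using ord_ge x y False k by (auto simp: e_def)
    let ?s = "\<lambda>n. padic_trunc q x (n-e) * padic_trunc q y (n-e)"
    have 1: "\<And>n. pintegral q (e+e) (?s n)" by (intro pintegral_mult trunc_fin[OF q] e q)
    have 2: "\<And>m n. m \<le> n \<Longrightarrow> pcong q m (?s n) (?s m)"
    proof -
      fix m n :: int assume "m \<le> n"
      then have "pcong q ((m-e)+e) (?s n) (?s m)" 
        by (intro pcong_mult[OF q] trunc_le_cg[OF q] x y trunc_fin[OF q] e) auto
      then show "pcong q m (?s n) (?s m)" by simp
    qed
    note * = seq_limit[OF q 1 2, of "padic_mult q x y"]
    have z: "padic_mult q x y j = digit q (?s (j+1)) j" for j by (simp add: padic_mult_def Let_def e_def)
    have A: "padic_mult q x y \<in> padics q" by (rule *(1), assumption, rule z)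
    have B: "\<forall>j<e+e. padic_mult q x y j = 0" by (rule *(3), assumption, rule z)
    have C: "papprox q (padic_mult q x y) (?s n) n" for n unfolding papprox_def by (rule *(2), assumption, rule z)
    have "papprox q (padic_mult q x y) (padic_trunc q x n * padic_trunc q y n) (n+k)" for n
      using papprox_mono[OF q A C[of "n+e"], of "n+k"] ke by simp
    then show ?thesis using A B ke by auto
  qed
  then show "padic_mult q x y \<in> padics q" "\<forall>j<2*k. padic_mult q x y j = 0" by auto
  have *: "k \<le> n \<Longrightarrow> papprox q (padic_mult q x y) (padic_trunc q x n * padic_trunc q y n) (n+k)" using a by auto
  assume "k \<le> n" and r: "papprox q x r n" "papprox q y s n"
  have "pcong q (n+k) (padic_trunc q x n * padic_trunc q y n) (r * s)"
    using r by (intro pcong_mult[OF q] trunc_fin[OF q k(1)] papprox_fin[OF q r(2) k(2) \<open>k\<le>n\<close>]) (simp_all add: papprox_def)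
  then show "papprox q (padic_mult q x y) (r * s) (n+k)" by (rule papprox_cg[OF *[OF \<open>k \<le> n\<close>]])
qed


definition pneg :: "nat \<Rightarrow> padic \<Rightarrow> padic" where
  "pneg q x = (\<lambda>j. digit q (- padic_trunc q x (j + 1)) j)"

lemma neg_props:
  assumes q: "q \<ge> 2" and x: "x \<in> padics q"
  shows "pneg q x \<in> padics q" "papprox q x r n \<Longrightarrow> papprox q (pneg q x) (- r) n"
proof -
  obtain k where k: "\<forall>j<k. x j = 0" using lo x by blast
  let ?s = "\<lambda>n. - padic_trunc q x n"
  have 1: "\<And>n. pintegral q k (?s n)" by (intro pintegral_minus trunc_fin[OF q] k)
  have 2: "\<And>m n. m \<le> n \<Longrightarrow> pcong q m (?s n) (?s m)" by (intro pcong_minus trunc_le_cg[OF q] x)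
  note * = seq_limit[OF q 1 2, of "pneg q x"]
  show "pneg q x \<in> padics q" by (rule *(1), assumption, simp add: pneg_def)
  have "pcong q n (padic_trunc q (pneg q x) n) (?s n)" for n by (rule *(2), assumption, simp add: pneg_def)
  then show "papprox q (pneg q x) (- r) n" if "papprox q x r n"
    unfolding papprox_def by (rule pcong_trans) (rule pcong_minus[OF that[unfolded papprox_def]])
qed

lemma one_in[simp]: "q \<ge> 2 \<Longrightarrow> padic_one \<in> padics q" by (auto simp: padics_def padic_one_def intro: exI[of _ 0])

lemma trunc_one: "padic_trunc q padic_one n = (if 0 < n then 1 else 0)"
proof -
  have "{j. j < n \<and> padic_one j \<noteq> 0} = (if 0 < n then {0} else {})" by (auto simp: padic_one_def)
  then show ?thesis by (simp add: padic_trunc_def padic_one_def)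
qed

lemma papprox_one: "q \<ge> 2 \<Longrightarrow> papprox q padic_one 1 n"
  using powi_Int[of "-n" q] by (auto simp: papprox_def trunc_one pcong_def power_int_minus divide_inverse)

lemma papprox_zero: "papprox q padic_zero 0 n" by (simp add: papprox_def)

lemma lo1: "x \<in> padics q \<Longrightarrow> \<exists>k\<le>0. \<forall>j<k. x j = 0"
  using lo by (metis le_less_trans linear min.cobounded1 min_def order.strict_trans2)

lemma lo3:
  assumes "x \<in> padics q" "y \<in> padics q" "z \<in> padics q"
  shows "\<exists>k\<le>0. (\<forall>j<k. x j = 0) \<and> (\<forall>j<k. y j = 0) \<and> (\<forall>j<k. z j = 0)"
proof -
  obtain a where "a \<le> 0" "\<forall>j<a. x j = 0" using lo1 assms(1) by blast
  moreover obtain b where "\<forall>j<b. y j = 0" using lo assms(2) by blast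
  moreover obtain c where "\<forall>j<c. z j = 0" using lo assms(3) by blast
  ultimately show ?thesis by (intro exI[of _ "min a (min b c)"]) auto
qed

lemma mult_comm: "padic_mult q x y = padic_mult q y x"
  unfolding padic_mult_def Let_def by (simp add: min.commute mult.commute)

lemma mult_cl: "q \<ge> 2 \<Longrightarrow> x \<in> padics q \<Longrightarrow> y \<in> padics q \<Longrightarrow> padic_mult q x y \<in> padics q"
  using lo3[of x q y x] mult_props(1) by blast

lemma mult_assoc:
  assumes q: "q \<ge> 2" and x: "x \<in> padics q" and y: "y \<in> padics q" and z: "z \<in> padics q"
  shows "padic_mult q (padic_mult q x y) z = padic_mult q x (padic_mult q y z)"
proof -
  obtain k where k0: "k \<le> 0" and k: "\<forall>j<k. x j = 0" "\<forall>j<k. y j = 0" "\<forall>j<k. z j = 0"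
    using lo3[OF x y z] by blast
  have k2: "\<forall>j<2*k. x j = 0" "\<forall>j<2*k. z j = 0" using k k0 by auto
  have cl: "padic_mult q x y \<in> padics q" "padic_mult q y z \<in> padics q" using mult_cl x y z q by auto
  have m: "\<forall>j<2*k. padic_mult q x y j = 0" "\<forall>j<2*k. padic_mult q y z j = 0"
    using mult_props(2)[OF q] x y z k by auto
  define M where "M N = max N 0 - 3 * k" for N
  have M: "k \<le> M N" "2 * k \<le> M N + k" "M N + k \<le> M N" "N \<le> M N + k + 2 * k" for N using k0 by (auto simp: M_def)
  let ?r = "\<lambda>N. padic_trunc q x (M N)" let ?s = "\<lambda>N. padic_trunc q y (M N)" let ?t = "\<lambda>N. padic_trunc q z (M N)"
  have L: "papprox q (padic_mult q (padic_mult q x y) z) (?r N * ?s N * ?t N) N" for N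
  proof -
    have "papprox q (padic_mult q x y) (?r N * ?s N) (M N + k)"
      by (rule mult_props(3)[OF q x y k(1,2) M(1)]) (simp_all add: papprox_trunc q x y)
    moreover have "papprox q z (?t N) (M N + k)" using papprox_trunc[OF q z M(3)] .
    ultimately have "papprox q (padic_mult q (padic_mult q x y) z) (?r N * ?s N * ?t N) (M N + k + 2 * k)"
      by (rule mult_props(3)[OF q cl(1) z m(1) k2(2) M(2)])
    then show ?thesis using papprox_mono[OF q mult_cl[OF q cl(1) z] _ M(4)] by blast
  qed
  have R: "papprox q (padic_mult q x (padic_mult q y z)) (?r N * ?s N * ?t N) N" for N
  proof -
    have "papprox q (padic_mult q y z) (?s N * ?t N) (M N + k)"
      by (rule mult_props(3)[OF q y z k(2,3) M(1)]) (simp_all add: papprox_trunc q y z)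
    moreover have "papprox q x (?r N) (M N + k)" using papprox_trunc[OF q x M(3)] .
    ultimately have "papprox q (padic_mult q x (padic_mult q y z)) (?r N * (?s N * ?t N)) (M N + k + 2 * k)"
      using mult_props(3)[OF q x cl(2) k2(1) m(2) M(2)] by blast
    then show ?thesis using papprox_mono[OF q mult_cl[OF q x cl(2)] _ M(4)] by (simp add: mult.assoc)
  qed
  show ?thesis by (rule papprox_eqI[OF q mult_cl[OF q cl(1) z] mult_cl[OF q x cl(2)] L R])
qed

lemma mult_one:
  assumes q: "q \<ge> 2" and x: "x \<in> padics q" shows "padic_mult q padic_one x = x"
proof -
  obtain k where k0: "k \<le> 0" and k: "\<forall>j<k. x j = 0" using lo1[OF x] by blast
  have k1: "\<forall>j<k. padic_one j = 0" using k0 by (auto simp: padic_one_def)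
  define M where "M N = max N 0 - k" for N
  have M: "k \<le> M N" "N \<le> M N" "N \<le> M N + k" for N using k0 by (auto simp: M_def)
  have L: "papprox q (padic_mult q padic_one x) (1 * padic_trunc q x (M N)) N" for N
  proof -
    have "papprox q (padic_mult q padic_one x) (1 * padic_trunc q x (M N)) (M N + k)"
      by (rule mult_props(3)[OF q one_in[OF q] x k1 k M(1) papprox_one[OF q]]) (simp add: papprox_trunc q x)
    then show ?thesis using papprox_mono[OF q mult_cl[OF q one_in[OF q] x] _ M(3)] by blast
  qed
  have R: "papprox q x (1 * padic_trunc q x (M N)) N" for N using papprox_trunc[OF q x M(2)] by simp
  show ?thesis by (rule papprox_eqI[OF q mult_cl[OF q one_in[OF q] x] x L R])
qed

lemma padic_distr:
  assumes q: "q \<ge> 2" and x: "x \<in> padics q" and y: "y \<in> padics q" and z: "z \<in> padics q"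
  shows "padic_mult q (padic_add q x y) z = padic_add q (padic_mult q x z) (padic_mult q y z)"
proof -
  obtain k where k0: "k \<le> 0" and k: "\<forall>j<k. x j = 0" "\<forall>j<k. y j = 0" "\<forall>j<k. z j = 0"
    using lo3[OF x y z] by blast
  note a = add_props(1)[OF q]
  obtain l where l0: "l \<le> 0" and l: "\<forall>j<l. padic_add q x y j = 0" using lo1 a[OF x y] by blast
  define e where "e = min k l"
  have e0: "e \<le> 0" and e: "\<forall>j<e. x j = 0" "\<forall>j<e. y j = 0" "\<forall>j<e. z j = 0" "\<forall>j<e. padic_add q x y j = 0"
    using k k0 l by (auto simp: e_def)
  define M where "M N = max N 0 - e" for N
  have M: "e \<le> M N" "N \<le> M N" "N \<le> M N + e" for N using e0 by (auto simp: M_def)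
  let ?r = "\<lambda>N. padic_trunc q x (M N)" let ?s = "\<lambda>N. padic_trunc q y (M N)" let ?t = "\<lambda>N. padic_trunc q z (M N)"
  note t = papprox_trunc[OF q x order_refl] papprox_trunc[OF q y order_refl] papprox_trunc[OF q z order_refl]
  note c = mult_cl[OF q a[OF x y] z] a[OF mult_cl[OF q x z] mult_cl[OF q y z]]
  have L: "papprox q (padic_mult q (padic_add q x y) z) ((?r N + ?s N) * ?t N) N" for N
    by (rule papprox_mono[OF q c(1) mult_props(3)[OF q a[OF x y] z e(4,3) M(1) add_props(2)[OF q x y t(1,2)] t(3)] M(3)])
  have R: "papprox q (padic_add q (padic_mult q x z) (padic_mult q y z)) ((?r N + ?s N) * ?t N) N" for N
    unfolding distrib_right
    by (rule papprox_mono[OF q c(2) add_props(2)[OF q mult_cl[OF q x z] mult_cl[OF q y z]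
      mult_props(3)[OF q x z e(1,3) M(1) t(1,3)] mult_props(3)[OF q y z e(2,3) M(1) t(2,3)]] M(3)])
  show ?thesis by (rule papprox_eqI[OF q c L R])
qed

lemma add_eqI: 
  assumes "q \<ge> 2" "x \<in> padics q" "y \<in> padics q" "\<And>n. \<exists>r. papprox q x r n \<and> papprox q y r n" shows "x = y"
proof -
  obtain r where "\<And>n. papprox q x (r n) n \<and> papprox q y (r n) n" using assms(4) by metis
  then show ?thesis using papprox_eqI[OF assms(1-3), of r] by blast
qed

lemma cring_Qp:
  assumes q: "q \<ge> 2" shows "cring (Qp q)"
proof (rule cringI)
  note a = add_props(1)[OF q]
  show "abelian_group (Qp q)"
  proof (rule abelian_groupI; simp add: Qp_def a q)
    fix x y assume x: "x \<in> padics q" and y: "y \<in> padics q" 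
    show "padic_add q x y = padic_add q y x" by (simp add: padic_add_def add.commute)
    fix z assume z: "z \<in> padics q"
    show "padic_add q (padic_add q x y) z = padic_add q x (padic_add q y z)"
    proof (rule add_eqI[OF q a[OF a[OF x y] z] a[OF x a[OF y z]]], intro exI conjI)
      fix n
      note t = papprox_trunc[OF q x order_refl, of n] papprox_trunc[OF q y order_refl, of n] papprox_trunc[OF q z order_refl, of n]
      let ?u = "padic_trunc q x n + padic_trunc q y n + padic_trunc q z n"
      show "papprox q (padic_add q (padic_add q x y) z) ?u n"
        by (rule add_props(2)[OF q a[OF x y] z add_props(2)[OF q x y t(1,2)] t(3)])
      show "papprox q (padic_add q x (padic_add q y z)) ?u n"
        unfolding add.assoc by (rule add_props(2)[OF q x a[OF y z] t(1) add_props(2)[OF q y z t(2,3)]])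
    qed
  next
    fix x assume x: "x \<in> padics q"
    note t = papprox_trunc[OF q x order_refl]
    show "padic_add q padic_zero x = x"
    proof (rule add_eqI[OF q a[OF zero_in[OF q] x] x], intro exI conjI)
      fix n show "papprox q x (0 + padic_trunc q x n) n" using t by simp
      show "papprox q (padic_add q padic_zero x) (0 + padic_trunc q x n) n" by (rule add_props(2)[OF q zero_in[OF q] x papprox_zero t])
    qed
    show "\<exists>y\<in>padics q. padic_add q y x = padic_zero"
    proof (rule bexI[OF _ neg_props(1)[OF q x]])
      show "padic_add q (pneg q x) x = padic_zero"
      proof (rule add_eqI[OF q a[OF neg_props(1)[OF q x] x] zero_in[OF q]], intro exI conjI)
        fix n show "papprox q padic_zero (- padic_trunc q x n + padic_trunc q x n) n" using papprox_zero by simp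
        show "papprox q (padic_add q (pneg q x) x) (- padic_trunc q x n + padic_trunc q x n) n" 
          by (rule add_props(2)[OF q neg_props(1)[OF q x] x neg_props(2)[OF q x t] t])
      qed
    qed
  qed
  show "comm_monoid (Qp q)"
    by (rule comm_monoidI; simp add: Qp_def mult_cl q mult_assoc mult_one; rule mult_comm)
  fix x y z assume "x \<in> carrier (Qp q)" "y \<in> carrier (Qp q)" "z \<in> carrier (Qp q)"
  then show "(x \<oplus>\<^bsub>Qp q\<^esub> y) \<otimes>\<^bsub>Qp q\<^esub> z = x \<otimes>\<^bsub>Qp q\<^esub> z \<oplus>\<^bsub>Qp q\<^esub> y \<otimes>\<^bsub>Qp q\<^esub> z"
    using padic_distr[OF q] by (simp add: Qp_def)
qed

lemma padic_inverse:
  assumes q: "prime q" and x: "x \<in> padics q" and x0: "x \<noteq> padic_zero"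
  shows "\<exists>y\<in>padics q. padic_mult q x y = padic_one"
proof -
  have q2: "q \<ge> 2" using q prime_ge_2_nat by blast
  define v where "v = padic_ord x"
  have v: "x v \<noteq> 0" "\<forall>j<v. x j = 0" using ord_props[OF x x0] by (auto simp: v_def)
  define u :: "nat \<Rightarrow> int" where "u m = \<lfloor>padic_trunc q x (v + int m) / real q powi v\<rfloor>" for m
  have u: "padic_trunc q x (v + int m) = u m * real q powi v" for m
    using pintegral_floor[OF q2 trunc_fin[OF q2 v(2)], of "v + int m"] by (simp add: u_def mult.commute)
  have P: "real q powi v > 0" using q2 by simp
  have udvd: "int q ^ m dvd u n - u m" if mn: "m \<le> n" for m n
  proof -
    have "pcong q (v + int m) (padic_trunc q x (v + int n)) (padic_trunc q x (v + int m))"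
      using mn by (intro trunc_le_cg[OF q2 x]) simp
    then obtain z where "(u n * real q powi v - u m * real q powi v) / real q powi (v + int m) = of_int z"
      unfolding pcong_def u by (auto elim: Ints_cases)
    then have "u n * real q powi v - u m * real q powi v = of_int z * real q powi (v + int m)" using q2 by (simp add: field_simps)
    then have "real_of_int (u n - u m) * real q powi v = (of_int z * real q ^ m) * real q powi v" using q2
      by (simp add: power_int_add algebra_simps)
    then have "real_of_int (u n - u m) = of_int z * real q ^ m" using P by (metis mult_right_cancel less_irrefl)
    then have "u n - u m = z * int q ^ m" by (metis of_int_eq_iff of_int_mult of_int_of_nat_eq of_int_power)
    then show ?thesis by simp
  qed
  have u1: "u 1 = int (x v)"
    using trunc_step[OF x, of v] trunc_alt[OF v(2), of q v] P q2 unfolding u_def by simp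
  have cop: "coprime (u m) (int q ^ m)" if "m \<ge> 1" for m
  proof -
    have "\<not> int q dvd int (x v)"
    proof
      assume "int q dvd int (x v)"
      then have "q \<le> x v" using v(1) dvd_imp_le by auto
      then show False using x by (auto simp: padics_def not_le[symmetric])
    qed
    moreover have "int q dvd u m - u 1" using udvd[OF that] by simp
    ultimately have "\<not> int q dvd u m" using u1 by (metis dvd_diff_right_iff)
    then have "coprime (int q) (u m)" using prime_imp_coprime[of "int q" "u m"] q by simp
    then show ?thesis by (simp add: coprime_commute)
  qed
  have "\<exists>w. m \<ge> 1 \<longrightarrow> int q ^ m dvd u m * w - 1" for m
  proof (cases "m \<ge> 1")
    case True
    then obtain a b where "a * u m + b * int q ^ m = 1" using cop[OF True] bezout_int[of "u m" "int q ^ m"] by (auto simp: coprime_iff_gcd_eq_1)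
    then have "u m * a - 1 = int q ^ m * (- b)" by (simp add: algebra_simps)
    then show ?thesis by (intro exI[of _ a]) simp
  qed auto
  then obtain w0 where w0: "\<And>m. m \<ge> 1 \<Longrightarrow> int q ^ m dvd u m * w0 m - 1" by metis
  define w where "w m = (if m = 0 then 0 else w0 m)" for m
  have w: "int q ^ m dvd u m * w m - 1" for m using w0 by (cases "m = 0") (auto simp: w_def)
  have wu: "int q ^ m dvd u n * w n' - 1" if "m \<le> n" "m \<le> n'" for m n n'
  proof -
    have "int q ^ m dvd u n' * w n' - 1" using w[of n'] that by (meson dvd_trans le_imp_power_dvd)
    moreover have "int q ^ m dvd (u n - u m) - (u n' - u m)" by (rule dvd_diff[OF udvd[OF that(1)] udvd[OF that(2)]])
    then have "int q ^ m dvd (u n - u n') * w n'" by simp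
    ultimately have "int q ^ m dvd (u n' * w n' - 1) + (u n - u n') * w n'" by (rule dvd_add)
    then show ?thesis by (simp add: algebra_simps)
  qed
  have wdvd: "int q ^ m dvd w n - w m" if "m \<le> n" for m n
  proof -
    have "int q ^ m dvd (u m * w n - 1) - (u m * w m - 1)" by (rule dvd_diff[OF wu[OF order_refl that] w])
    then have "int q ^ m dvd u m * (w n - w m)" by (simp add: algebra_simps)
    then show ?thesis using cop[of m] by (cases "m = 0") (auto simp: coprime_dvd_mult_right_iff coprime_commute)
  qed
  define s where "s n = w (nat (n + v)) * real q powi (- v)" for n
  have 1: "\<And>n. pintegral q (- v) (s n)" using q2 by (simp add: pintegral_def s_def)
  have 2: "\<And>m n. m \<le> n \<Longrightarrow> pcong q m (s n) (s m)"
  proof -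
    fix m n :: int assume mn: "m \<le> n"
    show "pcong q m (s n) (s m)"
    proof (cases "m + v \<le> 0")
      case True
      have "pintegral q m (s n)" "pintegral q m (s m)" using pintegral_mono[OF q2 1, of m] True by auto
      then show ?thesis unfolding pintegral_iff using pcong_trans pcong_sym by blast
    next
      case False
      obtain z where z: "w (nat (n+v)) - w (nat (m+v)) = int q ^ nat (m+v) * z" using wdvd[OF nat_mono, of "m+v" "n+v"] mn by (auto simp: dvd_def)
      have "s n - s m = real_of_int (w (nat (n+v)) - w (nat (m+v))) * real q powi (-v)" by (simp add: s_def algebra_simps)
      also have "\<dots> = z * (real q ^ nat (m+v) * real q powi (-v))" unfolding z by simp
      also have "real q ^ nat (m+v) = real q powi (m + v)" using False by (simp add: power_int_def)
      also have "real q powi (m + v) * real q powi (-v) = real q powi m" using q2 by (simp add: power_int_add power_int_minus)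
      finally show ?thesis using q2 by (simp add: pcong_def)
    qed
  qed
  define y where "y = (\<lambda>j. digit q (s (j+1)) j)"
  have y: "y \<in> padics q" by (rule seq_limit(1)[OF q2 1 2], assumption, simp add: y_def)
  have apy: "papprox q y (s n) n" for n unfolding papprox_def by (rule seq_limit(2)[OF q2 1 2], assumption, simp add: y_def)
  have yl: "\<forall>j< - v. y j = 0" by (rule seq_limit(3)[OF q2 1 2], assumption, simp add: y_def)
  define k where "k = - \<bar>v\<bar>"
  have k: "\<forall>j<k. x j = 0" "\<forall>j<k. y j = 0" "k \<le> 0" using v(2) yl by (auto simp: k_def)
  have one: "papprox q (padic_mult q x y) 1 N" for N
  proof -
    define n where "n = max N 0 - k"
    have n: "k \<le> n" "N \<le> n + k" "n - v \<ge> 0" "n + v \<ge> 0" "n - v \<ge> n + k" "n + v \<ge> n + k" using k by (auto simp: n_def k_def)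
    have nk: "n + k \<ge> 0" by (simp add: n_def)
    have A: "papprox q (padic_mult q x y) (padic_trunc q x n * s n) (n+k)"
      by (rule mult_props(3)[OF q2 x y k(1,2) n(1) papprox_trunc[OF q2 x order_refl] apy])
    have "padic_trunc q x n = u (nat (n - v)) * real q powi v" using u[of "nat (n - v)"] n by simp
    then have e: "padic_trunc q x n * s n = real_of_int (u (nat (n-v)) * w (nat (n+v)))" using P right_inverse[OF less_imp_neq[OF P, symmetric]] by (simp add: s_def power_int_minus del: right_inverse)
    obtain z where z: "u (nat (n-v)) * w (nat (n+v)) - 1 = int q ^ nat (n+k) * z"
      using wu[OF nat_mono nat_mono, OF n(5,6)] by (auto simp: dvd_def)
    have "padic_trunc q x n * s n - 1 = real_of_int (u (nat (n-v)) * w (nat (n+v)) - 1)" unfolding e by simp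
    also have "\<dots> = z * real q powi (n+k)" unfolding z using nk by (simp add: power_int_def)
    finally have "pcong q (n+k) (padic_trunc q x n * s n) 1" using q2 by (simp add: pcong_def)
    then show ?thesis using papprox_mono[OF q2 mult_cl[OF q2 x y] papprox_cg[OF A] n(2)] by blast
  qed
  have "padic_mult q x y = padic_one"
    by (rule papprox_eqI[OF q2 mult_cl[OF q2 x y] one_in[OF q2] one papprox_one[OF q2]])
  then show ?thesis using y by blast
qed

lemma field_Qp:
  assumes "prime q" shows "field (Qp q)"
proof -
  have q2: "q \<ge> 2" using assms prime_ge_2_nat by blast
  interpret cring "Qp q" by (rule cring_Qp[OF q2])
  show ?thesis
  proof (rule cring_fieldI2)
    show "\<zero>\<^bsub>Qp q\<^esub> \<noteq> \<one>\<^bsub>Qp q\<^esub>" by (auto simp: Qp_def padic_zero_def padic_one_def fun_eq_iff)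
    fix x assume "x \<in> carrier (Qp q)" "x \<noteq> \<zero>\<^bsub>Qp q\<^esub>"
    then show "\<exists>y\<in>carrier (Qp q). x \<otimes>\<^bsub>Qp q\<^esub> y = \<one>\<^bsub>Qp q\<^esub>"
      using padic_inverse[OF assms] by (simp add: Qp_def)
  qed
qed


lemma Qp_simps: "carrier (Qp q) = padics q" "x \<oplus>\<^bsub>Qp q\<^esub> y = padic_add q x y" "\<zero>\<^bsub>Qp q\<^esub> = padic_zero"
  by (simp_all add: Qp_def)

lemma norm_le_iff:
  assumes q: "q \<ge> 2" and z: "z \<in> padics q"
  shows "padic_norm q z \<le> real q powi (- b) \<longleftrightarrow> (\<forall>j<b. z j = 0)"
proof (cases "z = padic_zero")
  case True then show ?thesis using q by (simp add: padic_norm_def padic_zero_def)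
next
  case False
  have "padic_norm q z \<le> real q powi (- b) \<longleftrightarrow> b \<le> padic_ord z"
  proof
    assume "padic_norm q z \<le> real q powi (- b)"
    then have le: "real q powi (- padic_ord z) \<le> real q powi (- b)" using False by (simp add: padic_norm_def)
    show "b \<le> padic_ord z"
    proof (rule ccontr)
      assume "\<not> b \<le> padic_ord z"
      then have "real q powi (- b) < real q powi (- padic_ord z)" using q by (intro power_int_strict_increasing) auto
      then show False using le by simp
    qed
  next
    assume "b \<le> padic_ord z"
    then have "real q powi (- padic_ord z) \<le> real q powi (- b)" using q by (intro power_int_increasing) auto
    then show "padic_norm q z \<le> real q powi (- b)" using False by (simp add: padic_norm_def)
  qed
  also have "\<dots> \<longleftrightarrow> (\<forall>j<b. z j = 0)" 
    using ord_props(2)[OF z False] ord_ge[OF z False] by auto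
  finally show ?thesis .
qed

lemma uminus_Qp:
  assumes q: "q \<ge> 2" and x: "x \<in> padics q" shows "\<ominus>\<^bsub>Qp q\<^esub> x = pneg q x"
proof -
  interpret cring "Qp q" by (rule cring_Qp[OF q])
  have "padic_add q (pneg q x) x = padic_zero"
  proof (rule add_eqI[OF q add_props(1)[OF q neg_props(1)[OF q x] x] zero_in[OF q]], intro exI conjI)
    fix n 
    note t = papprox_trunc[OF q x order_refl]
    show "papprox q padic_zero (- padic_trunc q x n + padic_trunc q x n) n" using papprox_zero by simp
    show "papprox q (padic_add q (pneg q x) x) (- padic_trunc q x n + padic_trunc q x n) n" 
      by (rule add_props(2)[OF q neg_props(1)[OF q x] x neg_props(2)[OF q x t] t])
  qed
  then show ?thesis using minus_equality[of "pneg q x" x] x neg_props(1)[OF q x] by (simp add: Qp_def)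
qed

lemma ball_eq:
  assumes q: "q \<ge> 2" and c: "c \<in> padics q"
  shows "padic_cball q c b = {x \<in> padics q. \<forall>j<b. x j = c j}"
proof -
  have "padic_norm q (x \<ominus>\<^bsub>Qp q\<^esub> c) \<le> real q powi (- b) \<longleftrightarrow> (\<forall>j<b. x j = c j)" if x: "x \<in> padics q" for x
  proof -
    let ?z = "padic_add q x (pneg q c)"
    have z: "?z \<in> padics q" using add_props(1)[OF q x neg_props(1)[OF q c]] .
    have "x \<ominus>\<^bsub>Qp q\<^esub> c = ?z" unfolding a_minus_def uminus_Qp[OF q c] by (simp add: Qp_def)
    moreover have ap: "papprox q ?z (padic_trunc q x b + - padic_trunc q c b) b"
      by (intro add_props(2)[OF q x neg_props(1)[OF q c]] neg_props(2)[OF q c] papprox_trunc q x c order_refl)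
    have "(\<forall>j<b. ?z j = 0) \<longleftrightarrow> (\<forall>j<b. x j = c j)"
    proof
      assume "\<forall>j<b. ?z j = 0"
      then have "padic_trunc q ?z b = 0" using trunc_alt[of b ?z q b] by simp
      then have "pcong q b (padic_trunc q x b + - padic_trunc q c b) 0" using ap pcong_sym by (simp add: papprox_def)
      then have "pcong q b (padic_trunc q x b) (padic_trunc q c b)" by (simp add: pcong_def)
      then show "\<forall>j<b. x j = c j" using digit_cong[OF q] digit_trunc[OF q x] digit_trunc[OF q c] by metis
    next
      assume "\<forall>j<b. x j = c j"
      then have "padic_trunc q x b = padic_trunc q c b" by (rule trunc_local)
      then have "pcong q b (padic_trunc q ?z b) 0" using ap by (simp add: papprox_def)
      then have "digit q (padic_trunc q ?z b) j = digit q 0 j" if "j < b" for j using digit_cong[OF q _ that] by blast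
      then show "\<forall>j<b. ?z j = 0" by (simp add: digit_trunc[OF q z]) (simp add: digit_def)
    qed
    ultimately show ?thesis using norm_le_iff[OF q z] by simp
  qed
  then show ?thesis by (auto simp: padic_cball_def Qp_def)
qed

lemma Zp_eq: "q \<ge> 2 \<Longrightarrow> Zp q = padic_cball q padic_zero 0"
  using norm_le_iff[of q _ 0] by (auto simp: Zp_def ball_eq) (auto simp: Qp_def padic_zero_def)

lemma space_pb: "space (padic_borel q) = padics q"
  unfolding padic_borel_def by (subst space_measure_of) (auto simp: padic_cball_def Qp_def)

lemma sets_pb: "sets (padic_borel q) = sigma_sets (padics q) {padic_cball q c b |c b. c \<in> padics q}"
  unfolding padic_borel_def by (subst sets_measure_of) (auto simp: padic_cball_def Qp_def)

lemma ball_sets: "c \<in> padics q \<Longrightarrow> padic_cball q c b \<in> sets (padic_borel q)"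
  unfolding sets_pb by (rule sigma_sets.Basic) blast

lemma measurable_pb:
  assumes "\<And>t. t \<in> space M \<Longrightarrow> f t \<in> padics q"
    "\<And>c b. c \<in> padics q \<Longrightarrow> f -` padic_cball q c b \<inter> space M \<in> sets M"
  shows "f \<in> measurable M (padic_borel q)"
  unfolding padic_borel_def
  by (rule measurable_measure_of) (use assms in \<open>auto simp: Qp_def padic_cball_def\<close>)

lemma pb_eqI:
  assumes q: "q \<ge> 2" and M: "sets M = sets (padic_borel q)" and N: "sets N = sets (padic_borel q)"
    and e: "\<And>c b. c \<in> padics q \<Longrightarrow> emeasure M (padic_cball q c b) = emeasure N (padic_cball q c b)"
    and fin: "\<And>b. emeasure M (padic_cball q padic_zero b) \<noteq> \<infinity>"
  shows "M = N"
proof -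
  let ?B = "{padic_cball q c b |c b. c \<in> padics q}"
  let ?E = "insert {} ?B"
  have S: "sigma_sets (padics q) ?B = sigma_sets (padics q) ?E"
    by (rule sigma_sets_eqI) (auto intro: sigma_sets.Basic sigma_sets.Empty)
  show ?thesis
  proof (rule measure_eqI_generator_eq[where E = ?E and \<Omega> = "padics q" and A = "\<lambda>i. padic_cball q padic_zero (- int i)"])
    show "Int_stable ?E"
    proof (rule Int_stableI)
      fix X Y assume "X \<in> ?E" "Y \<in> ?E"
      then consider "X \<inter> Y = {}" | (balls) c b c' b' where "c \<in> padics q" "c' \<in> padics q" "X = padic_cball q c b" "Y = padic_cball q c' b'" "X \<inter> Y \<noteq> {}"
        by blast
      then show "X \<inter> Y \<in> ?E"
      proof cases
        case 1 then show ?thesis by simp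
      next
        case balls
        then obtain z where z: "z \<in> X" "z \<in> Y" by blast
        then have zp: "z \<in> padics q" using balls ball_eq[OF q] by auto
        have "X \<inter> Y = padic_cball q z (max b b')"
          using z balls by (auto simp: ball_eq[OF q] zp less_max_iff_disj)
        then show ?thesis using zp by blast
      qed
    qed
    show "?E \<subseteq> Pow (padics q)" by (auto simp: padic_cball_def Qp_def)
    show "emeasure M X = emeasure N X" if "X \<in> ?E" for X using that e by auto
    show "sets M = sigma_sets (padics q) ?E" "sets N = sigma_sets (padics q) ?E" using M N S by (simp_all add: sets_pb)
    show "range (\<lambda>i. padic_cball q padic_zero (- int i)) \<subseteq> ?E" using zero_in[OF q] by blast
    show "(\<Union>i. padic_cball q padic_zero (- int i)) = padics q"
    proof -
      have "\<exists>i. x \<in> padic_cball q padic_zero (- int i)" if x: "x \<in> padics q" for x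
      proof -
        obtain k where "\<forall>j<k. x j = 0" using lo x by blast
        then have "\<forall>j< - int (nat (-k)). x j = 0" by auto
        then show ?thesis unfolding ball_eq[OF q zero_in[OF q]] using x
          by (intro exI[of _ "nat (- k)"]) (simp add: padic_zero_def del: nat_minus_as_int)
      qed
      then show ?thesis by (auto simp: padic_cball_def Qp_def)
    qed
    show "emeasure M (padic_cball q padic_zero (- int i)) \<noteq> \<infinity>" for i using fin .
  qed
qed

definition monna :: "nat \<Rightarrow> real \<Rightarrow> padic" where
  "monna q t = (\<lambda>j. digit q t (- 1 - j))"

lemma floor_big:
  assumes "q \<ge> 2" "t \<ge> 0" shows "\<exists>K. \<forall>i\<ge>K. \<lfloor>t / real q powi i\<rfloor> = 0"
proof -
  obtain n where n: "t < real q ^ n" using real_arch_pow[of "real q" t] assms by auto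
  have "\<lfloor>t / real q powi i\<rfloor> = 0" if "i \<ge> int n" for i
  proof -
    have "real q ^ n \<le> real q powi i" using power_int_increasing[OF that, of "real q"] assms(1) by simp
    then show ?thesis using n assms by (simp add: floor_eq_iff)
  qed
  then show ?thesis by blast
qed

lemma floor_determines:
  assumes q: "q \<ge> 2" and t: "t \<ge> 0" and u: "u \<ge> 0"
  shows "(\<forall>i\<ge>k. digit q t i = digit q u i) \<longleftrightarrow> \<lfloor>t / real q powi k\<rfloor> = \<lfloor>u / real q powi k\<rfloor>"
proof
  assume d: "\<forall>i\<ge>k. digit q t i = digit q u i"
  obtain K1 K2 where K: "\<forall>i\<ge>K1. \<lfloor>t / real q powi i\<rfloor> = 0" "\<forall>i\<ge>K2. \<lfloor>u / real q powi i\<rfloor> = 0"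
    using floor_big q t u by metis
  define n where "n = max k (max K1 K2)"
  have n: "k \<le> n" "\<lfloor>t / real q powi n\<rfloor> = 0" "\<lfloor>u / real q powi n\<rfloor> = 0" using K by (auto simp: n_def)
  have "(\<Sum>j\<in>{k..<n}. real (digit q t j) * real q powi j) = (\<Sum>j\<in>{k..<n}. real (digit q u j) * real q powi j)"
    using d by (intro sum.cong) auto
  then show "\<lfloor>t / real q powi k\<rfloor> = \<lfloor>u / real q powi k\<rfloor>" using q by (simp add: digit_sum[OF q n(1)] n)
next
  assume f: "\<lfloor>t / real q powi k\<rfloor> = \<lfloor>u / real q powi k\<rfloor>"
  have "\<lfloor>t / real q powi i\<rfloor> = \<lfloor>u / real q powi i\<rfloor>" if "i \<ge> k" for i
    using that
  proof (induction i rule: int_ge_induct)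
    case base then show ?case using f .
  next
    case (step i) then show ?case by (simp add: floor_div_step[OF q])
  qed
  then show "\<forall>i\<ge>k. digit q t i = digit q u i" by (simp add: digit_def)
qed

lemma monna_in: 
  assumes q: "q \<ge> 2" and t: "t \<ge> 0" shows "monna q t \<in> padics q"
proof -
  obtain K where "\<forall>i\<ge>K. \<lfloor>t / real q powi i\<rfloor> = 0" using floor_big q t by blast
  then have "\<forall>j< - K. monna q t j = 0" by (auto simp: monna_def digit_def)
  then show ?thesis using digit_less[OF q] by (auto simp: padics_def monna_def)
qed

lemma monna_onto:
  assumes q: "q \<ge> 2" and c: "c \<in> padics q"
  shows "\<exists>t\<ge>0. \<forall>j<b. monna q t j = c j"
proof -
  obtain k where k: "\<forall>j<k. c j = 0" using lo c by blast
  define c' :: padic where "c' = (\<lambda>i. if i \<ge> - b then c (- 1 - i) else 0)"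
  have c': "c' \<in> padics q" using c q by (auto simp: padics_def c'_def intro!: exI[of _ "-b"])
  define K where "K = max (- k) (- b)"
  define t where "t = padic_trunc q c' K"
  have r: "0 \<le> t" "t < real q powi K" using trunc_range[OF q c'] by (auto simp: t_def)
  have "monna q t j = c j" if "j < b" for j
  proof (cases "- 1 - j < K")
    case True
    then have "digit q t (- 1 - j) = c' (- 1 - j)" unfolding t_def by (rule digit_trunc[OF q c'])
    then show ?thesis using that by (simp add: monna_def c'_def)
  next
    case False
    have "real q powi K \<le> real q powi (- 1 - j)" using False q by (intro power_int_increasing) auto
    then have "\<lfloor>t / real q powi (- 1 - j)\<rfloor> = 0" using r q by (simp add: floor_eq_iff)
    moreover have "c j = 0" using k False by (auto simp: K_def)
    ultimately show ?thesis by (simp add: monna_def digit_def)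
  qed
  then show ?thesis using r by blast
qed

lemma monna_ball:
  assumes q: "q \<ge> 2" and c: "c \<in> padics q"
  shows "\<exists>N::nat. monna q -` padic_cball q c b \<inter> {0..} = {N * real q powi (- b) ..< N * real q powi (-b) + real q powi (- b)}"
proof -
  obtain u where u: "u \<ge> 0" "\<forall>j<b. monna q u j = c j" using monna_onto[OF q c] by blast
  have P: "real q powi (- b) > 0" using q by simp
  define N where "N = nat \<lfloor>u / real q powi (- b)\<rfloor>"
  have N: "int N = \<lfloor>u / real q powi (- b)\<rfloor>" using u P by (simp add: N_def)
  have "t \<in> monna q -` padic_cball q c b \<longleftrightarrow> N * real q powi (- b) \<le> t \<and> t < N * real q powi (-b) + real q powi (- b)" if t: "t \<ge> 0" for t
  proof -
    have "t \<in> monna q -` padic_cball q c b \<longleftrightarrow> (\<forall>j<b. monna q t j = monna q u j)"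
      using monna_in[OF q t] u by (simp add: ball_eq[OF q c])
    also have "\<dots> \<longleftrightarrow> (\<forall>i\<ge>-b. digit q t i = digit q u i)"
    proof
      assume a: "\<forall>j<b. monna q t j = monna q u j"
      show "\<forall>i\<ge>-b. digit q t i = digit q u i"
      proof (intro allI impI)
        fix i assume "i \<ge> - b"
        then show "digit q t i = digit q u i" using a[rule_format, of "- 1 - i"] by (simp add: monna_def)
      qed
    qed (auto simp: monna_def)
    also have "\<dots> \<longleftrightarrow> \<lfloor>t / real q powi (- b)\<rfloor> = int N" using floor_determines[OF q t u(1)] N by simp
    also have "\<dots> \<longleftrightarrow> N \<le> t / real q powi (- b) \<and> t / real q powi (- b) < N + 1" by (simp add: floor_eq_iff add.commute)
    also have "\<dots> \<longleftrightarrow> N * real q powi (- b) \<le> t \<and> t < N * real q powi (-b) + real q powi (- b)"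
      using P by (simp add: pos_le_divide_eq pos_divide_less_eq algebra_simps del: power_int_minus)
    finally show ?thesis .
  qed
  note iff = this
  have nn: "0 \<le> N * real q powi (- b)" using P by (intro mult_nonneg_nonneg) auto
  have "monna q -` padic_cball q c b \<inter> {0..} = {N * real q powi (- b) ..< N * real q powi (-b) + real q powi (- b)}"
  proof (rule Set.set_eqI)
    fix t
    show "t \<in> monna q -` padic_cball q c b \<inter> {0..} \<longleftrightarrow> t \<in> {N * real q powi (- b) ..< N * real q powi (-b) + real q powi (- b)}"
    proof (cases "t \<ge> 0")
      case True then show ?thesis using iff[OF True] by (simp only: Int_iff atLeast_iff atLeastLessThan_iff simp_thms)
    next
      case False
      then have "\<not> N * real q powi (- b) \<le> t" using nn by linarith
      then show ?thesis using False by (simp only: Int_iff atLeast_iff atLeastLessThan_iff simp_thms)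
    qed
  qed
  then show ?thesis by blast
qed

definition haar0 :: "nat \<Rightarrow> padic measure" where
  "haar0 q = distr (restrict_space lborel {0..}) (padic_borel q) (monna q)"

lemma monna_measurable:
  assumes q: "q \<ge> 2" shows "monna q \<in> measurable (restrict_space lborel {0..}) (padic_borel q)"
proof (rule measurable_pb)
  show "monna q t \<in> padics q" if "t \<in> space (restrict_space lborel {0..})" for t using that monna_in[OF q] by (simp add: space_restrict_space)
  fix c b assume "c \<in> padics q"
  then obtain N :: nat where N: "monna q -` padic_cball q c b \<inter> {0..} = {N * real q powi (- b) ..< N * real q powi (-b) + real q powi (- b)}"
    using monna_ball[OF q] by blast
  have "monna q -` padic_cball q c b \<inter> space (restrict_space lborel {0..}) = monna q -` padic_cball q c b \<inter> {0..}" by (simp add: space_restrict_space)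
  moreover have "\<dots> \<subseteq> {0..}" by blast
  ultimately show "monna q -` padic_cball q c b \<inter> space (restrict_space lborel {0..}) \<in> sets (restrict_space lborel {0..})"
    by (subst sets_restrict_space_iff) (auto simp: N)
qed

lemma sets_haar0: "sets (haar0 q) = sets (padic_borel q)" by (simp add: haar0_def)

lemma haar0_ball:
  assumes q: "q \<ge> 2" and c: "c \<in> padics q"
  shows "emeasure (haar0 q) (padic_cball q c b) = ennreal (real q powi (- b))"
proof -
  obtain N :: nat where N: "monna q -` padic_cball q c b \<inter> {0..} = {N * real q powi (- b) ..< N * real q powi (-b) + real q powi (- b)}"
    using monna_ball[OF q c] by blast
  have "emeasure (haar0 q) (padic_cball q c b) = emeasure (restrict_space lborel {0..}) (monna q -` padic_cball q c b \<inter> {0..})"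
    unfolding haar0_def by (subst emeasure_distr[OF monna_measurable[OF q] ball_sets[OF c]]) (simp add: space_restrict_space)
  also have "\<dots> = emeasure lborel (monna q -` padic_cball q c b \<inter> {0..})"
    by (rule emeasure_restrict_space) auto
  also have "\<dots> = ennreal (real q powi (- b))" unfolding N using q by simp
  finally show ?thesis .
qed

lemma add_ball:
  assumes q: "q \<ge> 2" and a: "a \<in> padics q" and c: "c \<in> padics q"
  shows "padic_add q a ` padic_cball q c b = padic_cball q (padic_add q a c) b"
proof -
  interpret cring "Qp q" by (rule cring_Qp[OF q])
  have sub: "padic_add q a' ` padic_cball q c' b \<subseteq> padic_cball q (padic_add q a' c') b"
    if "a' \<in> padics q" "c' \<in> padics q" for a' c'
  proof
    fix y assume "y \<in> padic_add q a' ` padic_cball q c' b"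
    then obtain x where "x \<in> padic_cball q c' b" and y: "y = padic_add q a' x" by blast
    then have x: "x \<in> padics q" "\<forall>j<b. x j = c' j" by (simp_all add: ball_eq[OF q that(2)])
    have "y j = padic_add q a' c' j" if "j < b" for j
    proof -
      have "padic_trunc q x (j+1) = padic_trunc q c' (j+1)" by (rule trunc_local) (use x that in auto)
      then show ?thesis by (simp add: y padic_add_def)
    qed
    then show "y \<in> padic_cball q (padic_add q a' c') b"
      unfolding ball_eq[OF q add_props(1)[OF q that]] using add_props(1)[OF q that(1) x(1)] y by blast
  qed
  have n: "pneg q a \<in> padics q" using neg_props[OF q a] by simp
  have can: "padic_add q a (padic_add q (pneg q a) x) = x" "padic_add q (pneg q a) (padic_add q a x) = x" if "x \<in> padics q" for x
    using r_neg1[of a x] r_neg2[of a x] a that by (simp_all add: uminus_Qp[OF q] Qp_simps) 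
  show ?thesis
  proof
    show "padic_add q a ` padic_cball q c b \<subseteq> padic_cball q (padic_add q a c) b" using sub a c .
    show "padic_cball q (padic_add q a c) b \<subseteq> padic_add q a ` padic_cball q c b"
    proof
      fix x assume x: "x \<in> padic_cball q (padic_add q a c) b"
      then have "padic_add q (pneg q a) x \<in> padic_cball q c b" using sub[OF n add_props(1)[OF q a c]] can(2)[OF c] by auto
      moreover have "x \<in> padics q" using x by (simp add: padic_cball_def Qp_def)
      ultimately show "x \<in> padic_add q a ` padic_cball q c b" using can(1)[of x] by (metis image_eqI)
    qed
  qed
qed

lemma vimage_add:
  assumes q: "q \<ge> 2" and a: "a \<in> padics q" and A: "A \<subseteq> padics q"
  shows "padic_add q (pneg q a) -` A \<inter> padics q = padic_add q a ` A"
proof -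
  interpret cring "Qp q" by (rule cring_Qp[OF q])
  have n: "pneg q a \<in> padics q" using neg_props[OF q a] by simp
  have can: "padic_add q a (padic_add q (pneg q a) x) = x" "padic_add q (pneg q a) (padic_add q a x) = x" if "x \<in> padics q" for x
    using r_neg1[of a x] r_neg2[of a x] a that by (simp_all add: uminus_Qp[OF q] Qp_simps) 
  show ?thesis
  proof
    show "padic_add q (pneg q a) -` A \<inter> padics q \<subseteq> padic_add q a ` A"
    proof
      fix x assume "x \<in> padic_add q (pneg q a) -` A \<inter> padics q"
      then show "x \<in> padic_add q a ` A" using can(1)[of x] by (intro image_eqI[of _ _ "padic_add q (pneg q a) x"]) auto
    qed
    show "padic_add q a ` A \<subseteq> padic_add q (pneg q a) -` A \<inter> padics q" 
    proof
      fix y assume "y \<in> padic_add q a ` A"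
      then obtain x where x: "x \<in> A" "y = padic_add q a x" by blast
      then have "x \<in> padics q" using A by blast
      then show "y \<in> padic_add q (pneg q a) -` A \<inter> padics q" using can(2)[of x] add_props(1)[OF q a, of x] x by simp
    qed
  qed
qed

lemma haar0: 
  assumes q: "q \<ge> 2" shows "normalized_haar q (haar0 q)"
  unfolding normalized_haar_def
proof (intro conjI ballI)
  show "sets (haar0 q) = sets (padic_borel q)" by (rule sets_haar0)
  show "emeasure (haar0 q) (Zp q) = 1" using haar0_ball[OF q zero_in[OF q], of 0] by (simp add: Zp_eq[OF q])
  fix a A assume "a \<in> carrier (Qp q)" and A: "A \<in> sets (haar0 q)"
  then have a: "a \<in> padics q" by (simp add: Qp_def)
  have sp: "space (haar0 q) = padics q" using sets_eq_imp_space_eq[OF sets_haar0] by (simp add: space_pb)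
  let ?f = "padic_add q (pneg q a)"
  have n: "pneg q a \<in> padics q" using neg_props[OF q a] by simp
  have sub: "padic_cball q c b \<subseteq> padics q" for c b by (auto simp: padic_cball_def Qp_def)
  have f: "?f \<in> measurable (haar0 q) (padic_borel q)"
  proof (rule measurable_pb)
    show "?f t \<in> padics q" if "t \<in> space (haar0 q)" for t using add_props(1)[OF q n] that unfolding sp by blast
    show "?f -` padic_cball q c b \<inter> space (haar0 q) \<in> sets (haar0 q)" if c: "c \<in> padics q" for c b
      unfolding sp sets_haar0 vimage_add[OF q a sub] add_ball[OF q a c]
      by (rule ball_sets[OF add_props(1)[OF q a c]])
  qed
  have "distr (haar0 q) (padic_borel q) ?f = haar0 q"
  proof (rule pb_eqI[OF q])
    have e: "emeasure (distr (haar0 q) (padic_borel q) ?f) (padic_cball q c b) = ennreal (real q powi (- b))" if c: "c \<in> padics q" for c b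
      by (subst emeasure_distr[OF f ball_sets[OF c]])
        (simp only: sp vimage_add[OF q a sub] add_ball[OF q a c] haar0_ball[OF q add_props(1)[OF q a c]])
    then show "emeasure (distr (haar0 q) (padic_borel q) ?f) (padic_cball q c b) = emeasure (haar0 q) (padic_cball q c b)"
      if c: "c \<in> padics q" for c b using haar0_ball[OF q c] that by simp
    show "emeasure (distr (haar0 q) (padic_borel q) ?f) (padic_cball q padic_zero b) \<noteq> \<infinity>" for b using e[OF zero_in[OF q]] by simp
  qed (simp_all add: sets_haar0)
  then have "emeasure (haar0 q) A = emeasure (distr (haar0 q) (padic_borel q) ?f) A" by simp
  also have "\<dots> = emeasure (haar0 q) (?f -` A \<inter> padics q)"
    using A by (subst emeasure_distr[OF f]) (simp_all add: sets_haar0 sp)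
  also have "?f -` A \<inter> padics q = padic_add q a ` A" using vimage_add[OF q a] sets.sets_into_space[OF A] sp by simp
  finally show "emeasure (haar0 q) ((\<lambda>x. a \<oplus>\<^bsub>Qp q\<^esub> x) ` A) = emeasure (haar0 q) A" by (simp add: Qp_def)
qed

lemma haar_ball:
  assumes q: "q \<ge> 2" and M: "normalized_haar q M" and c: "c \<in> padics q"
  shows "emeasure M (padic_cball q c b) = ennreal (real q powi (- b))"
proof -
  have S: "sets M = sets (padic_borel q)" using M by (simp add: normalized_haar_def)
  have inv: "emeasure M (padic_cball q c b) = emeasure M (padic_cball q padic_zero b)" if c: "c \<in> padics q" for c b
  proof -
    interpret cring "Qp q" by (rule cring_Qp[OF q])
    have "padic_add q c padic_zero = c" using r_zero[of c] c by (simp add: Qp_def)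
    then have "padic_cball q c b = padic_add q c ` padic_cball q padic_zero b" using add_ball[OF q c zero_in[OF q]] by simp
    moreover have "emeasure M (padic_add q c ` padic_cball q padic_zero b) = emeasure M (padic_cball q padic_zero b)"
      using M c ball_sets[OF zero_in[OF q]] S unfolding normalized_haar_def by (simp add: Qp_def)
    ultimately show ?thesis by simp
  qed
  define m where "m b = emeasure M (padic_cball q padic_zero b)" for b
  have step: "m b = of_nat q * m (b + 1)" for b
  proof -
    define e where "e d = (\<lambda>j. if j = b then d else 0)" for d :: nat
    have e: "e d \<in> padics q" if "d < q" for d using that q by (auto simp: padics_def e_def intro!: exI[of _ b])
    have "padic_cball q padic_zero b = (\<Union>d<q. padic_cball q (e d) (b + 1))"
    proof (intro equalityI subsetI)
      fix x assume "x \<in> padic_cball q padic_zero b"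
      then have x: "x \<in> padics q" "\<forall>j<b. x j = 0" unfolding ball_eq[OF q zero_in[OF q]] by (auto simp: padic_zero_def)
      then have d: "x b < q" by (simp add: padics_def)
      have "x \<in> padic_cball q (e (x b)) (b + 1)" unfolding ball_eq[OF q e[OF d]] using x by (auto simp: e_def)
      then show "x \<in> (\<Union>d<q. padic_cball q (e d) (b + 1))" using d by blast
    next
      fix x assume "x \<in> (\<Union>d<q. padic_cball q (e d) (b + 1))"
      then obtain d where "d < q" "x \<in> padic_cball q (e d) (b + 1)" by blast
      then have "x \<in> padics q" "\<forall>j<b+1. x j = e d j" by (simp_all add: ball_eq[OF q e])
      then show "x \<in> padic_cball q padic_zero b" unfolding ball_eq[OF q zero_in[OF q]] by (auto simp: e_def padic_zero_def)
    qed
    moreover have "emeasure M (\<Union>d<q. padic_cball q (e d) (b + 1)) = (\<Sum>d<q. emeasure M (padic_cball q (e d) (b + 1)))"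
    proof (rule sum_emeasure[symmetric])
      show "(\<lambda>d. padic_cball q (e d) (b + 1)) ` {..<q} \<subseteq> sets M" using S ball_sets e by auto
      show "disjoint_family_on (\<lambda>d. padic_cball q (e d) (b + 1)) {..<q}"
        unfolding disjoint_family_on_def
      proof (intro ballI impI)
        fix d d' assume d: "d \<in> {..<q}" "d' \<in> {..<q}" "d \<noteq> d'"
        then have "e d b \<noteq> e d' b" by (simp add: e_def)
        then show "padic_cball q (e d) (b + 1) \<inter> padic_cball q (e d') (b + 1) = {}"
          using d ball_eq[OF q e] by fastforce
      qed
    qed simp
    ultimately show ?thesis using inv[OF e] by (simp add: m_def)
  qed
  have m0: "m 0 = 1" using M by (simp add: m_def normalized_haar_def Zp_eq[OF q])
  have qq: "of_nat q * ennreal (real q powi (- (i + 1))) = ennreal (real q powi (- i))" for i :: int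
  proof -
    have "of_nat q * ennreal (real q powi (- (i + 1))) = ennreal (real q * real q powi (- (i + 1)))"
      by (simp add: ennreal_mult' ennreal_of_nat_eq_real_of_nat)
    also have "real q * real q powi (- (i + 1)) = real q powi (- i)" 
      using q power_int_add_1'[of "real q" "- (i+1)"] by simp
    finally show ?thesis .
  qed
  have "m b = ennreal (real q powi (- b))" for b
  proof (induction b rule: int_induct[where k = 0])
    case base then show ?case using m0 by simp
  next
    case (step1 i)
    then have "of_nat q * m (i + 1) = of_nat q * ennreal (real q powi (- (i + 1)))" using step[of i] qq[of i] by simp
    then show ?case using q by (subst (asm) ennreal_mult_cancel_left) auto
  next
    case (step2 i)
    then show ?case using step[of "i - 1"] qq[of "i - 1"] by simp
  qed
  then show ?thesis using inv[OF c] by (simp add: m_def)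
qed

lemma ex1_haar:
  assumes q: "q \<ge> 2" shows "\<exists>!M. normalized_haar q M"
proof (rule ex1I)
  show "normalized_haar q (haar0 q)" by (rule haar0[OF q])
next
  fix M assume M: "normalized_haar q M"
  show "M = haar0 q"
    by (rule pb_eqI[OF q]) (use M haar_ball[OF q M] haar0_ball[OF q] zero_in[OF q] in \<open>simp_all add: normalized_haar_def sets_haar0\<close>)
qed


end

theory Submission
  imports Defs
begin

text \<open>
  Let \<open>R = q^(2 n)\<close> and write \<open>F\<close> as the sum of its parts \<open>F\<^sub>t\<close>, \<open>t < q^n\<close>, with frequencies over the interval of
  length \<open>q^(-n)\<close> around \<open>t\<close>. The frequencies of \<open>F\<^sub>t\<close> lie in a parallelogram of sides \<open>q^(-n)\<close> and \<open>q^(-2 n)\<close>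
  at \<open>(t, t^2)\<close>. The dual plank is a group, and a shift by one of its elements multiplies \<open>F\<^sub>t\<close> by a number of
  modulus \<open>1\<close>, the phase of the shift at the frequency \<open>(t, t^2)\<close>. The whole estimate rests on this rule:
  it holds for sums and clippings of packets as well, and two functions are orthogonal as soon as some
  shift multiplies the product of one with the conjugate of the other by a number other than \<open>1\<close>. The
  estimate \<open>sixth_moment\<close> is therefore proved for any measure space with suitable translations, and the
  \<open>q\<close>-adic plane enters only through the verification of the rule.

  The argument is of high-low type. Let \<open>S\<close> be the sum of the squared suprema of the \<open>F\<^sub>t\<close> and \<open>m\<close> that of their
  squared \<open>L^2\<close>-norms.

  At each point, either a single \<open>F\<^sub>t\<close> is as large as \<open>F\<close>, up to a constant, or \<open>F\<close> is at most a multiple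
  of \<open>n\<close> times the smaller of two arcs of \<open>F\<close> over sibling intervals, that is, over distinct children of
  one interval (\<open>broad_narrow\<close>). The first case is trivial, and in the second one \<open>min(|f'|, |f''|)^6\<close> has
  to be integrated for siblings \<open>f'\<close>, \<open>f''\<close>.

  Consider the set \<open>U\<close> where both siblings are at least \<open>\<alpha>\<close>, with \<open>\<alpha>^2 > 8 S\<close>. Starting from the parts of scale
  \<open>n\<close>, set every packet to zero where it exceeds \<open>c\<close>, a constant times \<open>(n + 1) S / \<alpha>\<close>, add up the packets of
  siblings, and repeat. The square function \<open>g\<^sub>k\<close> of the packets of scale \<open>k\<close> starts below \<open>S\<close>, and \<open>g\<^sub>k\<close>
  exceeds \<open>g\<^sub>k\<^sub>+\<^sub>1\<close> by no more than a sum \<open>e\<^sub>k\<close> of products of distinct siblings. Products over different parents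
  are orthogonal, because the parabola is curved; so the squared \<open>L^2\<close>-norm of \<open>e\<^sub>k\<close> is at most a multiple of
  \<open>c^2 m\<close> (\<open>high_estimate\<close>). At a point of \<open>U\<close> let \<open>k\<close> be the first scale, from fine to coarse, with
  \<open>g\<^sub>k > 2 S\<close>. Before that little has been removed: both siblings are still at least \<open>\<alpha> / 2\<close>. As the set with
  stopping scale \<open>k\<close> is invariant under the planks of scale \<open>k\<close>, the products of packets in the two siblings
  are orthogonal on it, and the integral of \<open>|f' f''|^2\<close> over it, for the clipped siblings, is at most that of \<open>g\<^sub>k^2\<close>
  (\<open>bilinear_identity\<close>). Finally \<open>g\<^sub>k\<close> is at most twice the sum of the \<open>e\<^sub>i\<close>, since it exceeds \<open>2 S\<close>. Altogether
  \<open>\<alpha>^4 |U|\<close> is at most a multiple of \<open>n^2 c^2 m\<close>, so \<open>\<alpha>^6 |U|\<close> is at most a multiple of \<open>n^4 S^2 m\<close>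
  (\<open>level_set\<close>). Summing over \<open>n\<close> levels and over \<open>n\<close> scales of siblings and inserting the factor \<open>n^6\<close> from
  the first step gives \<open>n^12 S^2 m\<close>, and \<open>n \<le> ln R\<close>.

  For the \<open>q\<close>-adic plane, \<open>F\<^sub>t\<close> is an explicit average of translates of \<open>F\<close>, and the rule follows by comparing
  Fourier transforms, which determine Schwartz functions (\<open>fourier_injective\<close>).
\<close>

section \<open>Bounded integrable functions\<close>

definition echar :: "real \<Rightarrow> complex" where
  "echar r = cis (2 * pi * r)"

lemma echar_add: "echar (r + s) = echar r * echar s"
  by (simp add: echar_def cis_mult algebra_simps)

lemma cnj_echar: "cnj (echar r) = echar (- r)"
  by (simp add: echar_def cis_cnj)

lemma cmod_echar [simp]: "cmod (echar r) = 1"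
  by (simp add: echar_def)

lemma echar_0 [simp]: "echar 0 = 1" by (simp add: echar_def)

lemma echar_eq_1_iff: "echar r = 1 \<longleftrightarrow> r \<in> \<int>"
proof -
  have "echar r = 1 \<longleftrightarrow> (\<exists>n::int. 2 * pi * r = of_int (2 * n) * pi)"
    unfolding echar_def cis_conv_exp exp_eq_1 by simp
  also have "\<dots> \<longleftrightarrow> (\<exists>n::int. r = of_int n)" by simp
  finally show ?thesis by (auto elim: Ints_cases)
qed

lemma echar_cong: "r - s \<in> \<int> \<Longrightarrow> echar r = echar s"
  using echar_add[of "r - s" s] echar_eq_1_iff[of "r - s"] by simp

text \<open>
  The wave packets below are of this kind. The class is closed under products, so that no integrability
  question arises when four of them are multiplied. The bound holds at every point rather than
  almost everywhere, which keeps the pointwise arguments free of null sets.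
\<close>

definition bddint :: "'a measure \<Rightarrow> ('a \<Rightarrow> complex) \<Rightarrow> bool" where
  "bddint M f \<longleftrightarrow> integrable M f \<and> (\<exists>B. \<forall>x. cmod (f x) \<le> B)"

lemma bddint_integrable: "bddint M f \<Longrightarrow> integrable M f" by (simp add: bddint_def)

lemma bddint_meas [measurable_dest]: "bddint M f \<Longrightarrow> f \<in> borel_measurable M"
  by (auto simp: bddint_def)

lemma bddint_bound:
  assumes f: "bddint M f" and g: "g \<in> borel_measurable M" and le: "\<And>x. cmod (g x) \<le> C * cmod (f x)" and C: "C \<ge> 0"
  shows "bddint M g"
proof -
  obtain B where B: "\<And>x. cmod (f x) \<le> B" using f by (auto simp: bddint_def)
  have "integrable M (\<lambda>x. C * cmod (f x))" using f by (auto simp: bddint_def)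
  then have "integrable M g"
    by (rule Bochner_Integration.integrable_bound[OF _ g]) (use le C in \<open>auto simp: abs_mult\<close>)
  moreover have "cmod (g x) \<le> C * B" for x using le[of x] mult_left_mono[OF B[of x] C] by linarith
  ultimately show ?thesis by (auto simp: bddint_def)
qed

lemma bddint_0 [simp]: "bddint M (\<lambda>x. 0)" by (auto simp: bddint_def)

lemma bddint_add:
  assumes "bddint M f" "bddint M g" shows "bddint M (\<lambda>x. f x + g x)"
proof -
  obtain B C where "\<And>x. cmod (f x) \<le> B" "\<And>x. cmod (g x) \<le> C" using assms by (auto simp: bddint_def)
  then have "cmod (f x + g x) \<le> B + C" for x by (rule norm_triangle_mono)
  then show ?thesis using assms by (auto simp: bddint_def)
qed

lemma bddint_sum: "(\<And>i. i \<in> A \<Longrightarrow> bddint M (f i)) \<Longrightarrow> bddint M (\<lambda>x. \<Sum>i\<in>A. f i x)"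
  by (induction A rule: infinite_finite_induct) (simp_all add: bddint_add)

lemma bddint_bdd_mult:
  assumes f: "bddint M f" and g: "g \<in> borel_measurable M" and le: "\<And>x. cmod (g x) \<le> C"
  shows "bddint M (\<lambda>x. g x * f x)"
proof (rule bddint_bound[OF f])
  show "(\<lambda>x. g x * f x) \<in> borel_measurable M" using g bddint_meas[OF f] by simp
  show "cmod (g x * f x) \<le> max C 0 * cmod (f x)" for x
    using le[of x] by (auto simp: norm_mult intro!: mult_right_mono)
qed simp

lemma bddint_mult:
  assumes "bddint M f" "bddint M g" shows "bddint M (\<lambda>x. f x * g x)"
proof -
  obtain C where "\<forall>x. cmod (f x) \<le> C" using assms(1) by (auto simp: bddint_def)
  then show ?thesis using bddint_bdd_mult[OF assms(2) bddint_meas[OF assms(1)]] by blast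
qed

lemma bddint_cnj: "bddint M f \<Longrightarrow> bddint M (\<lambda>x. cnj (f x))"
  by (auto simp: bddint_def)

lemma bddint_cmult: "bddint M f \<Longrightarrow> bddint M (\<lambda>x. c * f x)"
  by (rule bddint_bdd_mult[where C="cmod c"]) auto

text \<open>
  Clipping sends large values to \<open>0\<close> instead of shrinking them. Whether a value is kept depends only
  on its modulus, so clipping commutes with multiplication by numbers of modulus \<open>1\<close>.
\<close>

definition clip :: "real \<Rightarrow> ('a \<Rightarrow> complex) \<Rightarrow> 'a \<Rightarrow> complex" where
  "clip c f x = (if cmod (f x) \<le> c then f x else 0)"

lemma cmod_clip_le: "cmod (clip c f x) \<le> cmod (f x)" and cmod_clip_le': "c \<ge> 0 \<Longrightarrow> cmod (clip c f x) \<le> c"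
  by (auto simp: clip_def)

lemma bddint_clip:
  assumes f: "bddint M f" shows "bddint M (clip c f)"
proof (rule bddint_bound[OF f, of _ 1])
  note [measurable] = bddint_meas[OF f]
  have "(\<lambda>x. if cmod (f x) \<le> c then f x else 0) \<in> borel_measurable M" by measurable
  then show "clip c f \<in> borel_measurable M" by (simp add: clip_def[abs_def])
qed (auto simp: cmod_clip_le)

lemma bddint_sq:
  assumes "bddint M f" shows "integrable M (\<lambda>x. (cmod (f x))\<^sup>2)"
proof -
  have "bddint M (\<lambda>x. f x * cnj (f x))" using assms by (intro bddint_mult bddint_cnj)
  then have "integrable M (\<lambda>x. cmod (f x * cnj (f x)))" by (simp add: bddint_def)
  then show ?thesis by (simp add: norm_mult power2_eq_square)
qed

lemma integral_norm_sum_sq: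
  assumes "finite A" and b: "\<And>p. p \<in> A \<Longrightarrow> bddint M (g p)"
    and o: "\<And>p r. p \<in> A \<Longrightarrow> r \<in> A \<Longrightarrow> p \<noteq> r \<Longrightarrow> (LINT x|M. g p x * cnj (g r x)) = 0"
  shows "(LINT x|M. (cmod (\<Sum>p\<in>A. g p x))\<^sup>2) = (\<Sum>p\<in>A. LINT x|M. (cmod (g p x))\<^sup>2)"
proof -
  have i: "integrable M (\<lambda>x. g p x * cnj (g r x))" if "p \<in> A" "r \<in> A" for p r
    using b that by (intro bddint_integrable bddint_mult bddint_cnj) auto
  have "complex_of_real (LINT x|M. (cmod (\<Sum>p\<in>A. g p x))\<^sup>2) = (LINT x|M. (\<Sum>p\<in>A. \<Sum>r\<in>A. g p x * cnj (g r x)))"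
    unfolding integral_complex_of_real[symmetric]
    by (rule Bochner_Integration.integral_cong) (auto simp only: complex_norm_square cnj_sum sum_product)
  also have "\<dots> = (\<Sum>p\<in>A. \<Sum>r\<in>A. LINT x|M. g p x * cnj (g r x))"
    using i by (simp add: Bochner_Integration.integral_sum)
  also have "\<dots> = (\<Sum>p\<in>A. LINT x|M. g p x * cnj (g p x))"
  proof (rule sum.cong[OF refl])
    fix p assume p: "p \<in> A"
    show "(\<Sum>r\<in>A. LINT x|M. g p x * cnj (g r x)) = (LINT x|M. g p x * cnj (g p x))"
      unfolding sum.remove[OF assms(1) p] using o[OF p] by (subst sum.neutral) auto
  qed
  also have "\<dots> = (\<Sum>p\<in>A. LINT x|M. complex_of_real ((cmod (g p x))\<^sup>2))"
    by (simp only: complex_norm_square)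
  also have "\<dots> = complex_of_real (\<Sum>p\<in>A. LINT x|M. (cmod (g p x))\<^sup>2)"
    by (simp only: integral_complex_of_real of_real_sum)
  finally show ?thesis using of_real_eq_iff by blast
qed

section \<open>Wave packets and their orthogonality\<close>

definition qfrac :: "nat \<Rightarrow> real \<Rightarrow> bool" where
  "qfrac q h \<longleftrightarrow> (\<exists>N. h * real q ^ N \<in> \<int>)"

text \<open>
  The plank dual to the piece of the parabola over the interval of length \<open>q^(-k)\<close> around \<open>t\<close>: this
  piece lies in the parallelogram spanned by \<open>q^k (1, 2 t)\<close> and \<open>q^(2 k) (0, 1)\<close> at \<open>(t, t^2)\<close>, and the
  plank consists of the shifts that pair integrally with both vectors. Shifts are rational numbers
  whose denominators are powers of \<open>q\<close>; since they are dense, they carry all the information of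
  \<open>q\<close>-adic shifts.
\<close>

definition plank :: "nat \<Rightarrow> nat \<Rightarrow> nat \<Rightarrow> real \<Rightarrow> real \<Rightarrow> bool" where
  "plank q k t h1 h2 \<longleftrightarrow> h2 * real q ^ (2 * k) \<in> \<int> \<and> (h1 + 2 * real t * h2) * real q ^ k \<in> \<int>"

lemma pow_double: "(x::'b::monoid_mult) ^ (2 * k) = x ^ k * x ^ k"
  by (simp add: mult_2 power_add)

lemma plank_qfrac:
  assumes "plank q k t h1 h2" shows "qfrac q h1" "qfrac q h2"
proof -
  have "h1 * real q ^ (2*k) = ((h1 + 2 * real t * h2) * real q ^ k) * real q ^ k - of_nat (2 * t) * (h2 * real q ^ (2*k))"
    unfolding pow_double by (simp add: algebra_simps)
  moreover have "\<dots> \<in> \<int>" using assms unfolding plank_def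
    by (elim conjE) (rule Ints_diff[OF Ints_mult[OF _ Ints_power[OF Ints_of_nat]] Ints_mult[OF Ints_of_nat]])
  ultimately show "qfrac q h1" unfolding qfrac_def by metis
  show "qfrac q h2" using assms unfolding plank_def qfrac_def by metis
qed

text \<open>
  Planks grow when the interval shrinks. Passing from \<open>t\<close> to \<open>t + q^k i\<close> changes the slope by
  \<open>2 q^k i\<close>, of norm at most \<open>q^(-k)\<close>. Over the long side, of length \<open>q^(2 k)\<close>, this amounts to a displacement
  of at most \<open>q^k\<close>, the width of the plank.
\<close>

lemma plank_finer:
  assumes "k \<le> l" "plank q k t h1 h2" shows "plank q l (t + q ^ k * i) h1 h2"
proof -
  have p: "h2 * real q ^ (2*k) \<in> \<int>" "(h1 + 2 * real t * h2) * real q ^ k \<in> \<int>"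
    using assms(2) by (simp_all only: plank_def)
  obtain d where l: "l = k + d" using assms(1) by (metis le_iff_add)
  have "h2 * real q ^ (2*l) = (h2 * real q ^ (2*k)) * of_nat (q ^ (2*d))" unfolding l pow_double power_add by (simp add: algebra_simps pow_double)
  moreover have "\<dots> \<in> \<int>" by (rule Ints_mult[OF p(1) Ints_of_nat])
  moreover have "(h1 + 2 * real (t + q ^ k * i) * h2) * real q ^ l
     = ((h1 + 2 * real t * h2) * real q ^ k) * of_nat (q ^ d) + of_nat (2 * i * q ^ d) * (h2 * real q ^ (2*k))"
    unfolding l pow_double power_add by (simp add: algebra_simps pow_double)
  moreover have "\<dots> \<in> \<int>" by (intro Ints_add Ints_mult[OF p(2) Ints_of_nat] Ints_mult[OF Ints_of_nat p(1)])
  ultimately show ?thesis unfolding plank_def by presburger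
qed

text \<open>
  Inside the plank the frequency \<open>(s, s^2)\<close> cannot be told apart from \<open>(t, t^2)\<close> when \<open>s\<close> is congruent to
  \<open>t\<close> modulo \<open>q^k\<close>.
\<close>

lemma plank_phase:
  assumes "plank q k t h1 h2"
  shows "(real (t + q ^ k * i) * h1 + real (t + q ^ k * i) ^ 2 * h2) - (real t * h1 + real t ^ 2 * h2) \<in> \<int>"
proof -
  have "(real (t + q ^ k * i) * h1 + real (t + q ^ k * i) ^ 2 * h2) - (real t * h1 + real t ^ 2 * h2)
     = of_nat i * ((h1 + 2 * real t * h2) * real q ^ k) + of_nat (i ^ 2) * (h2 * real q ^ (2*k))"
    unfolding pow_double power2_eq_square by (simp add: algebra_simps)
  moreover have "\<dots> \<in> \<int>"
    using assms unfolding plank_def by (intro Ints_add Ints_mult[OF Ints_of_nat]) simp_all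
  ultimately show ?thesis by presburger
qed

text \<open>
  The setting of the analytic argument: a measure space with measure preserving maps indexed by shifts.
  Every orthogonality relation below is obtained from a single shift.
\<close>

locale qtranslations =
  fixes M :: "'a measure" and q :: nat and T :: "real \<Rightarrow> real \<Rightarrow> 'a \<Rightarrow> 'a"
  assumes prime_q: "prime q" and odd_q: "odd q"
    and T_meas: "\<And>h1 h2. qfrac q h1 \<Longrightarrow> qfrac q h2 \<Longrightarrow> T h1 h2 \<in> measurable M M"
    and T_distr: "\<And>h1 h2. qfrac q h1 \<Longrightarrow> qfrac q h2 \<Longrightarrow> distr M M (T h1 h2) = M"
begin

lemma q_gt_1: "q > 1" and q_pos: "q > 0" and q_ge3: "q \<ge> 3"
proof -
  show "q > 1" using prime_q prime_gt_1_nat by blast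
  then show "q > 0" by simp
  have "q \<noteq> 2" using odd_q by auto
  then show "q \<ge> 3" using \<open>q > 1\<close> by simp
qed

text \<open>
  The source of orthogonality in the estimates, in place of the Fourier transform: invariance of the
  measure shows that the integral equals \<open>w\<close> times itself.
\<close>

lemma integral_zero:
  assumes "qfrac q h1" "qfrac q h2" and \<Phi>: "bddint M \<Phi>" and w: "\<And>x. \<Phi> (T h1 h2 x) = w * \<Phi> x" "w \<noteq> 1"
  shows "(LINT x|M. \<Phi> x) = 0"
proof -
  have "(LINT x|M. \<Phi> x) = (LINT x|distr M M (T h1 h2). \<Phi> x)" using T_distr assms by simp
  also have "\<dots> = (LINT x|M. \<Phi> (T h1 h2 x))"
    by (rule integral_distr) (use T_meas assms bddint_meas[OF \<Phi>] in auto)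
  also have "\<dots> = w * (LINT x|M. \<Phi> x)" by (simp add: w)
  finally show ?thesis using w(2) by (metis mult_cancel_right1)
qed

text \<open>
  Frequency localization to the piece of the parabola over \<open>t\<close> modulo \<open>q^k\<close>, expressed by translations.
  This form survives multiplication by functions of the modulus, hence clipping.
\<close>

definition wave :: "nat \<Rightarrow> nat \<Rightarrow> ('a \<Rightarrow> complex) \<Rightarrow> bool" where
  "wave k t f \<longleftrightarrow> bddint M f \<and> (\<forall>h1 h2 x. plank q k t h1 h2 \<longrightarrow>
     f (T h1 h2 x) = echar (real t * h1 + real t ^ 2 * h2) * f x)"

lemma wave_bddint: "wave k t f \<Longrightarrow> bddint M f" by (simp add: wave_def)

lemma waveD: "wave k t f \<Longrightarrow> plank q k t h1 h2 \<Longrightarrow> f (T h1 h2 x) = echar (real t * h1 + real t ^ 2 * h2) * f x"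
  by (simp add: wave_def)

lemma wave_coarser:
  assumes "k \<le> l" "wave l (t + q ^ k * i) f" shows "wave k t f"
  unfolding wave_def
proof (intro conjI allI impI)
  show "bddint M f" by (rule wave_bddint[OF assms(2)])
  fix h1 h2 x assume p: "plank q k t h1 h2"
  show "f (T h1 h2 x) = echar (real t * h1 + real t ^ 2 * h2) * f x"
    unfolding waveD[OF assms(2) plank_finer[OF assms(1) p]] using echar_cong[OF plank_phase[OF p]] by simp
qed

lemma wave_sum: "(\<And>i. i \<in> A \<Longrightarrow> wave k t (f i)) \<Longrightarrow> wave k t (\<lambda>x. \<Sum>i\<in>A. f i x)"
  unfolding wave_def by (auto intro!: bddint_sum simp: sum_distrib_left)

lemma wave_clip: "wave k t f \<Longrightarrow> wave k t (clip c f)"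
  unfolding wave_def by (auto intro!: bddint_clip simp: clip_def norm_mult)

lemma wave_norm: "wave k t f \<Longrightarrow> plank q k t h1 h2 \<Longrightarrow> cmod (f (T h1 h2 x)) = cmod (f x)"
  by (simp add: waveD norm_mult)

text \<open>
  All the orthogonality relations between products of two functions have this shape. The weight \<open>V\<close> makes
  room for the indicator of a set that is invariant under the shift.
\<close>

lemma quad_zero:
  assumes w: "wave k a f1" "wave k b f2" "wave l c f3" "wave l d f4"
    and p: "plank q k a h1 h2" "plank q k b h1 h2" "plank q l c h1 h2" "plank q l d h1 h2"
    and V: "V \<in> borel_measurable M" "\<And>x. cmod (V x) \<le> B" "\<And>x. V (T h1 h2 x) = V x"
    and nz: "(real a * h1 + real a ^ 2 * h2) - (real b * h1 + real b ^ 2 * h2)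
       + (real c * h1 + real c ^ 2 * h2) - (real d * h1 + real d ^ 2 * h2) \<notin> \<int>"
  shows "(LINT x|M. V x * (f1 x * cnj (f2 x) * (f3 x * cnj (f4 x)))) = 0"
proof (rule integral_zero)
  show "qfrac q h1" "qfrac q h2" using plank_qfrac[OF p(1)] by simp_all
  show "bddint M (\<lambda>x. V x * (f1 x * cnj (f2 x) * (f3 x * cnj (f4 x))))"
    by (rule bddint_bdd_mult[OF _ V(1,2)]) (intro bddint_mult bddint_cnj w[THEN wave_bddint])
  let ?e = "\<lambda>t. echar (real t * h1 + real t ^ 2 * h2)"
  have e: "?e a * cnj (?e b) * (?e c * cnj (?e d)) = echar ((real a * h1 + real a ^ 2 * h2) - (real b * h1 + real b ^ 2 * h2)
       + (real c * h1 + real c ^ 2 * h2) - (real d * h1 + real d ^ 2 * h2))"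
    unfolding cnj_echar echar_add[symmetric] by (rule arg_cong[of _ _ echar]) simp
  show "?e a * cnj (?e b) * (?e c * cnj (?e d)) \<noteq> 1" unfolding e echar_eq_1_iff by (rule nz)
  show "V (T h1 h2 x) * (f1 (T h1 h2 x) * cnj (f2 (T h1 h2 x)) * (f3 (T h1 h2 x) * cnj (f4 (T h1 h2 x)))) =
     ?e a * cnj (?e b) * (?e c * cnj (?e d)) * (V x * (f1 x * cnj (f2 x) * (f3 x * cnj (f4 x))))" for x
    unfolding waveD[OF w(1) p(1)] waveD[OF w(2) p(2)] waveD[OF w(3) p(3)] waveD[OF w(4) p(4)] V(3)
    by (simp only: complex_cnj_mult mult_ac)
qed

end

section \<open>Orthogonality of high frequencies\<close>

lemma sum_children:
  fixes q j :: nat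
  shows "(\<Sum>s<q ^ Suc j. \<phi> s) = (\<Sum>t<q ^ j. \<Sum>i<q. \<phi> (t + q ^ j * i))"
proof -
  have "(\<Sum>s<q ^ Suc j. \<phi> s) = (\<Sum>i<q. \<Sum>s=i * q ^ j..<i * q ^ j + q ^ j. \<phi> s)"
    using sum.nat_group[of \<phi> "q ^ j" q] by simp
  also have "\<dots> = (\<Sum>i<q. \<Sum>t<q ^ j. \<phi> (t + q ^ j * i))"
  proof (rule sum.cong[OF refl])
    fix i
    show "(\<Sum>s=i * q ^ j..<i * q ^ j + q ^ j. \<phi> s) = (\<Sum>t<q ^ j. \<phi> (t + q ^ j * i))"
      by (rule sum.reindex_bij_witness[of _ "\<lambda>t. t + q ^ j * i" "\<lambda>s. s - q ^ j * i"]) (auto simp: mult.commute)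
  qed
  finally show ?thesis by (simp only: sum.swap[of _ "{..<q}"])
qed

lemma child_less:
  fixes q j :: nat
  assumes "t < q ^ j" "i < q" shows "t + q ^ j * i < q ^ Suc j"
proof -
  have "t + q ^ j * i < q ^ j * (i + 1)" using assms by simp
  also have "\<dots> \<le> q ^ j * q" using assms by (intro mult_le_mono2) simp
  finally show ?thesis by (simp add: mult.commute)
qed

lemma int_val:
  fixes d :: int
  assumes "d \<noteq> 0" "\<bar>d\<bar> < int q ^ j" "q > 1"
  shows "\<exists>v w. v < j \<and> d = int q ^ v * w \<and> \<not> int q dvd w"
  using assms(1,2)
proof (induction j arbitrary: d)
  case 0 then show ?case by simp
next
  case (Suc j)
  show ?case
  proof (cases "int q dvd d")
    case False then show ?thesis by (intro exI[of _ 0] exI[of _ d]) auto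
  next
    case True
    then obtain d' where d: "d = int q * d'" by blast
    have "d' \<noteq> 0" using Suc d by auto
    moreover have "\<bar>d'\<bar> < int q ^ j" using Suc.prems(2) assms(3) by (simp add: d abs_mult)
    ultimately obtain v w where "v < j" "d' = int q ^ v * w" "\<not> int q dvd w" using Suc.IH by blast
    then show ?thesis using d by (intro exI[of _ "Suc v"] exI[of _ w]) auto
  qed
qed

lemma not_dvd_imp_frac:
  assumes "\<not> int q dvd N" "q > 0" shows "real_of_int N / real q \<notin> \<int>"
proof
  assume "real_of_int N / real q \<in> \<int>"
  then obtain z where z: "real_of_int N / real q = of_int z" by (auto elim: Ints_cases)
  then have "real_of_int N = of_int (int q * z)" using z assms(2) by (simp add: field_simps)
  then have "N = int q * z" using of_int_eq_iff by blast
  then show False using assms by simp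
qed

context qtranslations begin

text \<open>
  The horizontal shift by \<open>q^(-l)\<close> lies in every plank of scale \<open>l\<close> and separates the residue classes
  modulo \<open>q^l\<close>.
\<close>

lemma pair_zero:
  assumes w: "wave l a f" "wave l b g" and ab: "a < q ^ l" "b < q ^ l" "a \<noteq> b"
  shows "(LINT x|M. f x * cnj (g x)) = 0"
proof (rule integral_zero)
  let ?h = "1 / real q ^ l"
  have p: "plank q l t ?h 0" for t using q_pos by (simp add: plank_def)
  show "qfrac q ?h" "qfrac q 0" using plank_qfrac[OF p[of 0]] by simp_all
  show "bddint M (\<lambda>x. f x * cnj (g x))" using w by (intro bddint_mult bddint_cnj) (auto dest: wave_bddint)
  have e: "echar (real a * ?h + real a ^ 2 * 0) * cnj (echar (real b * ?h + real b ^ 2 * 0)) = echar (real_of_int (int a - int b) / real (q ^ l))"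
    unfolding cnj_echar echar_add[symmetric] by (rule arg_cong[of _ _ echar]) (simp add: diff_divide_distrib)
  have "\<not> int (q ^ l) dvd (int a - int b)"
  proof
    assume "int (q ^ l) dvd (int a - int b)"
    then have "int (q ^ l) \<le> \<bar>int a - int b\<bar>" using ab(3) by (intro zdvd_imp_le) auto
    then show False using ab by linarith
  qed
  then show "echar (real a * ?h + real a ^ 2 * 0) * cnj (echar (real b * ?h + real b ^ 2 * 0)) \<noteq> 1"
    unfolding e echar_eq_1_iff by (rule not_dvd_imp_frac) (use q_pos in simp)
  show "f (T ?h 0 x) * cnj (g (T ?h 0 x)) =
      echar (real a * ?h + real a ^ 2 * 0) * cnj (echar (real b * ?h + real b ^ 2 * 0)) * (f x * cnj (g x))" for x
    unfolding waveD[OF w(1) p] waveD[OF w(2) p] by (simp only: complex_cnj_mult mult_ac)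
qed

text \<open>
  The product of two distinct siblings over \<open>t\<close> has its frequency near \<open>z (1, 2 t)\<close> with \<open>z\<close> of norm
  exactly \<open>q^(-j)\<close>. For different \<open>t\<close> these regions are disjoint because the slopes \<open>2 t\<close> differ; this is
  where \<open>q\<close> has to be odd. The shift that detects it is orthogonal to \<open>(1, 2 t)\<close>, and its length
  \<open>q^(j + 1 + v)\<close>, where \<open>q^v\<close> is the exact power of \<open>q\<close> in \<open>t' - t\<close>, is chosen such that the phase over
  \<open>t'\<close> is a fraction with denominator \<open>q\<close>, whereas the one over \<open>t\<close> is an integer.
\<close>

lemma cross_orth:
  assumes t: "t < q ^ j" "t' < q ^ j" "t \<noteq> t'"
    and i: "i < q" "i' < q" and k: "k < q" "k' < q" "k \<noteq> k'"
    and w: "wave (Suc j) (t + q ^ j * i) f1" "wave (Suc j) (t + q ^ j * i') f2"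
       "wave (Suc j) (t' + q ^ j * k) f3" "wave (Suc j) (t' + q ^ j * k') f4"
  shows "(LINT x|M. f1 x * cnj (f2 x) * (f3 x * cnj (f4 x))) = 0"
proof -
  have "\<bar>int t' - int t\<bar> < int q ^ j" using t by (simp add: abs_if flip: of_nat_power)
  then obtain v u where vu: "v < j" "int t' - int t = int q ^ v * u" "\<not> int q dvd u"
    using int_val[of "int t' - int t" q j] t q_gt_1 by auto
  \<comment> \<open>The shift has length \<open>q^(j + 1 + v)\<close> and is orthogonal to \<open>(1, 2 t)\<close>.\<close>
  obtain r where j: "j = v + 1 + r" using vu(1) by (metis add.commute add_Suc less_iff_Suc_add plus_1_eq_Suc)
  define Q A B where "Q = real q" "A = Q ^ v" "B = Q ^ r"
  have nz: "Q \<noteq> 0" "A \<noteq> 0" "B \<noteq> 0" using q_pos by (auto simp: Q_A_B_def)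
  have Qj: "Q ^ j = A * Q * B" by (simp add: j Q_A_B_def power_add)
  define h2 where "h2 = 1 / (A * Q * B * Q * A)"
  define h1 where "h1 = - 2 * real t * h2"
  have t': "real t' = real t + A * of_int u"
  proof -
    have "real_of_int (int t' - int t) = of_int (int q ^ v * u)" using vu(2) by simp
    then show ?thesis by (simp add: Q_A_B_def)
  qed
  have pl: "plank q (Suc j) s h1 h2" if "real s = real t + A * of_int z" for s and z :: int
  proof -
    have e1: "h2 * real q ^ (2 * Suc j) = B * Q * Q"
      unfolding pow_double power_Suc Q_A_B_def(1)[symmetric] Qj h2_def using nz by (simp add: field_simps)
    have e2: "(h1 + 2 * real s * h2) * real q ^ Suc j = 2 * of_int z"
      unfolding power_Suc Q_A_B_def(1)[symmetric] Qj h1_def h2_def that using nz by (simp add: field_simps)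
    show ?thesis unfolding plank_def e1 e2 by (simp add: Q_A_B_def)
  qed
  have R: "real (s + q ^ j * i) = real s + A * Q * B * real i" for s i using Qj by (simp add: Q_A_B_def(1))
  have *: "real (t + q ^ j * i) = real t + A * of_int (int q ^ Suc r * int i)" for i
    unfolding R by (simp add: Q_A_B_def)
  have **: "real (t' + q ^ j * i) = real t + A * of_int (u + int q ^ Suc r * int i)" for i
    unfolding R t' by (simp add: Q_A_B_def algebra_simps)
  let ?N = "(int k - int k') * (2 * u + int q * (int q ^ r * (int k + int k')))"
  have nd: "\<not> int q dvd ?N"
  proof
    have pq: "prime (int q)" using prime_q by simp
    assume "int q dvd ?N"
    then consider "int q dvd int k - int k'" | "int q dvd 2 * u + int q * (int q ^ r * (int k + int k'))"
      using prime_dvd_multD[OF pq] by blast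
    then show False
    proof cases
      case 1 then show False using k zdvd_imp_le[of "int q" "\<bar>int k - int k'\<bar>"] by auto
    next
      case 2
      then have "int q dvd 2 * u" by (simp add: dvd_add_left_iff)
      then have "int q dvd 2" using prime_dvd_multD[OF pq] vu(3) by blast
      then have "int q \<le> 2" by (rule zdvd_imp_le) simp
      then show False using q_ge3 by simp
    qed
  qed
  have "(LINT x|M. (\<lambda>x. 1) x * (f1 x * cnj (f2 x) * (f3 x * cnj (f4 x)))) = 0"
  proof (rule quad_zero[OF w pl[OF *] pl[OF *] pl[OF **] pl[OF **], where B=1])
    let ?p = "\<lambda>a. real a * h1 + real a ^ 2 * h2"
    \<comment> \<open>Completing the square: along this shift the phase depends on the distance of the frequency from \<open>t\<close>.\<close>
    have sq: "?p a = ((real a - real t)\<^sup>2 - real t ^ 2) * h2" for a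
      by (simp add: h1_def power2_eq_square algebra_simps)
    have 1: "?p (t + q ^ j * i) - ?p (t + q ^ j * i') = B * (real i ^ 2 - real i' ^ 2)"
      unfolding sq unfolding R h2_def using nz by (simp add: field_simps power2_eq_square)
    have 2: "?p (t' + q ^ j * k) - ?p (t' + q ^ j * k') = of_int ?N / real q"
      unfolding sq unfolding R t' h2_def using nz unfolding Q_A_B_def(1)[symmetric]
      by (simp add: field_simps power2_eq_square Q_A_B_def(3)[symmetric] Q_A_B_def(1)[symmetric])
    have 3: "B * (real i ^ 2 - real i' ^ 2) \<in> \<int>" by (simp add: Q_A_B_def)
    show "?p (t + q ^ j * i) - ?p (t + q ^ j * i') + ?p (t' + q ^ j * k) - ?p (t' + q ^ j * k') \<notin> \<int>"
    proof
      assume "?p (t + q ^ j * i) - ?p (t + q ^ j * i') + ?p (t' + q ^ j * k) - ?p (t' + q ^ j * k') \<in> \<int>"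
      moreover have "?p (t + q ^ j * i) - ?p (t + q ^ j * i') + ?p (t' + q ^ j * k) - ?p (t' + q ^ j * k')
          = B * (real i ^ 2 - real i' ^ 2) + of_int ?N / real q"
        unfolding 1[symmetric] 2[symmetric] by simp
      ultimately have "B * (real i ^ 2 - real i' ^ 2) + of_int ?N / real q \<in> \<int>" by metis
      then have "B * (real i ^ 2 - real i' ^ 2) + of_int ?N / real q - B * (real i ^ 2 - real i' ^ 2) \<in> \<int>"
        using 3 by (rule Ints_diff)
      then show False using not_dvd_imp_frac[OF nd q_pos] by simp
    qed
  qed simp_all
  then show ?thesis by simp
qed

lemma cross_eq:
  fixes z :: "nat \<Rightarrow> complex"
  shows "complex_of_real ((cmod (\<Sum>i<N. z i))\<^sup>2 - (\<Sum>i<N. (cmod (z i))\<^sup>2)) = (\<Sum>p\<in>{p\<in>{..<N}\<times>{..<N}. fst p \<noteq> snd p}. z (fst p) * cnj (z (snd p)))"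
proof -
  have "complex_of_real ((cmod (\<Sum>i<N. z i))\<^sup>2) = (\<Sum>p\<in>{..<N}\<times>{..<N}. z (fst p) * cnj (z (snd p)))"
    by (simp add: complex_norm_square sum_product sum.cartesian_product case_prod_beta del: of_real_power)
  also have "{..<N}\<times>{..<N} = {p\<in>{..<N}\<times>{..<N}. fst p \<noteq> snd p} \<union> (\<lambda>i. (i, i)) ` {..<N}" by force
  also have "(\<Sum>p\<in>\<dots>. z (fst p) * cnj (z (snd p))) = (\<Sum>p\<in>{p\<in>{..<N}\<times>{..<N}. fst p \<noteq> snd p}. z (fst p) * cnj (z (snd p)))
      + (\<Sum>p\<in>(\<lambda>i. (i, i)) ` {..<N}. z (fst p) * cnj (z (snd p)))"
    by (rule sum.union_disjoint) auto
  also have "(\<Sum>p\<in>(\<lambda>i. (i, i)) ` {..<N}. z (fst p) * cnj (z (snd p))) = (\<Sum>i<N. z i * cnj (z i))"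
    by (subst sum.reindex) (auto simp: inj_on_def)
  also have "\<dots> = complex_of_real (\<Sum>i<N. (cmod (z i))\<^sup>2)" by (simp add: complex_norm_square del: of_real_power)
  finally show ?thesis by simp
qed

lemma norm_sum_sq_le:
  fixes z :: "nat \<Rightarrow> complex"
  shows "(cmod (\<Sum>i\<in>A. z i))\<^sup>2 \<le> real (card A) * (\<Sum>i\<in>A. (cmod (z i))\<^sup>2)"
proof -
  have "(cmod (\<Sum>i\<in>A. z i))\<^sup>2 \<le> (\<Sum>i\<in>A. 1 * cmod (z i))\<^sup>2" by (intro power_mono) (simp_all add: norm_sum)
  also have "\<dots> \<le> (\<Sum>i\<in>A. 1\<^sup>2) * (\<Sum>i\<in>A. (cmod (z i))\<^sup>2)" by (rule Cauchy_Schwarz_ineq_sum)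
  finally show ?thesis by simp
qed

text \<open>
  The difference between the square function of the parents and that of their children is a sum of
  products of distinct siblings. It is orthogonal for different parents, and for one parent it is at most
  \<open>q\<close> times the sum of the squared children, by Cauchy-Schwarz. The bound \<open>c\<close> on the children turns their
  fourth powers into squares.
\<close>

lemma high_estimate:
  assumes F: "\<And>s. s < q ^ Suc j \<Longrightarrow> wave (Suc j) s (F s)" and c: "\<And>s x. s < q ^ Suc j \<Longrightarrow> cmod (F s x) \<le> c"
    and G: "\<And>t x. t < q ^ j \<Longrightarrow> G t x = (\<Sum>i<q. F (t + q ^ j * i) x)"
  shows "(LINT x|M. ((\<Sum>t<q ^ j. (cmod (G t x))\<^sup>2) - (\<Sum>s<q ^ Suc j. (cmod (F s x))\<^sup>2))\<^sup>2)
       \<le> real q ^ 3 * c\<^sup>2 * (LINT x|M. (\<Sum>s<q ^ Suc j. (cmod (F s x))\<^sup>2))" (is ?high)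
    and "(LINT x|M. (\<Sum>t<q ^ j. (cmod (G t x))\<^sup>2)) = (LINT x|M. (\<Sum>s<q ^ Suc j. (cmod (F s x))\<^sup>2))" (is ?mass)
    and "integrable M (\<lambda>x. ((\<Sum>t<q ^ j. (cmod (G t x))\<^sup>2) - (\<Sum>s<q ^ Suc j. (cmod (F s x))\<^sup>2))\<^sup>2)" (is ?int)
proof -
  let ?z = "\<lambda>t i. F (t + q ^ j * i)"
  let ?P = "{p\<in>{..<q}\<times>{..<q}. fst p \<noteq> snd p}"
  define E where "E t x = complex_of_real ((cmod (\<Sum>i<q. ?z t i x))\<^sup>2 - (\<Sum>i<q. (cmod (?z t i x))\<^sup>2))" for t x
  have E: "E t x = (\<Sum>p\<in>?P. ?z t (fst p) x * cnj (?z t (snd p) x))" for t x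
    unfolding E_def by (rule cross_eq)
  have w: "wave (Suc j) (t + q ^ j * i) (?z t i)" if "t < q ^ j" "i < q" for t i
    by (rule F[OF child_less[OF that]])
  have b: "bddint M (?z t i)" if "t < q ^ j" "i < q" for t i by (rule wave_bddint[OF w[OF that]])
  have bE: "bddint M (E t)" if t: "t < q ^ j" for t
    unfolding E[abs_def] by (intro bddint_sum bddint_mult bddint_cnj b t) auto
  have cE: "cnj (E t x) = E t x" for t x by (simp add: E_def)
  have oE: "(LINT x|M. E t x * cnj (E t' x)) = 0" if t: "t \<in> {..<q ^ j}" "t' \<in> {..<q ^ j}" "t \<noteq> t'" for t t'
  proof -
    have "(LINT x|M. E t x * cnj (E t' x)) = (LINT x|M. (\<Sum>p\<in>?P. \<Sum>r\<in>?P. ?z t (fst p) x * cnj (?z t (snd p) x) * (?z t' (fst r) x * cnj (?z t' (snd r) x))))"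
      unfolding cE unfolding E sum_product ..
    also have "\<dots> = (\<Sum>p\<in>?P. \<Sum>r\<in>?P. LINT x|M. ?z t (fst p) x * cnj (?z t (snd p) x) * (?z t' (fst r) x * cnj (?z t' (snd r) x)))"
    proof -
      have *: "integrable M (\<lambda>x. ?z t (fst p) x * cnj (?z t (snd p) x) * (?z t' (fst r) x * cnj (?z t' (snd r) x)))"
        if "p \<in> ?P" "r \<in> ?P" for p r
        using that t by (intro bddint_integrable bddint_mult bddint_cnj b) auto
      show ?thesis by (simp only: Bochner_Integration.integral_sum Bochner_Integration.integrable_sum * cong: sum.cong)
    qed
    also have "\<dots> = 0"
    proof (intro sum.neutral ballI)
      fix p r assume "p \<in> ?P" "r \<in> ?P"
      then show "(LINT x|M. ?z t (fst p) x * cnj (?z t (snd p) x) * (?z t' (fst r) x * cnj (?z t' (snd r) x))) = 0"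
        using t by (intro cross_orth[of t j t' "fst p" "snd p" "fst r" "snd r"] w) auto
    qed
    finally show ?thesis .
  qed
  have sE: "(\<Sum>t<q ^ j. (cmod (G t x))\<^sup>2) - (\<Sum>s<q ^ Suc j. (cmod (F s x))\<^sup>2) = Re (\<Sum>t<q ^ j. E t x)" for x
    unfolding sum_children sum_subtractf[symmetric] Re_sum by (rule sum.cong) (auto simp: E_def G)
  have sE2: "((\<Sum>t<q ^ j. (cmod (G t x))\<^sup>2) - (\<Sum>s<q ^ Suc j. (cmod (F s x))\<^sup>2))\<^sup>2 = (cmod (\<Sum>t<q ^ j. E t x))\<^sup>2" for x
  proof -
    have "(\<Sum>t<q ^ j. E t x) = of_real (Re (\<Sum>t<q ^ j. E t x))" by (simp add: E_def)
    then have "cmod (\<Sum>t<q ^ j. E t x) = \<bar>Re (\<Sum>t<q ^ j. E t x)\<bar>" by (metis norm_of_real)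
    then show ?thesis unfolding sE by simp
  qed
  have bs: "bddint M (\<lambda>x. \<Sum>t<q ^ j. E t x)" by (intro bddint_sum bE) auto
  show ?int unfolding sE2 by (rule bddint_sq[OF bs])
  have i2: "integrable M (\<lambda>x. (cmod (?z t i x))\<^sup>2)" if "t < q ^ j" "i < q" for t i by (rule bddint_sq[OF b[OF that]])
  have Eb: "(cmod (E t x))\<^sup>2 \<le> real q ^ 3 * c\<^sup>2 * (\<Sum>i<q. (cmod (?z t i x))\<^sup>2)" if t: "t < q ^ j" for t x
  proof -
    let ?S = "\<Sum>i<q. (cmod (?z t i x))\<^sup>2"
    have S: "0 \<le> ?S" by (intro sum_nonneg) auto
    have le: "?S \<le> real q * ?S" using S q_gt_1 by (simp add: mult_le_cancel_right1)
    have "(cmod (\<Sum>i<q. ?z t i x))\<^sup>2 \<le> real q * ?S" using norm_sum_sq_le[of "\<lambda>i. ?z t i x" "{..<q}"] by simp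
    then have "\<bar>(cmod (\<Sum>i<q. ?z t i x))\<^sup>2 - ?S\<bar> \<le> real q * ?S" using S le zero_le_power2[of "cmod (\<Sum>i<q. ?z t i x)"]
      unfolding abs_le_iff by linarith
    then have 1: "cmod (E t x) \<le> real q * ?S" unfolding E_def norm_of_real .
    have "?S \<le> (\<Sum>i<q. c\<^sup>2)" by (intro sum_mono power_mono c child_less t) auto
    then have 2: "?S \<le> real q * c\<^sup>2" by simp
    have "(cmod (E t x))\<^sup>2 \<le> (real q * ?S)\<^sup>2" using 1 by (intro power_mono) auto
    also have "\<dots> = (real q)\<^sup>2 * ?S * ?S" by (simp add: power2_eq_square)
    also have "\<dots> \<le> (real q)\<^sup>2 * ?S * (real q * c\<^sup>2)" using 2 S by (intro mult_left_mono) auto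
    finally show ?thesis by (simp add: power2_eq_square power3_eq_cube mult_ac)
  qed
  have "(LINT x|M. (cmod (\<Sum>t<q ^ j. E t x))\<^sup>2) = (\<Sum>t<q ^ j. LINT x|M. (cmod (E t x))\<^sup>2)"
    by (rule integral_norm_sum_sq) (use bE oE in auto)
  also have "\<dots> \<le> (\<Sum>t<q ^ j. LINT x|M. real q ^ 3 * c\<^sup>2 * (\<Sum>i<q. (cmod (?z t i x))\<^sup>2))"
    by (intro sum_mono integral_mono Eb bddint_sq bE Bochner_Integration.integrable_sum integrable_mult_right i2) auto
  also have "\<dots> = real q ^ 3 * c\<^sup>2 * (\<Sum>t<q ^ j. LINT x|M. (\<Sum>i<q. (cmod (?z t i x))\<^sup>2))"
    by (subst sum_distrib_left) (simp only: Bochner_Integration.integral_mult_right_zero)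
  also have "(\<Sum>t<q ^ j. LINT x|M. (\<Sum>i<q. (cmod (?z t i x))\<^sup>2)) = (LINT x|M. (\<Sum>s<q ^ Suc j. (cmod (F s x))\<^sup>2))"
    unfolding sum_children by (subst Bochner_Integration.integral_sum) (auto intro!: i2)
  finally show ?high unfolding sE2 .
  have "(LINT x|M. E t x) = 0" if t: "t < q ^ j" for t
  proof -
    have "(LINT x|M. E t x) = (\<Sum>p\<in>?P. LINT x|M. ?z t (fst p) x * cnj (?z t (snd p) x))"
      unfolding E using t by (intro Bochner_Integration.integral_sum bddint_integrable bddint_mult bddint_cnj b) auto
    also have "\<dots> = 0"
      using t q_pos by (intro sum.neutral ballI pair_zero[OF w w] child_less) auto
    finally show ?thesis .
  qed
  then have "(LINT x|M. Re (\<Sum>t<q ^ j. E t x)) = 0"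
    using bE bs by (simp add: bddint_integrable integral_sum)
  moreover have iR: "integrable M (\<lambda>x. Re (\<Sum>t<q ^ j. E t x))" using bddint_integrable[OF bs] by (rule integrable_Re)
  moreover have iF: "integrable M (\<lambda>x. (\<Sum>s<q ^ Suc j. (cmod (F s x))\<^sup>2))"
    by (intro Bochner_Integration.integrable_sum bddint_sq) (auto intro: wave_bddint[OF F])
  moreover have "(LINT x|M. (\<Sum>t<q ^ j. (cmod (G t x))\<^sup>2)) = (LINT x|M. Re (\<Sum>t<q ^ j. E t x) + (\<Sum>s<q ^ Suc j. (cmod (F s x))\<^sup>2))"
    unfolding sE[symmetric] by simp
  ultimately show ?mass using Bochner_Integration.integral_add[OF iR iF] by linarith
qed

section \<open>Orthogonality of products of siblings\<close>

text \<open>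
  If the frequencies of two products agree to the precision \<open>q^k\<close> in the first and, after the affine map
  that sends the arc over \<open>t0\<close> to the whole parabola, \<open>q^(k - m)\<close> in the second coordinate, then
  \<open>s1 + s2 = s3 + s4\<close> and \<open>s1^2 + s2^2 = s3^2 + s4^2\<close> modulo \<open>q^(k - m)\<close> for the rescaled frequencies. This
  gives \<open>(s1 - s3) (s1 + s3 - s2 - s4) = 0\<close>, and the second factor is congruent to \<open>2 (s1 - s2)\<close> modulo
  \<open>q\<close>, a unit since the two arcs are distinct siblings. So the pairs of frequencies coincide. A
  disagreement in the first coordinate is detected by a horizontal shift, one in the second coordinate by
  a shift orthogonal to \<open>(1, 2 t0)\<close>; both belong to all planks of scale \<open>k\<close> inside the arc.
\<close>

lemma bilinear_orth:
  assumes mk: "m < k" and t: "t1 < q ^ k" "t2 < q ^ k" "t3 < q ^ k" "t4 < q ^ k"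
    and r1: "t1 mod q ^ Suc m = r1" "t3 mod q ^ Suc m = r1"
    and r2: "t2 mod q ^ Suc m = r2" "t4 mod q ^ Suc m = r2"
    and r: "r1 mod q ^ m = t0" "r2 mod q ^ m = t0" "r1 \<noteq> r2"
    and ne: "(t1, t2) \<noteq> (t3, t4)"
    and w: "wave k t1 f1" "wave k t2 f2" "wave k t3 f3" "wave k t4 f4"
    and V: "V \<in> borel_measurable M" "\<And>x. V x = 0 \<or> V x = (1::real)"
      "\<And>h1 h2 x. (\<And>t. t mod q ^ m = t0 \<Longrightarrow> plank q k t h1 h2) \<Longrightarrow> V (T h1 h2 x) = V x"
  shows "(LINT x|M. of_real (V x) * (f1 x * cnj (f3 x) * (f2 x * cnj (f4 x)))) = 0"
proof -
  note q0 = q_pos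
  have t0: "t1 mod q ^ m = t0" "t2 mod q ^ m = t0" "t3 mod q ^ m = t0" "t4 mod q ^ m = t0"
    using r1 r2 r mod_mod_cancel[of "q ^ m" "q ^ Suc m"] by (metis dvd_triv_right power_Suc)+
  define \<sigma> where "\<sigma> t = int (t div q ^ m)" for t
  have dec: "t = t0 + q ^ m * (t div q ^ m)" if "t mod q ^ m = t0" for t
    using that mult_div_mod_eq[of "q ^ m" t] by simp
  have decr: "real t = real t0 + real q ^ m * of_int (\<sigma> t)" if "t mod q ^ m = t0" for t
    unfolding \<sigma>_def of_int_of_nat_eq of_nat_power[symmetric] of_nat_mult[symmetric] of_nat_add[symmetric]
    using dec[OF that] by simp
  have dig: "t mod q ^ Suc m = q ^ m * (t div q ^ m mod q) + t0" if "t mod q ^ m = t0" for t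
    using that mod_mult2_eq[of t "q ^ m" q] by (simp add: mult.commute)
  have sm: "\<sigma> t mod int q = int (t div q ^ m mod q)" for t by (simp add: \<sigma>_def zmod_int)
  have s13: "int q dvd \<sigma> t1 - \<sigma> t3" "int q dvd \<sigma> t2 - \<sigma> t4"
  proof -
    have "q ^ m * (t1 div q ^ m mod q) = q ^ m * (t3 div q ^ m mod q)"
      using r1 unfolding dig[OF t0(1)] dig[OF t0(3)] by linarith
    then show "int q dvd \<sigma> t1 - \<sigma> t3" unfolding mod_eq_dvd_iff[symmetric] sm using q0 by simp
    have "q ^ m * (t2 div q ^ m mod q) = q ^ m * (t4 div q ^ m mod q)"
      using r2 unfolding dig[OF t0(2)] dig[OF t0(4)] by linarith
    then show "int q dvd \<sigma> t2 - \<sigma> t4" unfolding mod_eq_dvd_iff[symmetric] sm using q0 by simp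
  qed
  have s12: "\<not> int q dvd \<sigma> t1 - \<sigma> t2"
    using dig[OF t0(1)] dig[OF t0(2)] r1 r2 r(3) unfolding mod_eq_dvd_iff[symmetric] sm by auto
  define d where "d = k - m"
  have k: "k = m + d" using mk by (simp add: d_def)
  have sl: "\<sigma> t < int q ^ d" "\<sigma> t \<ge> 0" if "t < q ^ k" for t
  proof -
    have "t div q ^ m < q ^ d" using that q0 by (simp add: k power_add less_mult_imp_div_less mult.commute)
    then show "\<sigma> t < int q ^ d" unfolding \<sigma>_def by (metis of_nat_less_iff of_nat_power)
  qed (simp add: \<sigma>_def)
  have small: "x = y" if "int q ^ d dvd x - y" "x < int q ^ d" "x \<ge> 0" "y < int q ^ d" "y \<ge> 0" for x y
    using that by (metis mod_eq_dvd_iff mod_pos_pos_trivial)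
  have VB: "cmod (of_real (V x)) \<le> 1" for x using V(2)[of x] by auto
  have Vm: "(\<lambda>x. complex_of_real (V x)) \<in> borel_measurable M" using V(1) by simp
  let ?A = "int t1 - int t3 + int t2 - int t4"
  show ?thesis
  proof (cases "int (q ^ k) dvd ?A")
    case False
    have pl: "plank q k t (1 / real q ^ k) 0" for t using q0 by (simp add: plank_def)
    show ?thesis
    proof (rule quad_zero[OF w(1) w(3) w(2) w(4) pl pl pl pl Vm VB])
      show "complex_of_real (V (T (1 / real q ^ k) 0 x)) = of_real (V x)" for x using V(3)[OF pl] by simp
      have "real_of_int ?A / real (q ^ k) \<notin> \<int>" by (rule not_dvd_imp_frac[OF False]) (use q0 in simp)
      then show "real t1 * (1 / real q ^ k) + real t1 ^ 2 * 0 - (real t3 * (1 / real q ^ k) + real t3 ^ 2 * 0) +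
          (real t2 * (1 / real q ^ k) + real t2 ^ 2 * 0) - (real t4 * (1 / real q ^ k) + real t4 ^ 2 * 0) \<notin> \<int>"
        by (simp add: add_divide_distrib diff_divide_distrib)
    qed
  next
    case True
    \<comment> \<open>Orthogonal to \<open>(1, 2 t0)\<close>, of length \<open>q^(k + m)\<close>; horizontal precision is already settled by the case assumption.\<close>
    define h2 where "h2 = 1 / (real q ^ m * real q ^ m * real q ^ d)"
    define h1 where "h1 = - 2 * real t0 * h2"
    have pl: "plank q k t h1 h2" if "t mod q ^ m = t0" for t
    proof -
      have e1: "h2 * real q ^ (2 * k) = real q ^ d"
        unfolding pow_double h2_def k power_add using q0 by (simp add: field_simps)
      have e2: "(h1 + 2 * real t * h2) * real q ^ k = 2 * of_int (\<sigma> t)"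
        unfolding decr[OF that] h1_def h2_def k power_add using q0 by (simp add: field_simps)
      show ?thesis unfolding plank_def e1 e2 by simp
    qed
    let ?N = "\<sigma> t1 ^ 2 - \<sigma> t3 ^ 2 + \<sigma> t2 ^ 2 - \<sigma> t4 ^ 2"
    show ?thesis
    proof (rule quad_zero[OF w(1) w(3) w(2) w(4) pl[OF t0(1)] pl[OF t0(3)] pl[OF t0(2)] pl[OF t0(4)] Vm VB])
      show "complex_of_real (V (T h1 h2 x)) = of_real (V x)" for x using V(3)[OF pl] by simp
      have nd: "\<not> int (q ^ d) dvd ?N"
      proof
        assume N: "int (q ^ d) dvd ?N"
        have "int t = int t0 + int q ^ m * \<sigma> t" if "t mod q ^ m = t0" for t
          using decr[OF that] by (metis (mono_tags, lifting) of_int_add of_int_eq_iff of_int_mult of_int_of_nat_eq of_int_power)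
        then have "?A = int q ^ m * (\<sigma> t1 - \<sigma> t3 + \<sigma> t2 - \<sigma> t4)" using t0 by (simp add: algebra_simps)
        then have B: "int q ^ d dvd \<sigma> t1 - \<sigma> t3 + \<sigma> t2 - \<sigma> t4" using True q0 by (simp add: k power_add)
        have "?N = (\<sigma> t1 - \<sigma> t3) * (\<sigma> t1 + \<sigma> t3 - \<sigma> t2 - \<sigma> t4) + (\<sigma> t1 - \<sigma> t3 + \<sigma> t2 - \<sigma> t4) * (\<sigma> t2 + \<sigma> t4)"
          by (simp add: power2_eq_square algebra_simps)
        then have P: "int q ^ d dvd (\<sigma> t1 - \<sigma> t3) * (\<sigma> t1 + \<sigma> t3 - \<sigma> t2 - \<sigma> t4)"
          using N B by (simp add: dvd_add_left_iff)
        have pq: "prime (int q)" using prime_q by simp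
        have "\<not> int q dvd \<sigma> t1 + \<sigma> t3 - \<sigma> t2 - \<sigma> t4"
        proof
          assume D: "int q dvd \<sigma> t1 + \<sigma> t3 - \<sigma> t2 - \<sigma> t4"
          have "int q dvd (\<sigma> t1 + \<sigma> t3 - \<sigma> t2 - \<sigma> t4) + (\<sigma> t1 - \<sigma> t3) - (\<sigma> t2 - \<sigma> t4)"
            by (rule dvd_diff[OF dvd_add[OF D s13(1)] s13(2)])
          also have "(\<sigma> t1 + \<sigma> t3 - \<sigma> t2 - \<sigma> t4) + (\<sigma> t1 - \<sigma> t3) - (\<sigma> t2 - \<sigma> t4) = 2 * (\<sigma> t1 - \<sigma> t2)" by simp
          finally have "int q dvd 2" using prime_dvd_multD[OF pq] s12 by blast
          then have "int q \<le> 2" by (rule zdvd_imp_le) simp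
          then show False using q_ge3 by simp
        qed
        then have "coprime (int q ^ d) (\<sigma> t1 + \<sigma> t3 - \<sigma> t2 - \<sigma> t4)"
          using prime_imp_coprime[OF pq] by simp
        then have "int q ^ d dvd \<sigma> t1 - \<sigma> t3" using P by (simp add: coprime_dvd_mult_left_iff)
        then have e13: "\<sigma> t1 = \<sigma> t3" using small sl t by blast
        then have "int q ^ d dvd \<sigma> t2 - \<sigma> t4" using B by simp
        then have "\<sigma> t2 = \<sigma> t4" using small sl t by blast
        then show False using e13 ne decr[OF t0(1)] decr[OF t0(2)] decr[OF t0(3)] decr[OF t0(4)] by simp
      qed
      let ?p = "\<lambda>a. real a * h1 + real a ^ 2 * h2"
      have sq: "?p a = ((real a - real t0)\<^sup>2 - real t0 ^ 2) * h2" for a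
        by (simp add: h1_def power2_eq_square algebra_simps)
      have sq': "?p a = of_int (\<sigma> a ^ 2) / real q ^ d - real t0 ^ 2 * h2" if "a mod q ^ m = t0" for a
        unfolding sq unfolding decr[OF that] h2_def using q0 by (simp add: field_simps power2_eq_square)
      have e: "?p t1 - ?p t3 + ?p t2 - ?p t4 = of_int ?N / real (q ^ d)"
        unfolding t0[THEN sq'] by (simp add: add_divide_distrib diff_divide_distrib)
      show "?p t1 - ?p t3 + ?p t2 - ?p t4 \<notin> \<int>"
        unfolding e by (rule not_dvd_imp_frac[OF nd]) (use q0 in simp)
    qed
  qed
qed

text \<open>
  Parseval for the products of a packet in one sibling with a packet in the other. The weight \<open>V\<close> is meant
  to be the indicator of the set where a stopping rule of scale \<open>k\<close> applies.
\<close>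

lemma bilinear_identity:
  assumes mk: "m < k" and r: "r1 mod q ^ m = t0" "r2 mod q ^ m = t0" "r1 \<noteq> r2"
    and F: "\<And>t. t < q ^ k \<Longrightarrow> wave k t (F t)"
    and V: "V \<in> borel_measurable M" "\<And>x. V x = 0 \<or> V x = (1::real)"
      "\<And>h1 h2 x. (\<And>t. t mod q ^ m = t0 \<Longrightarrow> plank q k t h1 h2) \<Longrightarrow> V (T h1 h2 x) = V x"
  defines "I r \<equiv> {t. t < q ^ k \<and> t mod q ^ Suc m = r}"
  shows "(LINT x|M. V x * ((cmod (\<Sum>t\<in>I r1. F t x))\<^sup>2 * (cmod (\<Sum>t\<in>I r2. F t x))\<^sup>2))
       = (LINT x|M. V x * ((\<Sum>t\<in>I r1. (cmod (F t x))\<^sup>2) * (\<Sum>t\<in>I r2. (cmod (F t x))\<^sup>2)))"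
proof -
  have fin: "finite (I r)" for r unfolding I_def by simp
  define g where "g p x = of_real (V x) * (F (fst p) x * F (snd p) x)" for p x
  have Vm: "(\<lambda>x. complex_of_real (V x)) \<in> borel_measurable M" using V(1) by simp
  have VB: "cmod (of_real (V x)) \<le> 1" for x using V(2)[of x] by auto
  have bF: "bddint M (F t)" if "t \<in> I r" for t r using that wave_bddint[OF F] by (auto simp: I_def)
  have bg: "bddint M (g p)" if "p \<in> I r1 \<times> I r2" for p
    unfolding g_def[abs_def] using that by (intro bddint_bdd_mult[OF _ Vm VB] bddint_mult bF) auto
  have VV: "(V x)\<^sup>2 = V x" for x using V(2)[of x] by auto
  have "(LINT x|M. V x * ((cmod (\<Sum>t\<in>I r1. F t x))\<^sup>2 * (cmod (\<Sum>t\<in>I r2. F t x))\<^sup>2)) = (LINT x|M. (cmod (\<Sum>p\<in>I r1 \<times> I r2. g p x))\<^sup>2)"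
  proof (rule Bochner_Integration.integral_cong[OF refl])
    fix x
    have "(\<Sum>p\<in>I r1 \<times> I r2. g p x) = of_real (V x) * ((\<Sum>t\<in>I r1. F t x) * (\<Sum>t\<in>I r2. F t x))"
      unfolding g_def sum_distrib_left[symmetric] unfolding sum_product sum.cartesian_product by (simp add: case_prod_beta)
    then show "V x * ((cmod (\<Sum>t\<in>I r1. F t x))\<^sup>2 * (cmod (\<Sum>t\<in>I r2. F t x))\<^sup>2) = (cmod (\<Sum>p\<in>I r1 \<times> I r2. g p x))\<^sup>2"
      by (simp add: norm_mult power_mult_distrib VV)
  qed
  also have "\<dots> = (\<Sum>p\<in>I r1 \<times> I r2. LINT x|M. (cmod (g p x))\<^sup>2)"
  proof (rule integral_norm_sum_sq)
    fix p s assume ps: "p \<in> I r1 \<times> I r2" "s \<in> I r1 \<times> I r2" "p \<noteq> s"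
    have "(LINT x|M. g p x * cnj (g s x)) = (LINT x|M. of_real (V x) * (F (fst p) x * cnj (F (fst s) x) * (F (snd p) x * cnj (F (snd s) x))))"
    proof (rule Bochner_Integration.integral_cong[OF refl])
      fix x show "g p x * cnj (g s x) = of_real (V x) * (F (fst p) x * cnj (F (fst s) x) * (F (snd p) x * cnj (F (snd s) x)))"
        using V(2)[of x] by (auto simp: g_def)
    qed
    also have "\<dots> = 0"
      using ps by (intro bilinear_orth[OF mk, where ?t1.0="fst p" and ?t2.0="snd p" and ?t3.0="fst s" and ?t4.0="snd s"
          and ?r1.0=r1 and ?r2.0=r2 and ?t0.0=t0] r F V) (auto simp: I_def prod_eq_iff)
    finally show "(LINT x|M. g p x * cnj (g s x)) = 0" .
  qed (use fin bg in auto)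
  also have "\<dots> = (LINT x|M. (\<Sum>p\<in>I r1 \<times> I r2. (cmod (g p x))\<^sup>2))"
    by (rule Bochner_Integration.integral_sum[symmetric]) (rule bddint_sq[OF bg])
  also have "\<dots> = (LINT x|M. V x * ((\<Sum>t\<in>I r1. (cmod (F t x))\<^sup>2) * (\<Sum>t\<in>I r2. (cmod (F t x))\<^sup>2)))"
    unfolding sum_product sum.cartesian_product
    by (simp add: g_def case_prod_beta norm_mult power_mult_distrib VV sum_distrib_left del: sum_distrib_right)
  finally show ?thesis .
qed

end

section \<open>Pruning wave packets\<close>

text \<open>
  Packets are clipped at the finest scale \<open>n\<close>, added up to packets of scale \<open>n - 1\<close>, clipped again, and so
  on. The recursion runs over the number \<open>d\<close> of steps, so the result has scale \<open>n - d\<close>.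
\<close>

primrec prune :: "nat \<Rightarrow> nat \<Rightarrow> (nat \<Rightarrow> 'a \<Rightarrow> complex) \<Rightarrow> real \<Rightarrow> nat \<Rightarrow> nat \<Rightarrow> 'a \<Rightarrow> complex" where
  "prune q n f c 0 t = clip c (f t)"
| "prune q n f c (Suc d) t = clip c (\<lambda>x. \<Sum>i<q. prune q n f c d (t + q ^ (n - Suc d) * i) x)"

text \<open>
  Clipping at \<open>c\<close> removes only values above \<open>c\<close>, and these are at most their square over \<open>c\<close>. In this way
  the square function controls the error in a sum of absolute values.
\<close>

lemma clip_error: "c > 0 \<Longrightarrow> cmod (f x - clip c f x) \<le> (cmod (f x))\<^sup>2 / c"
  by (auto simp: clip_def field_simps power2_eq_square intro!: mult_right_mono)

lemma mod_add_power_mult: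
  fixes q :: nat
  assumes "l \<le> j" shows "(t + q ^ j * i) mod q ^ l = t mod q ^ l"
proof -
  have "q ^ l dvd q ^ j * i" using assms by (simp add: le_imp_power_dvd dvd_mult2)
  then show ?thesis by (elim dvdE) simp
qed

locale wave_family = qtranslations +
  fixes n :: nat and f :: "nat \<Rightarrow> 'a \<Rightarrow> complex" and b :: "nat \<Rightarrow> real"
  assumes f_wave: "\<And>t. t < q ^ n \<Longrightarrow> wave n t (f t)"
    and f_le: "\<And>t x. t < q ^ n \<Longrightarrow> cmod (f t x) \<le> b t"
begin

definition sup_sum :: real where "sup_sum = (\<Sum>t<q ^ n. (b t)\<^sup>2)"
definition mass :: real where "mass = (\<Sum>t<q ^ n. LINT x|M. (cmod (f t x))\<^sup>2)"

definition arc :: "nat \<Rightarrow> nat \<Rightarrow> 'a \<Rightarrow> complex" where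
  "arc k t x = (\<Sum>s | s < q ^ n \<and> s mod q ^ k = t. f s x)"

text \<open>
  \<open>merged c j\<close> are the packets of scale \<open>j\<close> just before they are clipped, and \<open>pruned c j\<close> just after.
  At the finest scale the packets to be clipped are those of the family.
\<close>

definition pruned :: "real \<Rightarrow> nat \<Rightarrow> nat \<Rightarrow> 'a \<Rightarrow> complex" where
  "pruned c j = prune q n f c (n - j)"
definition merged :: "real \<Rightarrow> nat \<Rightarrow> nat \<Rightarrow> 'a \<Rightarrow> complex" where
  "merged c j t x = (if j = n then f t x else \<Sum>i<q. pruned c (Suc j) (t + q ^ j * i) x)"
definition pruned_sq :: "real \<Rightarrow> nat \<Rightarrow> 'a \<Rightarrow> real" where
  "pruned_sq c j x = (\<Sum>t<q ^ j. (cmod (pruned c j t x))\<^sup>2)"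
definition merged_sq :: "real \<Rightarrow> nat \<Rightarrow> 'a \<Rightarrow> real" where
  "merged_sq c j x = (\<Sum>t<q ^ j. (cmod (merged c j t x))\<^sup>2)"

lemma pruned_eq_clip:
  assumes "j \<le> n" shows "pruned c j t = clip c (merged c j t)"
proof (cases "j = n")
  case True then show ?thesis by (simp add: pruned_def merged_def[abs_def])
next
  case False
  then have "n - j = Suc (n - Suc j)" "n - Suc (n - Suc j) = j" using assms by auto
  then show ?thesis using False by (simp add: pruned_def merged_def[abs_def])
qed

lemma merged_wave: "j \<le> n \<Longrightarrow> t < q ^ j \<Longrightarrow> wave j t (merged c j t)"
proof (induction j arbitrary: t rule: inc_induct)
  case base then show ?case by (simp add: merged_def[abs_def] f_wave)
next
  case (step j)
  have "wave (Suc j) (t + q ^ j * i) (pruned c (Suc j) (t + q ^ j * i))" if "i < q" for i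
    using step child_less[OF step.prems that] by (simp add: pruned_eq_clip wave_clip)
  then have "wave j t (\<lambda>x. \<Sum>i<q. pruned c (Suc j) (t + q ^ j * i) x)"
    by (intro wave_sum wave_coarser[of j "Suc j"]) auto
  then show ?case using step by (simp add: merged_def[abs_def])
qed

lemma pruned_wave: "j \<le> n \<Longrightarrow> t < q ^ j \<Longrightarrow> wave j t (pruned c j t)"
  by (simp add: pruned_eq_clip wave_clip merged_wave)

lemma pruned_le: "j \<le> n \<Longrightarrow> c \<ge> 0 \<Longrightarrow> cmod (pruned c j t x) \<le> c"
  by (simp add: pruned_eq_clip cmod_clip_le')

lemma pruned_sq_nonneg: "0 \<le> pruned_sq c j x"
  by (auto simp: pruned_sq_def intro: sum_nonneg)

lemma pruned_sq_le_merged: "j \<le> n \<Longrightarrow> pruned_sq c j x \<le> merged_sq c j x"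
  unfolding pruned_sq_def merged_sq_def by (intro sum_mono power_mono) (auto simp: pruned_eq_clip cmod_clip_le)

lemma merged_sq_le_pruned:
  assumes "j < n" shows "merged_sq c j x \<le> real q * pruned_sq c (Suc j) x"
proof -
  have "(cmod (merged c j t x))\<^sup>2 \<le> real q * (\<Sum>i<q. (cmod (pruned c (Suc j) (t + q ^ j * i) x))\<^sup>2)" for t
    using norm_sum_sq_le[of "\<lambda>i. pruned c (Suc j) (t + q ^ j * i) x" "{..<q}"] assms by (simp add: merged_def)
  then have "merged_sq c j x \<le> (\<Sum>t<q ^ j. real q * (\<Sum>i<q. (cmod (pruned c (Suc j) (t + q ^ j * i) x))\<^sup>2))"
    unfolding merged_sq_def by (intro sum_mono)
  then show ?thesis unfolding pruned_sq_def sum_children sum_distrib_left[of "real q" _ "{..<q ^ j}"] .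
qed

lemma merged_sq_top_le: "merged_sq c n x \<le> sup_sum"
  unfolding merged_sq_def sup_sum_def by (intro sum_mono power_mono) (auto simp: merged_def f_le)

lemma integrable_pruned_sq: "j \<le> n \<Longrightarrow> integrable M (pruned_sq c j)" and integrable_merged_sq: "j \<le> n \<Longrightarrow> integrable M (merged_sq c j)"
  unfolding pruned_sq_def[abs_def] merged_sq_def[abs_def]
  by (intro Bochner_Integration.integrable_sum bddint_sq wave_bddint[OF pruned_wave] wave_bddint[OF merged_wave]; simp)+

lemma high_estimate_pruned:
  assumes "j < n" "c \<ge> 0"
  shows "(LINT x|M. (merged_sq c j x - pruned_sq c (Suc j) x)\<^sup>2) \<le> real q ^ 3 * c\<^sup>2 * (LINT x|M. pruned_sq c (Suc j) x)"
    and "(LINT x|M. merged_sq c j x) = (LINT x|M. pruned_sq c (Suc j) x)"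
    and "integrable M (\<lambda>x. (merged_sq c j x - pruned_sq c (Suc j) x)\<^sup>2)"
proof -
  have 1: "wave (Suc j) s (pruned c (Suc j) s)" if "s < q ^ Suc j" for s using that assms by (intro pruned_wave) auto
  have 2: "cmod (pruned c (Suc j) s x) \<le> c" for s x using assms by (intro pruned_le) auto
  have 3: "merged c j t x = (\<Sum>i<q. pruned c (Suc j) (t + q ^ j * i) x)" for t x using assms by (simp add: merged_def)
  show "(LINT x|M. (merged_sq c j x - pruned_sq c (Suc j) x)\<^sup>2) \<le> real q ^ 3 * c\<^sup>2 * (LINT x|M. pruned_sq c (Suc j) x)"
    "(LINT x|M. merged_sq c j x) = (LINT x|M. pruned_sq c (Suc j) x)"
    "integrable M (\<lambda>x. (merged_sq c j x - pruned_sq c (Suc j) x)\<^sup>2)"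
    unfolding merged_sq_def pruned_sq_def by (rule high_estimate[OF 1 2 3]; assumption)+
qed

text \<open>
  Adding up siblings preserves the integral of the square function, and clipping lowers it.
\<close>

lemma integral_merged_sq_le: "j \<le> n \<Longrightarrow> c \<ge> 0 \<Longrightarrow> (LINT x|M. merged_sq c j x) \<le> mass"
proof (induction j rule: inc_induct)
  case base
  have "(LINT x|M. merged_sq c n x) = mass" unfolding merged_sq_def mass_def
    by (subst Bochner_Integration.integral_sum) (auto simp: merged_def intro: bddint_sq wave_bddint[OF f_wave])
  then show ?case by simp
next
  case (step j)
  have "(LINT x|M. merged_sq c j x) = (LINT x|M. pruned_sq c (Suc j) x)" using step by (intro high_estimate_pruned)
  also have "\<dots> \<le> (LINT x|M. merged_sq c (Suc j) x)" using step by (intro integral_mono integrable_pruned_sq integrable_merged_sq pruned_sq_le_merged) auto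
  finally show ?case using step by simp
qed

lemma high_estimate_mass:
  assumes "j < n" "c \<ge> 0"
  shows "(LINT x|M. (merged_sq c j x - pruned_sq c (Suc j) x)\<^sup>2) \<le> real q ^ 3 * c\<^sup>2 * mass"
proof -
  have "(LINT x|M. pruned_sq c (Suc j) x) \<le> mass"
    using integral_merged_sq_le[of j c] high_estimate_pruned(2)[OF assms] assms by simp
  then have "real q ^ 3 * c\<^sup>2 * (LINT x|M. pruned_sq c (Suc j) x) \<le> real q ^ 3 * c\<^sup>2 * mass" by (intro mult_left_mono) auto
  then show ?thesis using high_estimate_pruned(1)[OF assms] by linarith
qed

lemma sum_children_mod:
  fixes \<phi> :: "nat \<Rightarrow> 'c::comm_monoid_add"
  assumes "l \<le> j"
  shows "(\<Sum>s | s < q ^ Suc j \<and> s mod q ^ l = r. \<phi> s) = (\<Sum>t | t < q ^ j \<and> t mod q ^ l = r. \<Sum>i<q. \<phi> (t + q ^ j * i))"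
proof -
  have m: "(t + q ^ j * i) mod q ^ l = t mod q ^ l" for t i
    by (rule mod_add_power_mult[OF assms])
  have c: "(\<Sum>s | s < N \<and> s mod q ^ l = r. \<psi> s) = (\<Sum>s<N. if s mod q ^ l = r then \<psi> s else 0)" for N and \<psi> :: "nat \<Rightarrow> 'c"
    using sum.inter_filter[of "{..<N}" \<psi> "\<lambda>s. s mod q ^ l = r"] by (simp add: conj_commute)
  have "(\<Sum>s<q ^ Suc j. if s mod q ^ l = r then \<phi> s else 0) = (\<Sum>t<q ^ j. \<Sum>i<q. if t mod q ^ l = r then \<phi> (t + q ^ j * i) else 0)"
    unfolding sum_children m ..
  also have "\<dots> = (\<Sum>t<q ^ j. if t mod q ^ l = r then \<Sum>i<q. \<phi> (t + q ^ j * i) else 0)" by (rule sum.cong) auto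
  finally show ?thesis unfolding c .
qed

text \<open>
  Between two consecutive scales the sum over the arc changes by the values that clipping removes, and
  \<open>clip_error\<close> bounds these by the square function of the packets being clipped.
\<close>

lemma pruning_error:
  assumes "l \<le> k" "k \<le> n" "c > 0"
  shows "cmod ((\<Sum>t | t < q ^ n \<and> t mod q ^ l = r. f t x) - (\<Sum>t | t < q ^ k \<and> t mod q ^ l = r. pruned c k t x))
     \<le> (\<Sum>i=k..n. merged_sq c i x) / c"
  using assms(2,1)
proof (induction k rule: inc_induct)
  case base
  have "cmod (\<Sum>t | t < q ^ n \<and> t mod q ^ l = r. f t x - pruned c n t x) \<le> (\<Sum>t | t < q ^ n \<and> t mod q ^ l = r. (cmod (merged c n t x))\<^sup>2 / c)"
    by (rule order_trans[OF norm_sum sum_mono]) (use clip_error[OF assms(3)] in \<open>auto simp: pruned_eq_clip merged_def[abs_def]\<close>)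
  also have "\<dots> \<le> (\<Sum>t<q ^ n. (cmod (merged c n t x))\<^sup>2 / c)" using assms(3) by (intro sum_mono2) auto
  finally show ?case by (simp add: sum_subtractf merged_sq_def sum_divide_distrib)
next
  case (step k)
  have G: "(\<Sum>t | t < q ^ Suc k \<and> t mod q ^ l = r. pruned c (Suc k) t x) = (\<Sum>t | t < q ^ k \<and> t mod q ^ l = r. merged c k t x)"
    using step by (subst sum_children_mod) (auto simp: merged_def)
  have "cmod (\<Sum>t | t < q ^ k \<and> t mod q ^ l = r. merged c k t x - pruned c k t x) \<le> (\<Sum>t | t < q ^ k \<and> t mod q ^ l = r. (cmod (merged c k t x))\<^sup>2 / c)"
    by (rule order_trans[OF norm_sum sum_mono]) (use clip_error[OF assms(3), of "merged c k _" x] step in \<open>auto simp: pruned_eq_clip\<close>)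
  also have "\<dots> \<le> (\<Sum>t<q ^ k. (cmod (merged c k t x))\<^sup>2 / c)" using assms(3) by (intro sum_mono2) auto
  finally have 1: "cmod ((\<Sum>t | t < q ^ Suc k \<and> t mod q ^ l = r. pruned c (Suc k) t x) - (\<Sum>t | t < q ^ k \<and> t mod q ^ l = r. pruned c k t x)) \<le> merged_sq c k x / c"
    unfolding G by (simp add: sum_subtractf merged_sq_def sum_divide_distrib)
  have "{k..n} = insert k {Suc k..n}" using step by auto
  then have s: "(\<Sum>i=k..n. merged_sq c i x) / c = merged_sq c k x / c + (\<Sum>i=Suc k..n. merged_sq c i x) / c" by (simp add: add_divide_distrib)
  show ?case unfolding s using norm_triangle_mono[OF 1 step.IH] step by (simp add: norm_minus_commute)
qed

lemma prune_support:
  assumes f0: "\<And>t. t < q ^ n \<Longrightarrow> t mod q ^ m \<noteq> t0 \<Longrightarrow> f t x = 0" and "m \<le> k" "k \<le> n" "t < q ^ k" "t mod q ^ m \<noteq> t0"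
  shows "pruned c k t x = 0"
  using assms(3,2,4,5)
proof (induction k arbitrary: t rule: inc_induct)
  case base
  then show ?case using f0 by (simp add: pruned_eq_clip merged_def clip_def)
next
  case (step k)
  have "pruned c (Suc k) (t + q ^ k * i) x = 0" if "i < q" for i
  proof (rule step.IH)
    show "t + q ^ k * i < q ^ Suc k" using step that by (intro child_less)
    have "(t + q ^ k * i) mod q ^ m = t mod q ^ m"
      using step by (intro mod_add_power_mult) simp
    then show "(t + q ^ k * i) mod q ^ m \<noteq> t0" using step by simp
  qed (use step in simp)
  then have "merged c k t x = 0" using step.hyps by (simp add: merged_def)
  then show ?case using step.hyps by (simp add: pruned_eq_clip clip_def)
qed

end

section \<open>Level sets of a pair of siblings\<close>

lemma (in wave_family) pruned_norm_invariant:
  assumes "k \<le> i" "i \<le> n" "t < q ^ i" "plank q k t h1 h2"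
  shows "cmod (pruned c i t (T h1 h2 x)) = cmod (pruned c i t x)"
  using wave_norm[OF pruned_wave[OF assms(2,3)]] plank_finer[OF assms(1,4), of 0] by simp

lemma sum_sq_le_card:
  fixes e :: "nat \<Rightarrow> real"
  shows "(\<Sum>i\<in>A. e i)\<^sup>2 \<le> real (card A) * (\<Sum>i\<in>A. (e i)\<^sup>2)"
  using Cauchy_Schwarz_ineq_sum[of "\<lambda>_. 1" e A] by simp

text \<open>
  A family supported on the arc over \<open>t0\<close> modulo \<open>q^m\<close>, and two distinct children \<open>r1\<close>, \<open>r2\<close> of this arc. The
  case \<open>sup_sum = 0\<close>, in which the family vanishes, is left out because the clipping height is a multiple
  of \<open>sup_sum\<close>.
\<close>

locale sibling_family = wave_family +
  fixes m t0 r1 r2 :: nat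
  assumes m_less: "m < n" and r_mod: "r1 mod q ^ m = t0" "r2 mod q ^ m = t0"
    and r_less: "r1 < q ^ Suc m" "r2 < q ^ Suc m" and r_neq: "r1 \<noteq> r2"
    and f_support: "\<And>t x. t < q ^ n \<Longrightarrow> t mod q ^ m \<noteq> t0 \<Longrightarrow> f t x = 0"
    and sup_sum_pos: "sup_sum > 0"
begin

definition pruned_arc :: "real \<Rightarrow> nat \<Rightarrow> nat \<Rightarrow> 'a \<Rightarrow> complex" where
  "pruned_arc c k r x = (\<Sum>t | t < q ^ k \<and> t mod q ^ Suc m = r. pruned c k t x)"

text \<open>
  Going from fine to coarse scales, \<open>k\<close> is the first one at which the pruned square function exceeds twice
  its bound \<open>sup_sum\<close> at the finest scale.
\<close>

definition stop :: "real \<Rightarrow> nat \<Rightarrow> 'a \<Rightarrow> bool" where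
  "stop c k x \<longleftrightarrow> pruned_sq c k x > 2 * sup_sum \<and> (\<forall>i\<in>{k<..n}. pruned_sq c i x \<le> 2 * sup_sum)"

lemma pruned_sq_invariant:
  assumes "\<And>t. t mod q ^ m = t0 \<Longrightarrow> plank q k t h1 h2" "m \<le> k" "k \<le> i" "i \<le> n"
  shows "pruned_sq c i (T h1 h2 x) = pruned_sq c i x"
  unfolding pruned_sq_def
proof (rule sum.cong[OF refl])
  fix t assume t: "t \<in> {..<q ^ i}"
  show "(cmod (pruned c i t (T h1 h2 x)))\<^sup>2 = (cmod (pruned c i t x))\<^sup>2"
  proof (cases "t mod q ^ m = t0")
    case True then show ?thesis using pruned_norm_invariant[OF assms(3,4) _ assms(1)] t by simp
  next
    case False then show ?thesis using prune_support[OF f_support] assms t by simp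
  qed
qed

text \<open>
  The rule depends only on moduli of packets of scale at least \<open>k\<close>, and their planks contain those of
  scale \<open>k\<close>.
\<close>

lemma stop_invariant:
  assumes "\<And>t. t mod q ^ m = t0 \<Longrightarrow> plank q k t h1 h2" "m \<le> k" "k \<le> n"
  shows "stop c k (T h1 h2 x) = stop c k x"
  using pruned_sq_invariant[OF assms(1,2)] assms(3) by (auto simp: stop_def)

lemma stop_measurable: "k \<le> n \<Longrightarrow> (\<lambda>x. of_bool (stop c k x) :: real) \<in> borel_measurable M"
proof -
  assume k: "k \<le> n"
  have m: "pruned_sq c i \<in> borel_measurable M" if "i \<le> n" for i
    using integrable_pruned_sq[OF that] by (rule borel_measurable_integrable)
  have "Measurable.pred M (\<lambda>x. 2 * sup_sum < pruned_sq c k x)"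
    by (rule borel_measurable_pred_less[OF borel_measurable_const m[OF k]])
  moreover have "Measurable.pred M (\<lambda>x. \<forall>i\<in>{k<..n}. pruned_sq c i x \<le> 2 * sup_sum)"
  proof (rule pred_intros_finite(3))
    fix i assume "i \<in> {k<..n}"
    then show "Measurable.pred M (\<lambda>x. pruned_sq c i x \<le> 2 * sup_sum)"
      using borel_measurable_le[OF m[of i] borel_measurable_const] by (simp add: Measurable.pred_def)
  qed simp
  ultimately have "Measurable.pred M (stop c k)" unfolding stop_def[abs_def] by (rule pred_intros_logic(3))
  then show ?thesis by measurable
qed

lemma stop_unique: "stop c k x \<Longrightarrow> stop c k' x \<Longrightarrow> k \<le> n \<Longrightarrow> k' \<le> n \<Longrightarrow> k = k'"
  unfolding stop_def by (metis greaterThanAtMost_iff linorder_neqE_nat not_le)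

text \<open>
  Only the high-frequency differences between merged and pruned square functions can make the pruned square
  function grow from one scale to the next coarser one.
\<close>

lemma pruned_sq_telescope: "k \<le> n \<Longrightarrow> pruned_sq c k x \<le> sup_sum + (\<Sum>i=k..<n. merged_sq c i x - pruned_sq c (Suc i) x)"
proof (induction k rule: inc_induct)
  case base then show ?case using pruned_sq_le_merged[of n c x] merged_sq_top_le[of c x] by simp
next
  case (step k)
  have "{k..<n} = insert k {Suc k..<n}" using step by auto
  then show ?case using step pruned_sq_le_merged[of k c x] by simp
qed

text \<open>
  When the rule applies, the square function exceeds \<open>2 sup_sum\<close>, so at least half of it comes from the
  high-frequency differences.
\<close>

lemma stop_energy_sq:
  assumes "k \<le> n" "stop c k x"
  shows "(pruned_sq c k x)\<^sup>2 \<le> 4 * real n * (\<Sum>i<n. (merged_sq c i x - pruned_sq c (Suc i) x)\<^sup>2)"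
proof -
  let ?e = "\<lambda>i. merged_sq c i x - pruned_sq c (Suc i) x"
  have "pruned_sq c k x \<le> 2 * (\<Sum>i=k..<n. ?e i)" using pruned_sq_telescope[OF assms(1), of c x] assms(2) by (simp add: stop_def)
  then have "(pruned_sq c k x)\<^sup>2 \<le> (2 * (\<Sum>i=k..<n. ?e i))\<^sup>2" by (intro power_mono pruned_sq_nonneg)
  also have "\<dots> \<le> 4 * (real (n - k) * (\<Sum>i=k..<n. (?e i)\<^sup>2))" using sum_sq_le_card[of ?e "{k..<n}"] by (simp add: power_mult_distrib)
  also have "\<dots> \<le> 4 * (real n * (\<Sum>i<n. (?e i)\<^sup>2))" by (intro mult_mono mult_left_mono sum_mono2 sum_nonneg) auto
  finally show ?thesis by simp
qed

text \<open>
  As long as the pruned square functions are at most \<open>2 sup_sum\<close>, every one of the at most \<open>n + 1\<close> clippings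
  costs at most \<open>2 q sup_sum / c\<close>. The clipping height \<open>c\<close> is chosen to make the total \<open>\<alpha> / 2\<close>.
\<close>

lemma pruned_close:
  assumes k: "Suc m \<le> k" "k \<le> n" and g: "\<And>i. i \<in> {k<..n} \<Longrightarrow> pruned_sq c i x \<le> 2 * sup_sum"
    and \<alpha>: "\<alpha> > 0" and c: "c = 4 * real q * (real n + 1) * sup_sum / \<alpha>"
  shows "cmod (arc (Suc m) r x - pruned_arc c k r x) \<le> \<alpha> / 2"
proof -
  have c0: "c > 0" using c sup_sum_pos \<alpha> q_pos by simp
  have "merged_sq c i x \<le> 2 * real q * sup_sum" if i: "i \<in> {k..n}" for i
  proof (cases "i = n")
    case True
    have "1 * sup_sum \<le> (2 * real q) * sup_sum" using q_pos sup_sum_pos by (intro mult_right_mono) auto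
    then show ?thesis using merged_sq_top_le[of c x] True by simp
  next
    case False
    then have "merged_sq c i x \<le> real q * pruned_sq c (Suc i) x" using i by (intro merged_sq_le_pruned) auto
    also have "\<dots> \<le> real q * (2 * sup_sum)" using i False by (intro mult_left_mono g) auto
    finally show ?thesis by simp
  qed
  then have "(\<Sum>i=k..n. merged_sq c i x) \<le> (\<Sum>i=k..n. 2 * real q * sup_sum)" by (rule sum_mono)
  also have "\<dots> = real (Suc n - k) * (2 * real q * sup_sum)" by simp
  also have "\<dots> \<le> (real n + 1) * (2 * real q * sup_sum)" using sup_sum_pos by (intro mult_right_mono) auto
  finally have "(\<Sum>i=k..n. merged_sq c i x) \<le> (real n + 1) * (2 * real q * sup_sum)" .
  then have "(\<Sum>i=k..n. merged_sq c i x) / c \<le> (real n + 1) * (2 * real q * sup_sum) / c"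
    by (rule divide_right_mono) (use c0 in simp)
  also have "\<dots> = \<alpha> / 2"
  proof -
    define D where "D = real q * (real n + 1) * sup_sum"
    have "D > 0" unfolding D_def using sup_sum_pos q_pos by simp
    moreover have e: "(real n + 1) * (2 * real q * sup_sum) = 2 * D" "c = 4 * D / \<alpha>" by (simp_all add: D_def c)
    ultimately show ?thesis using \<alpha> unfolding e by simp
  qed
  finally show ?thesis using pruning_error[OF k c0, where r=r and x=x] unfolding arc_def pruned_arc_def by linarith
qed

text \<open>
  If the rule applied at no scale down to \<open>m + 1\<close>, the sibling \<open>r1\<close> would be within \<open>\<alpha> / 2\<close> of a single
  pruned packet whose square is at most \<open>2 sup_sum\<close>, which is too small when \<open>\<alpha>^2 > 8 sup_sum\<close>. It does not
  apply at the scale \<open>n\<close>, where the square function is at most \<open>sup_sum\<close>. Up to the stopping scale both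
  siblings change by at most \<open>\<alpha> / 2\<close>.
\<close>

lemma level_point:
  assumes x: "\<alpha> \<le> cmod (arc (Suc m) r1 x)" "\<alpha> \<le> cmod (arc (Suc m) r2 x)"
    and \<alpha>: "\<alpha> > 0" "\<alpha>\<^sup>2 > 8 * sup_sum" and c: "c = 4 * real q * (real n + 1) * sup_sum / \<alpha>"
  shows "\<exists>k. Suc m \<le> k \<and> k < n \<and> stop c k x \<and> \<alpha> / 2 \<le> cmod (pruned_arc c k r1 x) \<and> \<alpha> / 2 \<le> cmod (pruned_arc c k r2 x)"
proof -
  have *: "\<alpha> / 2 \<le> cmod (pruned_arc c k r x)"
    if "Suc m \<le> k" "k \<le> n" "\<And>i. i \<in> {k<..n} \<Longrightarrow> pruned_sq c i x \<le> 2 * sup_sum" "\<alpha> \<le> cmod (arc (Suc m) r x)" for k r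
    using pruned_close[OF that(1-3) \<alpha>(1) c, of r] that(4) norm_triangle_ineq2[of "arc (Suc m) r x" "pruned_arc c k r x"] by linarith
  have ex: "\<exists>k\<in>{Suc m..n}. pruned_sq c k x > 2 * sup_sum"
  proof (rule ccontr)
    assume "\<not> ?thesis"
    then have le: "pruned_sq c k x \<le> 2 * sup_sum" if "k \<in> {Suc m..n}" for k using that by force
    have "\<alpha> / 2 \<le> cmod (pruned_arc c (Suc m) r1 x)" using m_less le by (intro *[OF _ _ _ x(1)]) auto
    moreover have "{t. t < q ^ Suc m \<and> t mod q ^ Suc m = r1} = {r1}" using r_less by auto
    ultimately have "\<alpha> / 2 \<le> cmod (pruned c (Suc m) r1 x)" by (simp add: pruned_arc_def del: power_Suc)
    then have "(\<alpha> / 2)\<^sup>2 \<le> (cmod (pruned c (Suc m) r1 x))\<^sup>2" using \<alpha> by (intro power_mono) auto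
    also have "\<dots> \<le> pruned_sq c (Suc m) x" unfolding pruned_sq_def by (rule member_le_sum) (use r_less in auto)
    also have "\<dots> \<le> 2 * sup_sum" using m_less by (intro le) auto
    finally show False using \<alpha> by (simp add: power_divide)
  qed
  \<comment> \<open>The largest index is the finest scale, the first one met by the recursion.\<close>
  define k where "k = Max {k\<in>{Suc m..n}. pruned_sq c k x > 2 * sup_sum}"
  have k: "k \<in> {k\<in>{Suc m..n}. pruned_sq c k x > 2 * sup_sum}" unfolding k_def using ex by (intro Max_in) auto
  have kmax: "pruned_sq c i x \<le> 2 * sup_sum" if "i \<in> {k<..n}" for i
  proof (rule ccontr)
    assume "\<not> ?thesis"
    then have "i \<in> {k\<in>{Suc m..n}. pruned_sq c k x > 2 * sup_sum}" using that k by auto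
    then have "i \<le> k" unfolding k_def by (intro Max_ge) auto
    then show False using that by simp
  qed
  have "k \<noteq> n" using k pruned_sq_le_merged[of n c x] merged_sq_top_le[of c x] sup_sum_pos by auto
  then show ?thesis using k kmax *[of k r1] *[of k r2] x by (intro exI[of _ k]) (auto simp: stop_def)
qed

text \<open>
  On the level set the product of the pruned siblings at the stopping scale is at least \<open>(\<alpha> / 2)^2\<close>. Its
  square has, over the set where the rule stops at \<open>k\<close>, the same integral as a product of two pruned square
  functions, by \<open>bilinear_identity\<close>. These are controlled by the high-frequency differences, whose norms
  \<open>high_estimate\<close> bounds by a multiple of \<open>c^2 mass\<close>. As \<open>c\<close> is a multiple of \<open>sup_sum / \<alpha>\<close>, two more
  factors \<open>\<alpha>\<close> appear on the left.
\<close>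

theorem level_set:
  assumes \<alpha>: "\<alpha> > 0" "\<alpha>\<^sup>2 > 8 * sup_sum"
  shows "\<alpha> ^ 6 * (LINT x|M. of_bool (\<alpha> \<le> cmod (arc (Suc m) r1 x) \<and> \<alpha> \<le> cmod (arc (Suc m) r2 x)))
     \<le> 1024 * real q ^ 5 * (real n)\<^sup>2 * (real n + 1)\<^sup>2 * sup_sum\<^sup>2 * mass"
proof -
  define c where "c = 4 * real q * (real n + 1) * sup_sum / \<alpha>"
  have c0: "c \<ge> 0" using c_def sup_sum_pos \<alpha> q_pos by simp
  let ?U = "\<lambda>x. of_bool (\<alpha> \<le> cmod (arc (Suc m) r1 x) \<and> \<alpha> \<le> cmod (arc (Suc m) r2 x)) :: real"
  let ?V = "\<lambda>k x. of_bool (stop c k x) :: real"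
  let ?I = "\<lambda>k r. {t. t < q ^ k \<and> t mod q ^ Suc m = r}"
  let ?e = "\<lambda>i x. merged_sq c i x - pruned_sq c (Suc i) x"
  let ?K = "{Suc m..<n}"
  define W where "W k x = ?V k x * ((cmod (pruned_arc c k r1 x))\<^sup>2 * (cmod (pruned_arc c k r2 x))\<^sup>2)" for k x
  define Z where "Z k x = ?V k x * ((\<Sum>t\<in>?I k r1. (cmod (pruned c k t x))\<^sup>2) * (\<Sum>t\<in>?I k r2. (cmod (pruned c k t x))\<^sup>2))" for k x
  define E where "E x = 4 * real n * (\<Sum>i<n. (?e i x)\<^sup>2)" for x
  have bF: "bddint M (pruned c k t)" if "k \<in> ?K" "t \<in> ?I k r" for k t r
    using that by (intro wave_bddint[OF pruned_wave]) auto
  have bP: "bddint M (pruned_arc c k r)" if "k \<in> ?K" for k r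
    unfolding pruned_arc_def[abs_def] using that by (intro bddint_sum bF) auto
  have iW: "integrable M (W k)" if k: "k \<in> ?K" for k
  proof -
    have "bddint M (\<lambda>x. of_real (?V k x) * (pruned_arc c k r1 x * pruned_arc c k r2 x))"
      using stop_measurable[of k c] k by (intro bddint_bdd_mult[where C=1] bddint_mult bP) auto
    from bddint_sq[OF this] show ?thesis
      unfolding W_def[abs_def] by (rule Bochner_Integration.integrable_cong[THEN iffD1, OF refl, rotated])
        (auto simp: norm_mult power_mult_distrib)
  qed
  have iE: "integrable M E" unfolding E_def[abs_def] using c0
    by (intro integrable_mult_right Bochner_Integration.integrable_sum high_estimate_pruned(3)) auto
  have sub: "(\<Sum>t\<in>?I k r. (cmod (pruned c k t x))\<^sup>2) \<le> pruned_sq c k x" for k r x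
    unfolding pruned_sq_def by (intro sum_mono2) auto
  have Z_le: "Z k x \<le> ?V k x * E x" if "k \<in> ?K" for k x
  proof (cases "stop c k x")
    case True
    have "Z k x \<le> pruned_sq c k x * pruned_sq c k x" unfolding Z_def using True sub pruned_sq_nonneg[of c k x]
      by (auto intro!: mult_mono sum_nonneg)
    also have "\<dots> \<le> E x" using stop_energy_sq[OF _ True] that by (simp add: power2_eq_square E_def)
    finally show ?thesis using True by simp
  qed (simp add: Z_def)
  have Z_nonneg: "Z k x \<ge> 0" for k x unfolding Z_def by (intro mult_nonneg_nonneg sum_nonneg) auto
  have E_nonneg: "E x \<ge> 0" for x unfolding E_def by (intro mult_nonneg_nonneg sum_nonneg) auto
  have Zs_le: "(\<Sum>k\<in>?K. Z k x) \<le> E x" for x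
  proof -
    \<comment> \<open>At most one scale is the stopping scale of a point, so that the sum over scales costs nothing here.\<close>
    have "(\<Sum>k\<in>?K. ?V k x) \<le> 1"
    proof (cases "\<exists>k\<in>?K. stop c k x")
      case True
      then obtain k where k: "k \<in> ?K" "stop c k x" by blast
      have "?V i x \<le> (if i = k then 1 else 0)" if "i \<in> ?K" for i
      proof (cases "stop c i x")
        case True
        have "i = k" by (rule stop_unique[OF True k(2)]) (use that k(1) in simp_all)
        then show ?thesis by simp
      qed simp
      then have "(\<Sum>i\<in>?K. ?V i x) \<le> (\<Sum>i\<in>?K. if i = k then 1 else 0)" by (rule sum_mono)
      then show ?thesis using k(1) by simp
    qed simp
    then have "(\<Sum>k\<in>?K. ?V k x) * E x \<le> E x" using E_nonneg[of x] by (simp add: mult_left_le_one_le)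
    moreover have "(\<Sum>k\<in>?K. Z k x) \<le> (\<Sum>k\<in>?K. ?V k x * E x)" by (intro sum_mono Z_le)
    ultimately show ?thesis by (simp add: sum_distrib_right)
  qed
  have mF: "(\<lambda>x. cmod (pruned c k t x)) \<in> borel_measurable M" if "k \<in> ?K" "t \<in> ?I k r" for k t r
    by (rule measurable_compose[OF bddint_meas[OF bF[OF that]] borel_measurable_norm])
  have iZ: "integrable M (Z k)" if k: "k \<in> ?K" for k
  proof (rule Bochner_Integration.integrable_bound[OF iE])
    show "Z k \<in> borel_measurable M" unfolding Z_def[abs_def] using stop_measurable[of k c] k
      by (intro borel_measurable_times borel_measurable_sum borel_measurable_power mF[OF k]) auto
    have "Z k x \<le> E x" for x using Z_le[OF k, of x] E_nonneg[of x] by (cases "stop c k x") auto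
    then show "AE x in M. norm (Z k x) \<le> norm (E x)" using Z_nonneg E_nonneg by simp
  qed
  have U_le: "(\<alpha> / 2) ^ 4 * ?U x \<le> (\<Sum>k\<in>?K. W k x)" for x
  proof (cases "\<alpha> \<le> cmod (arc (Suc m) r1 x) \<and> \<alpha> \<le> cmod (arc (Suc m) r2 x)")
    case True
    then obtain k where k: "Suc m \<le> k" "k < n" "stop c k x" "\<alpha> / 2 \<le> cmod (pruned_arc c k r1 x)" "\<alpha> / 2 \<le> cmod (pruned_arc c k r2 x)"
      using level_point[OF _ _ \<alpha> c_def] by blast
    have "(\<alpha> / 2) ^ 4 = (\<alpha> / 2)\<^sup>2 * (\<alpha> / 2)\<^sup>2" by (simp flip: power_add)
    also have "\<dots> \<le> (cmod (pruned_arc c k r1 x))\<^sup>2 * (cmod (pruned_arc c k r2 x))\<^sup>2"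
      by (intro mult_mono power_mono k) (use \<alpha> in auto)
    also have "\<dots> = W k x" unfolding W_def using k by simp
    also have "\<dots> \<le> (\<Sum>k\<in>?K. W k x)" by (rule member_le_sum) (use k in \<open>auto simp: W_def\<close>)
    finally show ?thesis using True by simp
  next
    case False then show ?thesis by (auto intro!: sum_nonneg simp: W_def)
  qed
  have barc: "bddint M (arc (Suc m) r)" for r
    unfolding arc_def[abs_def] by (intro bddint_sum wave_bddint[OF f_wave]) auto
  have [measurable]: "arc (Suc m) r \<in> borel_measurable M" for r by (rule bddint_meas[OF barc])
  have iU: "integrable M (\<lambda>x. (\<alpha> / 2) ^ 4 * ?U x)"
  proof (rule Bochner_Integration.integrable_bound[of M "\<lambda>x. \<Sum>k\<in>?K. W k x"])
    show "AE x in M. norm ((\<alpha> / 2) ^ 4 * ?U x) \<le> norm (\<Sum>k\<in>?K. W k x)"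
    proof (rule AE_I2)
      fix x
      have "0 \<le> (\<alpha> / 2) ^ 4 * ?U x" using \<alpha> by (intro mult_nonneg_nonneg zero_le_power) auto
      then show "norm ((\<alpha> / 2) ^ 4 * ?U x) \<le> norm (\<Sum>k\<in>?K. W k x)"
        using U_le[of x] unfolding real_norm_def by linarith
    qed
  qed (use iW in \<open>auto intro!: Bochner_Integration.integrable_sum\<close>)
  have "(\<alpha> / 2) ^ 4 * (LINT x|M. ?U x) = (LINT x|M. (\<alpha> / 2) ^ 4 * ?U x)" by simp
  also have "\<dots> \<le> (LINT x|M. (\<Sum>k\<in>?K. W k x))"
    by (rule integral_mono[OF iU _ U_le]) (intro Bochner_Integration.integrable_sum iW)
  also have "\<dots> = (\<Sum>k\<in>?K. LINT x|M. W k x)" by (rule Bochner_Integration.integral_sum[OF iW])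
  also have "\<dots> = (\<Sum>k\<in>?K. LINT x|M. Z k x)"
  proof (rule sum.cong[OF refl])
    fix k assume k: "k \<in> ?K"
    show "(LINT x|M. W k x) = (LINT x|M. Z k x)"
      unfolding W_def Z_def pruned_arc_def
    proof (rule bilinear_identity[OF _ r_mod r_neq])
      show "?V k (T h1 h2 x) = ?V k x" if "\<And>t. t mod q ^ m = t0 \<Longrightarrow> plank q k t h1 h2" for h1 h2 x
        using stop_invariant[OF that] k by simp
    qed (use k stop_measurable[of k c] pruned_wave in auto)
  qed
  also have "\<dots> = (LINT x|M. (\<Sum>k\<in>?K. Z k x))" by (rule Bochner_Integration.integral_sum[OF iZ, symmetric])
  also have "\<dots> \<le> (LINT x|M. E x)"
    by (rule integral_mono[OF _ iE Zs_le]) (intro Bochner_Integration.integrable_sum iZ)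
  also have "\<dots> = 4 * real n * (\<Sum>i<n. LINT x|M. (?e i x)\<^sup>2)"
    unfolding E_def using c0 high_estimate_pruned(3) by (simp add: Bochner_Integration.integral_sum)
  also have "\<dots> \<le> 4 * real n * (\<Sum>i<n. real q ^ 3 * c\<^sup>2 * mass)"
    by (intro mult_left_mono sum_mono high_estimate_mass) (use c0 in auto)
  finally have "(\<alpha> / 2) ^ 4 * (LINT x|M. ?U x) \<le> 4 * real n * (real n * (real q ^ 3 * c\<^sup>2 * mass))" by simp
  then have f1: "16 * \<alpha>\<^sup>2 * ((\<alpha> / 2) ^ 4 * (LINT x|M. ?U x)) \<le> 16 * \<alpha>\<^sup>2 * (4 * real n * (real n * (real q ^ 3 * c\<^sup>2 * mass)))"
    by (intro mult_left_mono) auto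
  have f2: "16 * \<alpha>\<^sup>2 * ((\<alpha> / 2) ^ 4 * (LINT x|M. ?U x)) = \<alpha> ^ 6 * (LINT x|M. ?U x)"
    by (simp add: power_divide flip: power_add)
  have f3: "16 * \<alpha>\<^sup>2 * (4 * real n * (real n * (real q ^ 3 * c\<^sup>2 * mass)))
      = 1024 * real q ^ 5 * (real n)\<^sup>2 * (real n + 1)\<^sup>2 * sup_sum\<^sup>2 * mass"
  proof -
    have e1: "\<alpha>\<^sup>2 * c\<^sup>2 = 16 * (real q)\<^sup>2 * (real n + 1)\<^sup>2 * sup_sum\<^sup>2"
      unfolding c_def using \<alpha> by (simp add: power_divide power_mult_distrib)
    have e2: "16 * \<alpha>\<^sup>2 * (4 * real n * (real n * (real q ^ 3 * c\<^sup>2 * mass))) = 64 * (real n)\<^sup>2 * real q ^ 3 * mass * (\<alpha>\<^sup>2 * c\<^sup>2)"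
      unfolding power2_eq_square by simp
    have e3: "real q ^ 5 = real q ^ 3 * (real q)\<^sup>2" unfolding power_add[symmetric] by simp
    show ?thesis unfolding e2 e1 e3 by simp
  qed
  show ?thesis using f1 unfolding f2 f3 .
qed

end

section \<open>Summing over levels and scales\<close>

lemma geometric_level:
  fixes y A :: real
  assumes "A < y" "y \<le> A * real q ^ n"
  shows "\<exists>i<n. A * real q ^ i \<le> y \<and> y \<le> A * real q ^ Suc i"
  using assms(2)
proof (induction n)
  case 0 then show ?case using assms(1) by simp
next
  case (Suc n)
  show ?case
  proof (cases "y \<le> A * real q ^ n")
    case True
    then obtain i where "i < n" "A * real q ^ i \<le> y \<and> y \<le> A * real q ^ Suc i" using Suc.IH by blast
    then show ?thesis by (intro exI[of _ i]) simp
  next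
    case False
    then show ?thesis using Suc.prems by (intro exI[of _ n]) simp
  qed
qed

context wave_family begin

lemma f_bddint: "t < q ^ n \<Longrightarrow> bddint M (f t)" by (rule wave_bddint[OF f_wave])

lemma sup_sum_nonneg: "0 \<le> sup_sum" unfolding sup_sum_def by (intro sum_nonneg) auto
lemma mass_nonneg: "0 \<le> mass" unfolding mass_def by (intro sum_nonneg) auto

lemma arc_bddint: "bddint M (arc k t)"
  unfolding arc_def[abs_def] by (intro bddint_sum f_bddint) auto

lemma integral_arc_sq: "(LINT x|M. (cmod (arc k t x))\<^sup>2) = (\<Sum>s | s < q ^ n \<and> s mod q ^ k = t. LINT x|M. (cmod (f s x))\<^sup>2)"
  unfolding arc_def by (rule integral_norm_sum_sq) (auto intro: f_bddint pair_zero f_wave)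

lemma arc_sq_le: "(cmod (arc k t x))\<^sup>2 \<le> real q ^ n * sup_sum"
proof -
  let ?S = "{s. s < q ^ n \<and> s mod q ^ k = t}"
  have "(cmod (arc k t x))\<^sup>2 \<le> real (card ?S) * (\<Sum>s\<in>?S. (cmod (f s x))\<^sup>2)" unfolding arc_def by (rule norm_sum_sq_le)
  also have "\<dots> \<le> real q ^ n * sup_sum"
  proof (rule mult_mono)
    have "card ?S \<le> card {..<q ^ n}" by (intro card_mono) auto
    then show "real (card ?S) \<le> real q ^ n" by (simp flip: of_nat_power)
    have "(\<Sum>s\<in>?S. (cmod (f s x))\<^sup>2) \<le> (\<Sum>s<q ^ n. (cmod (f s x))\<^sup>2)" by (intro sum_mono2) auto
    also have "\<dots> \<le> sup_sum" unfolding sup_sum_def by (intro sum_mono power_mono) (auto simp: f_le)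
    finally show "(\<Sum>s\<in>?S. (cmod (f s x))\<^sup>2) \<le> sup_sum" .
  qed (auto intro: sum_nonneg)
  finally show ?thesis .
qed

end

text \<open>
  Cauchy-Schwarz bounds the square of a sibling by \<open>q^n sup_sum\<close>, so \<open>n\<close> levels in geometric progression
  cover all squares above \<open>9 sup_sum\<close>. Below that, four of the six powers are bounded pointwise.
\<close>

lemma (in sibling_family) bilinear_sixth:
  "(LINT x|M. (min (cmod (arc (Suc m) r1 x)) (cmod (arc (Suc m) r2 x))) ^ 6)
    \<le> (81 + real n * (real q ^ 3 * (1024 * real q ^ 5 * (real n)\<^sup>2 * (real n + 1)\<^sup>2))) * sup_sum\<^sup>2 * mass"
proof -
  \<comment> \<open>The factor \<open>9\<close> instead of \<open>8\<close> provides the strict inequality in \<open>level_set\<close> for \<open>i = 0\<close>.\<close>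
  define al where "al i = sqrt (9 * sup_sum * real q ^ i)" for i
  have al_sq: "(al i)\<^sup>2 = 9 * sup_sum * real q ^ i" for i using sup_sum_pos by (simp add: al_def)
  have al_pos: "al i > 0" for i using sup_sum_pos q_pos by (simp add: al_def)
  have al_big: "(al i)\<^sup>2 > 8 * sup_sum" for i
  proof -
    have "8 * sup_sum < 9 * sup_sum * 1" using sup_sum_pos by simp
    also have "\<dots> \<le> 9 * sup_sum * real q ^ i" using sup_sum_pos q_gt_1 by (intro mult_left_mono one_le_power) auto
    finally show ?thesis by (simp only: al_sq)
  qed
  let ?mn = "\<lambda>x. min (cmod (arc (Suc m) r1 x)) (cmod (arc (Suc m) r2 x))"
  let ?U = "\<lambda>i x. of_bool (al i \<le> cmod (arc (Suc m) r1 x) \<and> al i \<le> cmod (arc (Suc m) r2 x)) :: real"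
  let ?R = "\<lambda>x. 81 * sup_sum\<^sup>2 * (cmod (arc (Suc m) r1 x))\<^sup>2 + (\<Sum>i<n. real q ^ 3 * (al i ^ 6 * ?U i x))"
  note bp = arc_bddint[of "Suc m"]
  have [measurable]: "arc (Suc m) r \<in> borel_measurable M" for r by (rule bddint_meas[OF bp])
  have le: "?mn x ^ 6 \<le> ?R x" for x
  proof -
    define y where "y = (?mn x)\<^sup>2"
    have y0: "y \<ge> 0" by (simp add: y_def)
    have y6: "?mn x ^ 6 = y ^ 3" by (simp add: y_def flip: power_mult)
    have y1: "y \<le> (cmod (arc (Suc m) r1 x))\<^sup>2" unfolding y_def by (intro power_mono) auto
    show ?thesis
    proof (cases "y \<le> 9 * sup_sum")
      case True
      have "y ^ 3 = y\<^sup>2 * y" by (simp add: power3_eq_cube power2_eq_square)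
      also have "\<dots> \<le> (9 * sup_sum)\<^sup>2 * (cmod (arc (Suc m) r1 x))\<^sup>2" using True y0 y1 by (intro mult_mono power_mono) auto
      also have "\<dots> \<le> ?R x" by (simp add: power_mult_distrib) (intro sum_nonneg mult_nonneg_nonneg zero_le_power; use al_pos in \<open>simp add: less_imp_le\<close>)
      finally show ?thesis by (simp only: y6)
    next
      case False
      have "y \<le> real q ^ n * sup_sum" using y1 arc_sq_le[of "Suc m" r1 x] by simp
      also have "\<dots> \<le> 9 * sup_sum * real q ^ n" using sup_sum_pos by simp
      finally obtain i where i: "i < n" "9 * sup_sum * real q ^ i \<le> y" "y \<le> 9 * sup_sum * real q ^ Suc i"
        using geometric_level[of "9 * sup_sum" y q n] False by auto
      have "al i \<le> ?mn x" unfolding al_def using i(2) by (intro real_le_lsqrt) (auto simp: y_def)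
      then have U: "?U i x = 1" by simp
      have "y ^ 3 \<le> (real q * (al i)\<^sup>2) ^ 3" using i(3) y0 unfolding al_sq by (intro power_mono) (auto simp: mult_ac)
      also have "\<dots> = real q ^ 3 * (al i ^ 6 * ?U i x)" unfolding U by (simp add: power_mult_distrib flip: power_mult)
      also have "\<dots> \<le> (\<Sum>i<n. real q ^ 3 * (al i ^ 6 * ?U i x))"
        by (rule member_le_sum) (use i al_pos in \<open>auto intro!: mult_nonneg_nonneg zero_le_power less_imp_le\<close>)
      also have "\<dots> \<le> ?R x" by simp
      finally show ?thesis by (simp only: y6)
    qed
  qed
  have i1: "integrable M (\<lambda>x. (cmod (arc (Suc m) r1 x))\<^sup>2)" by (rule bddint_sq[OF bp])
  have iU: "integrable M (?U i)" for i
  proof (rule Bochner_Integration.integrable_bound[of M "\<lambda>x. (1 / (al i)\<^sup>2) * (cmod (arc (Suc m) r1 x))\<^sup>2"])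
    show "integrable M (\<lambda>x. (1 / (al i)\<^sup>2) * (cmod (arc (Suc m) r1 x))\<^sup>2)" by (intro integrable_mult_right i1)
    show "?U i \<in> borel_measurable M" by measurable
    show "AE x in M. norm (?U i x) \<le> norm ((1 / (al i)\<^sup>2) * (cmod (arc (Suc m) r1 x))\<^sup>2)"
    proof (rule AE_I2)
      fix x
      show "norm (?U i x) \<le> norm ((1 / (al i)\<^sup>2) * (cmod (arc (Suc m) r1 x))\<^sup>2)"
      proof (cases "al i \<le> cmod (arc (Suc m) r1 x)")
        case True
        then have "(al i)\<^sup>2 \<le> (cmod (arc (Suc m) r1 x))\<^sup>2" using al_pos[of i] by (intro power_mono) auto
        then show ?thesis using al_pos[of i] by simp
      qed simp
    qed
  qed
  have iR: "integrable M ?R"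
    by (intro Bochner_Integration.integrable_add integrable_mult_right i1 Bochner_Integration.integrable_sum iU)
  have "(LINT x|M. ?mn x ^ 6) \<le> (LINT x|M. ?R x)"
  proof (rule integral_mono[OF _ iR le])
    show "integrable M (\<lambda>x. ?mn x ^ 6)"
    proof (rule Bochner_Integration.integrable_bound[OF iR])
      show "AE x in M. norm (?mn x ^ 6) \<le> norm (?R x)"
      proof (rule AE_I2)
        fix x
        have "0 \<le> ?mn x ^ 6" by (intro zero_le_power) simp
        then have "norm (?mn x ^ 6) = ?mn x ^ 6" by (rule real_norm_def[THEN trans, OF abs_of_nonneg])
        then show "norm (?mn x ^ 6) \<le> norm (?R x)"
          using order_trans[OF le[of x] abs_ge_self] unfolding real_norm_def by presburger
      qed
    qed measurable
  qed
  also have "\<dots> = 81 * sup_sum\<^sup>2 * (LINT x|M. (cmod (arc (Suc m) r1 x))\<^sup>2) + (\<Sum>i<n. real q ^ 3 * (al i ^ 6 * (LINT x|M. ?U i x)))"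
    by (subst Bochner_Integration.integral_add)
      (auto intro!: integrable_mult_right i1 Bochner_Integration.integrable_sum iU simp: Bochner_Integration.integral_sum iU simp del: of_bool_conj)
  also have "\<dots> \<le> 81 * sup_sum\<^sup>2 * mass + (\<Sum>i<n. real q ^ 3 * (1024 * real q ^ 5 * (real n)\<^sup>2 * (real n + 1)\<^sup>2 * sup_sum\<^sup>2 * mass))"
  proof (intro add_mono mult_left_mono sum_mono level_set al_pos al_big)
    show "(LINT x|M. (cmod (arc (Suc m) r1 x))\<^sup>2) \<le> mass"
      unfolding integral_arc_sq mass_def by (intro sum_mono2) auto
  qed auto
  finally show ?thesis by (simp add: algebra_simps)
qed

context wave_family begin

lemma mod_power_Suc: "s mod q ^ Suc k = s mod q ^ k + q ^ k * (s div q ^ k mod q)"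
  using mod_mult2_eq[of s "q ^ k" q] by (simp add: mult.commute)

lemma arc_children:
  assumes "t < q ^ k" shows "arc k t x = (\<Sum>i<q. arc (Suc k) (t + q ^ k * i) x)"
proof -
  have "arc k t x = (\<Sum>i<q. \<Sum>s | s \<in> {s. s < q ^ n \<and> s mod q ^ k = t} \<and> s div q ^ k mod q = i. f s x)"
    unfolding arc_def by (rule sum.group[symmetric]) (use q_pos in auto)
  also have "\<dots> = (\<Sum>i<q. arc (Suc k) (t + q ^ k * i) x)"
  proof (intro sum.cong refl)
    fix i assume i: "i \<in> {..<q}"
    have "{s. s \<in> {s. s < q ^ n \<and> s mod q ^ k = t} \<and> s div q ^ k mod q = i} = {s. s < q ^ n \<and> s mod q ^ Suc k = t + q ^ k * i}"
    proof (intro Collect_cong iffI)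
      fix s assume "s \<in> {s. s < q ^ n \<and> s mod q ^ k = t} \<and> s div q ^ k mod q = i"
      then show "s < q ^ n \<and> s mod q ^ Suc k = t + q ^ k * i" unfolding mod_power_Suc by auto
    next
      fix s assume s: "s < q ^ n \<and> s mod q ^ Suc k = t + q ^ k * i"
      then have "t + q ^ k * i = s mod q ^ k + q ^ k * (s div q ^ k mod q)" unfolding mod_power_Suc by simp
      then have "(t + q ^ k * i) mod q ^ k = (s mod q ^ k + q ^ k * (s div q ^ k mod q)) mod q ^ k"
        "(t + q ^ k * i) div q ^ k = (s mod q ^ k + q ^ k * (s div q ^ k mod q)) div q ^ k" by simp_all
      then show "s \<in> {s. s < q ^ n \<and> s mod q ^ k = t} \<and> s div q ^ k mod q = i" using s assms q_pos by simp
    qed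
    then show "(\<Sum>s | s \<in> {s. s < q ^ n \<and> s mod q ^ k = t} \<and> s div q ^ k mod q = i. f s x) = arc (Suc k) (t + q ^ k * i) x"
      unfolding arc_def by simp
  qed
  finally show ?thesis .
qed

text \<open>
  At a point, follow the largest child at every scale. The other children are dominated by it, so each is the
  minimum of a pair of siblings and thus at most \<open>X\<close>.
\<close>

lemma broad_narrow:
  assumes X: "X \<ge> 0" and sib: "\<And>k t i i'. k < n \<Longrightarrow> t < q ^ k \<Longrightarrow> i < q \<Longrightarrow> i' < q \<Longrightarrow> i \<noteq> i' \<Longrightarrow>
      min (cmod (arc (Suc k) (t + q ^ k * i) x)) (cmod (arc (Suc k) (t + q ^ k * i') x)) \<le> X"
    and "k \<le> n"
  shows "\<exists>t<q ^ k. cmod (arc 0 0 x) \<le> cmod (arc k t x) + real k * (real q * X)"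
  using assms(3)
proof (induction k)
  case 0 then show ?case by simp
next
  case (Suc k)
  then obtain t where t: "t < q ^ k" "cmod (arc 0 0 x) \<le> cmod (arc k t x) + real k * (real q * X)" by auto
  define \<phi> where "\<phi> i = cmod (arc (Suc k) (t + q ^ k * i) x)" for i
  obtain i where i: "i < q" "\<And>i'. i' < q \<Longrightarrow> \<phi> i' \<le> \<phi> i"
  proof -
    have "finite (\<phi> ` {..<q})" "\<phi> ` {..<q} \<noteq> {}" using q_pos by auto
    from Max_in[OF this] obtain i where "i < q" "\<phi> i = Max (\<phi> ` {..<q})" by auto
    then show ?thesis using that[of i] by simp
  qed
  have "cmod (arc k t x) \<le> (\<Sum>i'<q. \<phi> i')" unfolding arc_children[OF t(1)] \<phi>_def by (rule norm_sum)
  also have "\<dots> = \<phi> i + (\<Sum>i'\<in>{..<q} - {i}. \<phi> i')" using i by (intro sum.remove) auto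
  also have "(\<Sum>i'\<in>{..<q} - {i}. \<phi> i') \<le> (\<Sum>i'\<in>{..<q} - {i}. X)"
  proof (rule sum_mono)
    fix i' assume i': "i' \<in> {..<q} - {i}"
    then have "min (\<phi> i) (\<phi> i') \<le> X" unfolding \<phi>_def using Suc.prems t i by (intro sib) auto
    then show "\<phi> i' \<le> X" using i(2)[of i'] i' by auto
  qed
  also have "\<dots> = real (q - 1) * X" using i(1) by simp
  also have "\<dots> \<le> real q * X" using X by (intro mult_right_mono) auto
  finally have "cmod (arc k t x) \<le> \<phi> i + real q * X" by simp
  then have "cmod (arc 0 0 x) \<le> cmod (arc (Suc k) (t + q ^ k * i) x) + real (Suc k) * (real q * X)"
    using t(2) by (simp add: \<phi>_def algebra_simps)
  then show ?case using child_less[OF t(1) i(1)] by blast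
qed

text \<open>
  The family restricted to the arc over \<open>t\<close> modulo \<open>q^k\<close> is a family to which \<open>bilinear_sixth\<close>
  applies, with smaller sums. If its suprema all vanish, then so does the arc.
\<close>

lemma sibling_sixth:
  assumes k: "k < n" "t < q ^ k" and i: "i < q" "i' < q" "i \<noteq> i'"
  shows "(LINT x|M. (min (cmod (arc (Suc k) (t + q ^ k * i) x)) (cmod (arc (Suc k) (t + q ^ k * i') x))) ^ 6)
    \<le> (81 + real n * (real q ^ 3 * (1024 * real q ^ 5 * (real n)\<^sup>2 * (real n + 1)\<^sup>2))) * sup_sum\<^sup>2 *
      (\<Sum>s | s < q ^ n \<and> s mod q ^ k = t. LINT x|M. (cmod (f s x))\<^sup>2)" (is "_ \<le> ?C * _ * ?m")
proof -
  define f' where "f' s x = (if s mod q ^ k = t then f s x else 0)" for s x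
  define b' where "b' s = (if s mod q ^ k = t then b s else 0)" for s
  have S: "(\<Sum>s<N. if s mod q ^ l = r then \<psi> s else (0::real)) = (\<Sum>s | s < N \<and> s mod q ^ l = r. \<psi> s)" for N l r and \<psi> :: "nat \<Rightarrow> real"
    using sum.inter_filter[of "{..<N}" \<psi> "\<lambda>s. s mod q ^ l = r"] by (simp add: conj_commute)
  interpret W: wave_family M q T n f' b'
  proof
    fix s x assume s: "s < q ^ n"
    show "wave n s (f' s)" using f_wave[OF s] by (cases "s mod q ^ k = t") (simp_all add: f'_def[abs_def] wave_def)
    show "cmod (f' s x) \<le> b' s" using f_le[OF s] by (simp add: f'_def b'_def)
  qed
  have sup_sum': "W.sup_sum = (\<Sum>s | s < q ^ n \<and> s mod q ^ k = t. (b s)\<^sup>2)"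
    unfolding W.sup_sum_def b'_def S[symmetric] by (rule sum.cong) auto
  have mass': "W.mass = ?m"
    unfolding W.mass_def f'_def S[symmetric] by (rule sum.cong) auto
  have le: "W.sup_sum \<le> sup_sum" unfolding sup_sum' sup_sum_def by (intro sum_mono2) auto
  have m0: "?m \<ge> 0" by (intro sum_nonneg) auto
  have C0: "?C \<ge> 0" by (intro add_nonneg_nonneg mult_nonneg_nonneg) auto
  have arc': "arc (Suc k) (t + q ^ k * j) x = W.arc (Suc k) (t + q ^ k * j) x" for j x
  proof -
    have "s mod q ^ k = t" if "s mod q ^ Suc k = t + q ^ k * j" for s
    proof -
      have "s mod q ^ k = s mod q ^ Suc k mod q ^ k" by (simp add: mod_mod_cancel)
      then show ?thesis using that k(2) by simp
    qed
    then show ?thesis unfolding arc_def W.arc_def f'_def by (intro sum.cong) auto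
  qed
  show ?thesis
  proof (cases "W.sup_sum > 0")
    case True
    interpret S: sibling_family M q T n f' b' k t "t + q ^ k * i" "t + q ^ k * i'"
      by unfold_locales (use k i q_pos True in \<open>simp_all add: child_less f'_def del: power_Suc\<close>)
    have "(LINT x|M. (min (cmod (arc (Suc k) (t + q ^ k * i) x)) (cmod (arc (Suc k) (t + q ^ k * i') x))) ^ 6) \<le> ?C * W.sup_sum\<^sup>2 * W.mass"
      using S.bilinear_sixth unfolding arc' .
    also have "\<dots> \<le> ?C * sup_sum\<^sup>2 * ?m" unfolding mass'
      by (intro mult_right_mono mult_left_mono power_mono le C0 m0 W.sup_sum_nonneg)
    finally show ?thesis .
  next
    case False
    then have "W.sup_sum = 0" using W.sup_sum_nonneg by simp
    then have "(\<Sum>s<q ^ n. (b' s)\<^sup>2) = 0" unfolding W.sup_sum_def .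
    then have "b' s = 0" if "s < q ^ n" for s using that by (subst (asm) sum_nonneg_eq_0_iff) auto
    then have "f' s x = 0" if "s < q ^ n" for s x using W.f_le[OF that] that by (metis norm_le_zero_iff)
    then have "arc (Suc k) (t + q ^ k * j) x = 0" for j x unfolding arc' W.arc_def by (intro sum.neutral) auto
    then show ?thesis using C0 m0 by simp
  qed
qed

lemma integrable_min_arc: "integrable M (\<lambda>x. (min (cmod (arc k t x)) (cmod (arc k' t' x))) ^ 6)"
proof -
  obtain B where B: "\<And>x. cmod (arc k t x) \<le> B" using arc_bddint[of k t] by (auto simp: bddint_def)
  have B0: "B \<ge> 0" using B order_trans norm_ge_zero by blast
  note [measurable] = bddint_meas[OF arc_bddint]
  show ?thesis
  proof (rule Bochner_Integration.integrable_bound[of M "\<lambda>x. B ^ 4 * (cmod (arc k t x))\<^sup>2"])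
    show "integrable M (\<lambda>x. B ^ 4 * (cmod (arc k t x))\<^sup>2)" by (intro integrable_mult_right bddint_sq arc_bddint)
    show "AE x in M. norm ((min (cmod (arc k t x)) (cmod (arc k' t' x))) ^ 6) \<le> norm (B ^ 4 * (cmod (arc k t x))\<^sup>2)"
    proof (rule AE_I2)
      fix x
      have "(min (cmod (arc k t x)) (cmod (arc k' t' x))) ^ 6 \<le> cmod (arc k t x) ^ 6" by (intro power_mono) auto
      also have "\<dots> = cmod (arc k t x) ^ 4 * (cmod (arc k t x))\<^sup>2" by (simp flip: power_add)
      also have "\<dots> \<le> B ^ 4 * (cmod (arc k t x))\<^sup>2" by (intro mult_right_mono power_mono B) auto
      finally show "norm ((min (cmod (arc k t x)) (cmod (arc k' t' x))) ^ 6) \<le> norm (B ^ 4 * (cmod (arc k t x))\<^sup>2)"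
        using B0 by simp
    qed
  qed measurable
qed

text \<open>
  The exponent \<open>12\<close> is made up of \<open>6\<close> from the factor \<open>n\<close> in front of \<open>X\<close> in \<open>broad_narrow\<close>, \<open>1\<close> from the sum
  over the scale of the siblings, \<open>1\<close> from the number of levels and \<open>4\<close> from \<open>level_set\<close>. There, \<open>2\<close> come from
  the clipping height, \<open>1\<close> from Cauchy-Schwarz over the scales of the high-frequency differences and \<open>1\<close> from
  the number of these differences. The sum over the arcs of one scale costs nothing, because \<open>mass\<close>
  is additive over them.
\<close>

theorem sixth_moment:
  assumes n: "n \<ge> 1"
  shows "(LINT x|M. cmod (\<Sum>t<q ^ n. f t x) ^ 6) \<le> 64 * (1 + real q ^ 8 * (81 + 4096 * real q ^ 8)) * real n ^ 12 * sup_sum\<^sup>2 * mass"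
proof -
  let ?P = "{p \<in> {..<q} \<times> {..<q}. fst p \<noteq> snd p}"
  define mn where "mn k t p x = (min (cmod (arc (Suc k) (t + q ^ k * fst p) x)) (cmod (arc (Suc k) (t + q ^ k * snd p) x))) ^ 6" for k t p x
  define Y where "Y x = (\<Sum>k<n. \<Sum>t<q ^ k. \<Sum>p\<in>?P. mn k t p x)" for x
  have mn0: "mn k t p x \<ge> 0" for k t p x by (simp add: mn_def)
  have Y0: "Y x \<ge> 0" for x unfolding Y_def by (intro sum_nonneg mn0)
  have finP: "finite ?P" by simp
  define R where "R x = 64 * ((\<Sum>s<q ^ n. cmod (f s x) ^ 6) + (real n * real q) ^ 6 * Y x)" for x
  have le: "cmod (\<Sum>t<q ^ n. f t x) ^ 6 \<le> R x" for x
  proof -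
    \<comment> \<open>Every minimum of two siblings is one term of \<open>Y\<close>, hence at most its sixth root.\<close>
    define X where "X = root 6 (Y x)"
    have X0: "X \<ge> 0" using Y0 by (simp add: X_def)
    have X6: "X ^ 6 = Y x" using Y0[of x] by (simp add: X_def)
    have sib: "min (cmod (arc (Suc k) (t + q ^ k * i) x)) (cmod (arc (Suc k) (t + q ^ k * i') x)) \<le> X"
      if "k < n" "t < q ^ k" "i < q" "i' < q" "i \<noteq> i'" for k t i i'
    proof -
      have "mn k t (i, i') x \<le> (\<Sum>p\<in>?P. mn k t p x)" by (rule member_le_sum) (use that mn0 in auto)
      also have "\<dots> \<le> (\<Sum>t<q ^ k. \<Sum>p\<in>?P. mn k t p x)"
        by (rule member_le_sum[of t "{..<q ^ k}" "\<lambda>t. \<Sum>p\<in>?P. mn k t p x"]) (use that mn0 in \<open>auto intro: sum_nonneg\<close>)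
      also have "\<dots> \<le> Y x" unfolding Y_def
        by (rule member_le_sum[of k "{..<n}" "\<lambda>k. \<Sum>t<q ^ k. \<Sum>p\<in>?P. mn k t p x"]) (use that mn0 in \<open>auto intro!: sum_nonneg\<close>)
      finally have "(min (cmod (arc (Suc k) (t + q ^ k * i) x)) (cmod (arc (Suc k) (t + q ^ k * i') x))) ^ 6 \<le> X ^ 6"
        unfolding X6 mn_def by simp
      then show ?thesis using X0 by (subst (asm) power_mono_iff) auto
    qed
    obtain t where t: "t < q ^ n" "cmod (arc 0 0 x) \<le> cmod (arc n t x) + real n * (real q * X)"
      using broad_narrow[OF X0 sib, of n] by auto
    have "{s. s < q ^ n \<and> s mod q ^ n = t} = {t}" using t by auto
    then have an: "arc n t x = f t x" by (simp add: arc_def)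
    have "{s. s < q ^ n \<and> s mod q ^ 0 = 0} = {..<q ^ n}" by auto
    then have a0: "arc 0 0 x = (\<Sum>t<q ^ n. f t x)" by (simp add: arc_def)
    let ?u = "cmod (f t x)" and ?v = "real n * real q * X"
    have uv: "?u \<ge> 0" "?v \<ge> 0" using X0 by auto
    have "cmod (\<Sum>t<q ^ n. f t x) \<le> 2 * max ?u ?v" using t(2) unfolding an a0 by (simp add: mult_ac)
    then have "cmod (\<Sum>t<q ^ n. f t x) ^ 6 \<le> (2 * max ?u ?v) ^ 6" by (intro power_mono) auto
    also have "\<dots> = 64 * max ?u ?v ^ 6" by (simp add: power_mult_distrib)
    also have "max ?u ?v ^ 6 \<le> ?u ^ 6 + ?v ^ 6" using uv by (auto simp: max_def)
    also have "?u ^ 6 \<le> (\<Sum>s<q ^ n. cmod (f s x) ^ 6)" by (rule member_le_sum) (use t in auto)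
    also have "?v ^ 6 = (real n * real q) ^ 6 * Y x" by (simp add: power_mult_distrib X6)
    finally show ?thesis by (simp add: R_def)
  qed
  have f6: "cmod (f s x) ^ 6 \<le> sup_sum\<^sup>2 * (cmod (f s x))\<^sup>2" if "s < q ^ n" for s x
  proof -
    have "(cmod (f s x))\<^sup>2 \<le> (b s)\<^sup>2" by (intro power_mono f_le that) auto
    also have "\<dots> \<le> sup_sum" unfolding sup_sum_def by (rule member_le_sum) (use that in auto)
    finally have "((cmod (f s x))\<^sup>2)\<^sup>2 \<le> sup_sum\<^sup>2" by (intro power_mono) auto
    then have "((cmod (f s x))\<^sup>2)\<^sup>2 * (cmod (f s x))\<^sup>2 \<le> sup_sum\<^sup>2 * (cmod (f s x))\<^sup>2" by (intro mult_right_mono) auto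
    then show ?thesis by (simp flip: power_mult power_add)
  qed
  have if6: "integrable M (\<lambda>x. cmod (f s x) ^ 6)" if s: "s < q ^ n" for s
  proof (rule Bochner_Integration.integrable_bound[of M "\<lambda>x. sup_sum\<^sup>2 * (cmod (f s x))\<^sup>2"])
    show "integrable M (\<lambda>x. sup_sum\<^sup>2 * (cmod (f s x))\<^sup>2)" by (intro integrable_mult_right bddint_sq f_bddint s)
    show "(\<lambda>x. cmod (f s x) ^ 6) \<in> borel_measurable M" using bddint_meas[OF f_bddint[OF s]] by measurable
    show "AE x in M. norm (cmod (f s x) ^ 6) \<le> norm (sup_sum\<^sup>2 * (cmod (f s x))\<^sup>2)" using f6[OF s] by (intro AE_I2) simp
  qed
  have imn: "integrable M (mn k t p)" for k t p unfolding mn_def[abs_def] by (rule integrable_min_arc)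
  have iY: "integrable M Y" unfolding Y_def[abs_def] by (intro Bochner_Integration.integrable_sum imn)
  have is6: "integrable M (\<lambda>x. \<Sum>s<q ^ n. cmod (f s x) ^ 6)" by (intro Bochner_Integration.integrable_sum if6) auto
  have iR: "integrable M R" unfolding R_def[abs_def]
    by (intro integrable_mult_right Bochner_Integration.integrable_add iY is6)
  have R0: "R x \<ge> 0" for x using order_trans[OF _ le] by simp
  have "(LINT x|M. cmod (\<Sum>t<q ^ n. f t x) ^ 6) \<le> (LINT x|M. R x)"
    by (rule integral_mono'[OF iR le R0])
  also have "\<dots> = 64 * ((LINT x|M. (\<Sum>s<q ^ n. cmod (f s x) ^ 6)) + (real n * real q) ^ 6 * (LINT x|M. Y x))"
    unfolding R_def using is6 iY by simp
  finally have split: "(LINT x|M. cmod (\<Sum>t<q ^ n. f t x) ^ 6) \<le> 64 * ((LINT x|M. (\<Sum>s<q ^ n. cmod (f s x) ^ 6)) + (real n * real q) ^ 6 * (LINT x|M. Y x))" .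
  have narrow: "(LINT x|M. (\<Sum>s<q ^ n. cmod (f s x) ^ 6)) \<le> sup_sum\<^sup>2 * mass"
  proof -
    have "(LINT x|M. (\<Sum>s<q ^ n. cmod (f s x) ^ 6)) = (\<Sum>s<q ^ n. LINT x|M. cmod (f s x) ^ 6)"
      by (intro Bochner_Integration.integral_sum if6) auto
    also have "\<dots> \<le> (\<Sum>s<q ^ n. LINT x|M. sup_sum\<^sup>2 * (cmod (f s x))\<^sup>2)"
      by (intro sum_mono integral_mono if6 integrable_mult_right bddint_sq f_bddint f6) auto
    finally show ?thesis by (simp add: mass_def sum_distrib_left)
  qed
  have broad: "(LINT x|M. Y x) \<le> real n * (real q ^ 2 * ((81 + real n * (real q ^ 3 * (1024 * real q ^ 5 * (real n)\<^sup>2 * (real n + 1)\<^sup>2))) * sup_sum\<^sup>2 * mass))"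
    (is "_ \<le> real n * (_ * (?C * _ * _))")
  proof -
    let ?m = "\<lambda>k t. \<Sum>s | s < q ^ n \<and> s mod q ^ k = t. LINT x|M. (cmod (f s x))\<^sup>2"
    have C0: "?C \<ge> 0" by (intro add_nonneg_nonneg mult_nonneg_nonneg) auto
    have cardP: "real (card ?P) \<le> real q ^ 2"
    proof -
      have "card ?P \<le> card ({..<q} \<times> {..<q})" by (intro card_mono) auto
      then show ?thesis by (simp add: power2_eq_square flip: of_nat_mult)
    qed
    have "(LINT x|M. Y x) = (\<Sum>k<n. \<Sum>t<q ^ k. \<Sum>p\<in>?P. LINT x|M. mn k t p x)"
      unfolding Y_def by (simp add: Bochner_Integration.integral_sum Bochner_Integration.integrable_sum imn)
    also have "\<dots> \<le> (\<Sum>k<n. \<Sum>t<q ^ k. \<Sum>p\<in>?P. ?C * sup_sum\<^sup>2 * ?m k t)"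
      unfolding mn_def by (intro sum_mono sibling_sixth) auto
    also have "\<dots> \<le> (\<Sum>k<n. \<Sum>t<q ^ k. real q ^ 2 * (?C * sup_sum\<^sup>2 * ?m k t))"
    proof (intro sum_mono)
      fix k t
      have "?C * sup_sum\<^sup>2 * ?m k t \<ge> 0" by (intro mult_nonneg_nonneg C0 sum_nonneg) auto
      then show "(\<Sum>p\<in>?P. ?C * sup_sum\<^sup>2 * ?m k t) \<le> real q ^ 2 * (?C * sup_sum\<^sup>2 * ?m k t)"
        unfolding sum_constant by (intro mult_right_mono cardP)
    qed
    also have "\<dots> = (\<Sum>k<n. real q ^ 2 * (?C * sup_sum\<^sup>2 * (\<Sum>t<q ^ k. ?m k t)))"
      by (simp only: sum_distrib_left)
    also have "\<dots> = (\<Sum>k<n. real q ^ 2 * (?C * sup_sum\<^sup>2 * mass))"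
    proof (rule sum.cong[OF refl])
      fix k
      have "(\<Sum>t<q ^ k. ?m k t) = mass"
        unfolding mass_def using sum.group[of "{..<q ^ n}" "{..<q ^ k}" "\<lambda>s. s mod q ^ k" "\<lambda>s. LINT x|M. (cmod (f s x))\<^sup>2"] q_pos
        by (auto simp: image_subset_iff)
      then show "real q ^ 2 * (?C * sup_sum\<^sup>2 * (\<Sum>t<q ^ k. ?m k t)) = real q ^ 2 * (?C * sup_sum\<^sup>2 * mass)" by simp
    qed
    finally show ?thesis by simp
  qed
  have "64 * ((LINT x|M. (\<Sum>s<q ^ n. cmod (f s x) ^ 6)) + (real n * real q) ^ 6 * (LINT x|M. Y x))
      \<le> 64 * (sup_sum\<^sup>2 * mass + (real n * real q) ^ 6 * (real n * (real q ^ 2 * (?C * sup_sum\<^sup>2 * mass))))"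
    by (intro mult_left_mono add_mono narrow broad) auto
  with split have main: "(LINT x|M. cmod (\<Sum>t<q ^ n. f t x) ^ 6) \<le> 64 * (sup_sum\<^sup>2 * mass + (real n * real q) ^ 6 * (real n * (real q ^ 2 * (?C * sup_sum\<^sup>2 * mass))))"
    by (rule order_trans)
  have n1: "real n \<ge> 1" using n by simp
  have C_le: "?C \<le> real n ^ 5 * (81 + 4096 * real q ^ 8)"
  proof -
    have "(real n + 1)\<^sup>2 \<le> (2 * real n)\<^sup>2" using n1 by (intro power_mono) auto
    then have a: "(real n + 1)\<^sup>2 \<le> 4 * (real n)\<^sup>2" by (simp add: power_mult_distrib)
    have b: "81 * 1 \<le> 81 * real n ^ 5" using n1 by (intro mult_left_mono one_le_power) auto
    have q8: "real q ^ 8 = real q ^ 3 * real q ^ 5" and n5: "real n ^ 5 = real n * (real n)\<^sup>2 * (real n)\<^sup>2" by (simp_all flip: power_add power_Suc)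
    have "real n * (real q ^ 3 * (1024 * real q ^ 5 * (real n)\<^sup>2 * (real n + 1)\<^sup>2)) \<le> real n * (real q ^ 3 * (1024 * real q ^ 5 * (real n)\<^sup>2 * (4 * (real n)\<^sup>2)))"
      by (intro mult_left_mono a) auto
    also have "\<dots> = real n ^ 5 * (4096 * real q ^ 8)" unfolding q8 n5 by simp
    finally show ?thesis using b by (simp add: algebra_simps)
  qed
  have lm: "sup_sum\<^sup>2 * mass \<ge> 0" using mass_nonneg by simp
  have "sup_sum\<^sup>2 * mass + (real n * real q) ^ 6 * (real n * (real q ^ 2 * (?C * sup_sum\<^sup>2 * mass)))
      = (1 + (real n * real q) ^ 6 * (real n * (real q ^ 2 * ?C))) * (sup_sum\<^sup>2 * mass)" by (simp add: algebra_simps)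
  also have "\<dots> \<le> (real n ^ 12 * (1 + real q ^ 8 * (81 + 4096 * real q ^ 8))) * (sup_sum\<^sup>2 * mass)"
  proof (rule mult_right_mono[OF _ lm])
    have "(real n * real q) ^ 6 * (real n * (real q ^ 2 * ?C)) \<le> (real n * real q) ^ 6 * (real n * (real q ^ 2 * (real n ^ 5 * (81 + 4096 * real q ^ 8))))"
      by (intro mult_left_mono C_le) auto
    also have "\<dots> = real n ^ 12 * (real q ^ 8 * (81 + 4096 * real q ^ 8))"
    proof -
      have "real n ^ 12 = real n ^ 6 * real n * real n ^ 5" "real q ^ 8 = real q ^ 6 * real q ^ 2"
        by (simp_all flip: power_add power_Suc power_Suc2)
      then show ?thesis unfolding power_mult_distrib by simp
    qed
    moreover have "1 \<le> real n ^ 12" using n1 by (rule one_le_power)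
    ultimately show "1 + (real n * real q) ^ 6 * (real n * (real q ^ 2 * ?C)) \<le> real n ^ 12 * (1 + real q ^ 8 * (81 + 4096 * real q ^ 8))"
      by (simp only: distrib_left mult_1_right)
  qed
  finally have "64 * (sup_sum\<^sup>2 * mass + (real n * real q) ^ 6 * (real n * (real q ^ 2 * (?C * sup_sum\<^sup>2 * mass))))
     \<le> 64 * ((real n ^ 12 * (1 + real q ^ 8 * (81 + 4096 * real q ^ 8))) * (sup_sum\<^sup>2 * mass))" by (intro mult_left_mono) auto
  also have "\<dots> = 64 * (1 + real q ^ 8 * (81 + 4096 * real q ^ 8)) * real n ^ 12 * sup_sum\<^sup>2 * mass" by (simp only: mult_ac)
  finally show ?thesis by (rule order_trans[OF main])
qed

end

section \<open>Translations of the plane\<close>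

lemma haar_props:
  assumes q: "q \<ge> 2"
  shows "normalized_haar q (haar q)" "sets (haar q) = sets (padic_borel q)" "space (haar q) = padics q"
proof -
  show 1: "normalized_haar q (haar q)" unfolding haar_def by (rule theI'[OF ex1_haar[OF q]])
  then show 2: "sets (haar q) = sets (padic_borel q)" by (simp add: normalized_haar_def)
  show "space (haar q) = padics q" using sets_eq_imp_space_eq[OF 2] by (simp add: space_pb)
qed

lemma ball_subset: "padic_cball q c b \<subseteq> padics q" by (auto simp: padic_cball_def Qp_def)

lemma haar_ball_sets: "q \<ge> 2 \<Longrightarrow> c \<in> padics q \<Longrightarrow> padic_cball q c b \<in> sets (haar q)"
  by (simp add: haar_props ball_sets)

lemma sigma_finite_haar:
  assumes q: "q \<ge> 2" shows "sigma_finite_measure (haar q)"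
proof (rule sigma_finite_measure.intro, intro exI conjI)
  let ?A = "range (\<lambda>i::nat. padic_cball q padic_zero (- int i))"
  show "countable ?A" by simp
  show "?A \<subseteq> sets (haar q)" using haar_ball_sets[OF q zero_in[OF q]] by auto
  show "\<forall>a\<in>?A. emeasure (haar q) a \<noteq> \<infinity>"
    using haar_ball[OF q haar_props(1)[OF q] zero_in[OF q]] by auto
  show "\<Union> ?A = space (haar q)" unfolding haar_props(3)[OF q]
  proof (intro equalityI subsetI)
    fix x assume x: "x \<in> padics q"
    then obtain k where k: "\<forall>j<k. x j = 0" using lo by blast
    have "x \<in> padic_cball q padic_zero (- int (nat (- k)))"
      unfolding ball_eq[OF q zero_in[OF q]] using x k by (auto simp: padic_zero_def)
    then show "x \<in> \<Union> ?A" by blast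
  qed (use ball_subset in blast)
qed

lemma pneg_pneg:
  assumes q: "q \<ge> 2" and a: "a \<in> padics q" shows "pneg q (pneg q a) = a"
proof -
  interpret cring "Qp q" by (rule cring_Qp[OF q])
  show ?thesis using minus_minus[of a] a neg_props(1)[OF q a] by (simp add: uminus_Qp[OF q] Qp_simps)
qed

lemma haar_translate:
  assumes q: "q \<ge> 2" and a: "a \<in> padics q"
  shows "padic_add q a \<in> measurable (haar q) (haar q)" "distr (haar q) (haar q) (padic_add q a) = haar q"
proof -
  have n: "pneg q a \<in> padics q" using neg_props[OF q a] by simp
  have vim: "padic_add q a -` A \<inter> padics q = padic_add q (pneg q a) ` A" if "A \<subseteq> padics q" for A
    using vimage_add[OF q n that] by (simp add: pneg_pneg[OF q a])
  show m: "padic_add q a \<in> measurable (haar q) (haar q)"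
    unfolding measurable_cong_sets[OF refl haar_props(2)[OF q]]
  proof (rule measurable_pb)
    show "padic_add q a t \<in> padics q" if "t \<in> space (haar q)" for t
      using add_props(1)[OF q a] that by (simp add: haar_props[OF q])
    show "padic_add q a -` padic_cball q c b \<inter> space (haar q) \<in> sets (haar q)" if "c \<in> padics q" for c b
      unfolding haar_props(3)[OF q] vim[OF ball_subset] add_ball[OF q n that]
      by (rule haar_ball_sets[OF q add_props(1)[OF q n that]])
  qed
  show "distr (haar q) (haar q) (padic_add q a) = haar q"
  proof (rule measure_eqI)
    fix A assume "A \<in> sets (distr (haar q) (haar q) (padic_add q a))"
    then have A: "A \<in> sets (haar q)" by simp
    then have sub: "A \<subseteq> padics q" using sets.sets_into_space[OF A] by (simp add: haar_props[OF q])
    have "emeasure (distr (haar q) (haar q) (padic_add q a)) A = emeasure (haar q) (padic_add q (pneg q a) ` A)"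
      using A by (simp add: emeasure_distr[OF m] haar_props[OF q] vim[OF sub])
    also have "\<dots> = emeasure (haar q) A"
      using haar_props(1)[OF q] A n by (simp add: normalized_haar_def Qp_simps)
    finally show "emeasure (distr (haar q) (haar q) (padic_add q a)) A = emeasure (haar q) A" .
  qed simp
qed

lemma space_haar2: "q \<ge> 2 \<Longrightarrow> space (haar2 q) = Qp2 q"
  by (simp add: haar2_def space_pair_measure haar_props Qp2_def Qp_simps)

text \<open>
  Outside the plane, where Schwartz functions vanish, the map is the identity. With this convention
  the transformation rules hold at all points of the type.
\<close>

definition translate :: "nat \<Rightarrow> real \<Rightarrow> real \<Rightarrow> padic \<times> padic \<Rightarrow> padic \<times> padic" where
  "translate q h1 h2 x = (if x \<in> Qp2 q then (padic_add q (digit q h1) (fst x), padic_add q (digit q h2) (snd x)) else x)"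

lemma qfrac_pintegral:
  assumes "h * real q ^ N \<in> \<int>" shows "pintegral q (- int N) h"
  using assms by (simp add: pintegral_def power_int_minus divide_inverse)

lemma digit_in:
  assumes q: "q \<ge> 2" and h: "qfrac q h" shows "digit q h \<in> padics q"
proof -
  obtain N where "h * real q ^ N \<in> \<int>" using h by (auto simp: qfrac_def)
  then have "pintegral q (- int N) h" by (rule qfrac_pintegral)
  then have "\<forall>j<(- int N). digit q h j = 0" using digit_fin[OF q] by blast
  then show ?thesis using digit_less[OF q] unfolding padics_def by blast
qed

lemma papprox_digit:
  assumes q: "q \<ge> 2" and h: "qfrac q h" shows "papprox q (digit q h) h n"
proof -
  obtain N where "h * real q ^ N \<in> \<int>" using h by (auto simp: qfrac_def)
  then have "pintegral q (- int N) h" by (rule qfrac_pintegral)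
  then show ?thesis unfolding papprox_def by (rule pcong_trunc_digit[OF q])
qed

lemma translate_in:
  assumes q: "q \<ge> 2" and h: "qfrac q h1" "qfrac q h2"
  shows "translate q h1 h2 x \<in> Qp2 q \<longleftrightarrow> x \<in> Qp2 q"
  using add_props(1)[OF q digit_in[OF q h(1)]] add_props(1)[OF q digit_in[OF q h(2)]]
  by (auto simp: translate_def Qp2_def Qp_simps)

lemma translate_haar2:
  assumes q: "q \<ge> 2" and h: "qfrac q h1" "qfrac q h2"
  shows "translate q h1 h2 \<in> measurable (haar2 q) (haar2 q)" "distr (haar2 q) (haar2 q) (translate q h1 h2) = haar2 q"
proof -
  let ?f = "\<lambda>(x, y). (padic_add q (digit q h1) x, padic_add q (digit q h2) y)"
  note t1 = haar_translate[OF q digit_in[OF q h(1)]] and t2 = haar_translate[OF q digit_in[OF q h(2)]]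
  have eq: "translate q h1 h2 x = ?f x" if "x \<in> space (haar2 q)" for x
    using that by (simp add: translate_def space_haar2[OF q] case_prod_beta)
  have m: "?f \<in> measurable (haar2 q) (haar2 q)"
    unfolding haar2_def using t1(1) t2(1) by measurable
  then show "translate q h1 h2 \<in> measurable (haar2 q) (haar2 q)"
    using measurable_cong[of "haar2 q" "translate q h1 h2" ?f "haar2 q"] eq by blast
  have "distr (haar2 q) (haar2 q) (translate q h1 h2) = distr (haar2 q) (haar2 q) ?f"
    by (rule distr_cong[OF refl refl eq])
  also have "\<dots> = distr (haar q) (haar q) (padic_add q (digit q h1)) \<Otimes>\<^sub>M distr (haar q) (haar q) (padic_add q (digit q h2))"
    unfolding haar2_def by (rule pair_measure_distr[symmetric]) (use t1 t2 sigma_finite_haar[OF q] in auto)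
  also have "\<dots> = haar2 q" by (simp add: t1 t2 haar2_def)
  finally show "distr (haar2 q) (haar2 q) (translate q h1 h2) = haar2 q" .
qed

lemma qtranslations_haar2:
  assumes "prime q" "odd q" shows "qtranslations (haar2 q) q (translate q)"
proof -
  have "q \<ge> 2" using assms(1) by (rule prime_ge_2_nat)
  then show ?thesis using assms translate_haar2 by unfold_locales auto
qed

lemma emeasure_square:
  assumes q: "q \<ge> 2" and c: "c \<in> padics q" "d \<in> padics q"
  shows "emeasure (haar2 q) (padic_cball q c b \<times> padic_cball q d b) = ennreal (real q powi (- 2 * b))"
proof -
  interpret sigma_finite_measure "haar q" by (rule sigma_finite_haar[OF q])
  have "emeasure (haar2 q) (padic_cball q c b \<times> padic_cball q d b) = ennreal (real q powi (- b)) * ennreal (real q powi (- b))"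
    unfolding haar2_def using c by (simp add: emeasure_pair_measure_Times haar_ball_sets[OF q] haar_ball[OF q haar_props(1)[OF q]])
  also have "\<dots> = ennreal (real q powi (- 2 * b))"
  proof -
    have "real q powi (- 2 * b) = real q powi (- b) * real q powi (- b)"
      using q by (simp flip: power_int_add)
    then show ?thesis using q by (simp add: ennreal_mult)
  qed
  finally show ?thesis .
qed

section \<open>The character\<close>

lemma padic_char_papprox:
  assumes "papprox q x r 0" shows "padic_char q x = echar r"
proof -
  have "padic_trunc q x 0 - r \<in> \<int>" using assms by (simp add: papprox_def pcong_def)
  then have "echar (padic_trunc q x 0) = echar r" by (rule echar_cong)
  moreover have "padic_char q x = echar (padic_trunc q x 0)"
    by (simp add: padic_char_def echar_def cis_conv_exp mult_ac)
  ultimately show ?thesis by simp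
qed

text \<open>
  The character by which the Fourier transform integrates, with the minus sign included.
\<close>

definition dual_char :: "nat \<Rightarrow> padic \<times> padic \<Rightarrow> padic \<times> padic \<Rightarrow> complex" where
  "dual_char q x \<xi> = padic_char q (\<ominus>\<^bsub>Qp q\<^esub> padic_dot q x \<xi>)"

lemma fourier_dual_char: "fourier q f \<xi> = (LINT x|haar2 q. f x * dual_char q x \<xi>)"
  by (simp add: fourier_def dual_char_def)

definition zero_below :: "padic \<times> padic \<Rightarrow> int \<Rightarrow> bool" where
  "zero_below x k \<longleftrightarrow> (\<forall>j<k. fst x j = 0) \<and> (\<forall>j<k. snd x j = 0)"

lemma zero_below_mono: "zero_below x k \<Longrightarrow> l \<le> k \<Longrightarrow> zero_below x l" by (auto simp: zero_below_def)

lemma zero_below_ex: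
  assumes "x \<in> Qp2 q" shows "\<exists>k\<le>0. zero_below x k"
proof -
  have "fst x \<in> padics q" "snd x \<in> padics q" using assms by (auto simp: Qp2_def Qp_simps)
  then show ?thesis using lo3[of "fst x" q "snd x" "fst x"] by (auto simp: zero_below_def)
qed

text \<open>
  The pairing of \<open>x\<close> and \<open>\<xi>\<close> is needed only modulo integers. If both vanish below the index \<open>k\<close>, then
  approximating them to the precision \<open>q^n\<close> with \<open>n + k \<ge> 0\<close> suffices, and the computation takes place in
  rational numbers.
\<close>

lemma dual_char_papprox:
  assumes q: "q \<ge> 2" and x: "x \<in> Qp2 q" and \<xi>: "\<xi> \<in> Qp2 q" and k: "zero_below x k" "zero_below \<xi> k" and n: "0 \<le> n + k" "k \<le> n"
    and r: "papprox q (fst x) r1 n" "papprox q (snd x) r2 n" and s: "papprox q (fst \<xi>) s1 n" "papprox q (snd \<xi>) s2 n"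
  shows "dual_char q x \<xi> = echar (- (r1 * s1 + r2 * s2))"
proof -
  have in_p: "fst x \<in> padics q" "snd x \<in> padics q" "fst \<xi> \<in> padics q" "snd \<xi> \<in> padics q"
    using x \<xi> by (auto simp: Qp2_def Qp_simps)
  have k': "\<forall>j<k. fst x j = 0" "\<forall>j<k. snd x j = 0" "\<forall>j<k. fst \<xi> j = 0" "\<forall>j<k. snd \<xi> j = 0"
    using k by (auto simp: zero_below_def)
  note m1 = mult_props[OF q in_p(1,3) k'(1,3)] and m2 = mult_props[OF q in_p(2,4) k'(2,4)]
  have d: "padic_dot q x \<xi> = padic_add q (padic_mult q (fst x) (fst \<xi>)) (padic_mult q (snd x) (snd \<xi>))"
    by (simp add: padic_dot_def Qp_def)
  have dp: "padic_dot q x \<xi> \<in> padics q" unfolding d by (rule add_props(1)[OF q m1(1) m2(1)])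
  have "papprox q (padic_dot q x \<xi>) (r1 * s1 + r2 * s2) (n + k)"
    unfolding d by (intro add_props(2)[OF q m1(1) m2(1)] m1(3) m2(3) n r s)
  then have "papprox q (pneg q (padic_dot q x \<xi>)) (- (r1 * s1 + r2 * s2)) (n + k)" by (rule neg_props(2)[OF q dp])
  then have "papprox q (pneg q (padic_dot q x \<xi>)) (- (r1 * s1 + r2 * s2)) 0"
    using papprox_mono[OF q neg_props(1)[OF q dp]] n(1) by blast
  then show ?thesis unfolding dual_char_def uminus_Qp[OF q dp] by (rule padic_char_papprox)
qed

lemma zero_below_translate:
  assumes q: "q \<ge> 2" and x: "x \<in> Qp2 q" and k: "zero_below x k" and h: "pintegral q k h1" "pintegral q k h2" "qfrac q h1" "qfrac q h2"
  shows "zero_below (translate q h1 h2 x) k"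
proof -
  have *: "padic_add q (digit q h) y j = 0" if h: "pintegral q k h" "qfrac q h" and y: "y \<in> padics q" "\<forall>j<k. y j = 0" and "j < k" for h y j
  proof -
    have "papprox q (padic_add q (digit q h) y) (h + padic_trunc q y k) k"
      by (intro add_props(2)[OF q digit_in[OF q h(2)] y(1)] papprox_digit[OF q h(2)] papprox_trunc[OF q y(1)] order_refl)
    moreover have "pcong q k (h + padic_trunc q y k) 0"
      using pintegral_add[OF h(1) trunc_fin[OF q y(2)]] by (simp add: pintegral_iff)
    ultimately have "pcong q k (padic_trunc q (padic_add q (digit q h) y) k) 0" unfolding papprox_def by (rule pcong_trans)
    then have "digit q (padic_trunc q (padic_add q (digit q h) y) k) j = digit q 0 j" using digit_cong[OF q _ \<open>j < k\<close>] by blast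
    then show ?thesis using digit_trunc[OF q add_props(1)[OF q digit_in[OF q h(2)] y(1)] \<open>j < k\<close>] by (simp add: digit_def)
  qed
  show ?thesis using x k * h unfolding zero_below_def translate_def by (auto simp: Qp2_def Qp_simps)
qed

lemma dual_char_translate:
  assumes q: "q \<ge> 2" and x: "x \<in> Qp2 q" and \<xi>: "\<xi> \<in> Qp2 q"
    and N: "h1 * real q ^ N \<in> \<int>" "h2 * real q ^ N \<in> \<int>"
  shows "dual_char q (translate q h1 h2 x) \<xi>
    = echar (- (h1 * padic_trunc q (fst \<xi>) (int N) + h2 * padic_trunc q (snd \<xi>) (int N))) * dual_char q x \<xi>"
proof -
  have h: "qfrac q h1" "qfrac q h2" using N by (auto simp: qfrac_def)
  have in_p: "fst x \<in> padics q" "snd x \<in> padics q" "fst \<xi> \<in> padics q" "snd \<xi> \<in> padics q"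
    using x \<xi> by (auto simp: Qp2_def Qp_simps)
  obtain k1 k2 where k12: "k1 \<le> 0" "k2 \<le> 0" "zero_below x k1" "zero_below \<xi> k2" using zero_below_ex[OF x] zero_below_ex[OF \<xi>] by blast
  define k where "k = min (- int N) (min k1 k2)"
  have k: "k \<le> 0" "k \<le> - int N" "zero_below x k" "zero_below \<xi> k" using k12 by (auto simp: k_def intro: zero_below_mono)
  have hk: "pintegral q k h1" "pintegral q k h2" using qfrac_pintegral[OF N(1)] qfrac_pintegral[OF N(2)] k(2) pintegral_mono[OF q] by blast+
  define n where "n = - k"
  have n: "0 \<le> n + k" "k \<le> n" "int N \<le> n" using k by (auto simp: n_def)
  let ?r1 = "padic_trunc q (fst x) n" and ?r2 = "padic_trunc q (snd x) n"
  let ?s1 = "padic_trunc q (fst \<xi>) n" and ?s2 = "padic_trunc q (snd \<xi>) n"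
  have t: "translate q h1 h2 x = (padic_add q (digit q h1) (fst x), padic_add q (digit q h2) (snd x))"
    using x by (simp add: translate_def)
  have ap: "papprox q (padic_add q (digit q h) y) (h + padic_trunc q y n) n" if "qfrac q h" "y \<in> padics q" for h y
    by (intro add_props(2)[OF q digit_in[OF q that(1)] that(2)] papprox_digit[OF q that(1)] papprox_trunc[OF q that(2)] order_refl)
  have "dual_char q (translate q h1 h2 x) \<xi> = echar (- ((h1 + ?r1) * ?s1 + (h2 + ?r2) * ?s2))"
    by (rule dual_char_papprox[OF q _ \<xi> zero_below_translate[OF q x k(3) hk h] k(4) n(1,2)])
      (use translate_in[OF q h, of x] x in_p q h in \<open>simp_all add: t ap papprox_trunc\<close>)
  also have "\<dots> = echar (- (h1 * ?s1 + h2 * ?s2)) * echar (- (?r1 * ?s1 + ?r2 * ?s2))"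
    unfolding echar_add[symmetric] by (simp add: algebra_simps)
  also have "echar (- (?r1 * ?s1 + ?r2 * ?s2)) = dual_char q x \<xi>"
    by (rule dual_char_papprox[OF q x \<xi> k(3,4) n(1,2), symmetric]) (use in_p q in \<open>auto intro: papprox_trunc\<close>)
  also have "echar (- (h1 * ?s1 + h2 * ?s2)) = echar (- (h1 * padic_trunc q (fst \<xi>) (int N) + h2 * padic_trunc q (snd \<xi>) (int N)))"
  proof (rule echar_cong)
    have *: "h * padic_trunc q y n - h * padic_trunc q y (int N) \<in> \<int>" if "y \<in> padics q" "h * real q ^ N \<in> \<int>" for h y
    proof -
      have "(padic_trunc q y n - padic_trunc q y (int N)) / real q ^ N \<in> \<int>"
        using trunc_le_cg[OF q that(1) n(3)] by (simp add: pcong_def)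
      then have "(h * real q ^ N) * ((padic_trunc q y n - padic_trunc q y (int N)) / real q ^ N) \<in> \<int>" using that(2) by (rule Ints_mult[rotated])
      moreover have "(h * real q ^ N) * ((padic_trunc q y n - padic_trunc q y (int N)) / real q ^ N) = h * padic_trunc q y n - h * padic_trunc q y (int N)"
        using q by (simp add: field_simps)
      ultimately show ?thesis by simp
    qed
    have "- (h1 * ?s1 - h1 * padic_trunc q (fst \<xi>) (int N)) - (h2 * ?s2 - h2 * padic_trunc q (snd \<xi>) (int N)) \<in> \<int>"
      by (rule Ints_diff[OF Ints_minus[OF *[OF in_p(3) N(1)]] *[OF in_p(4) N(2)]])
    then show "- (h1 * ?s1 + h2 * ?s2) - - (h1 * padic_trunc q (fst \<xi>) (int N) + h2 * padic_trunc q (snd \<xi>) (int N)) \<in> \<int>"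
      by (simp add: algebra_simps)
  qed
  finally show ?thesis .
qed

lemma cmod_dual_char: "cmod (dual_char q x \<xi>) = 1"
  by (simp add: dual_char_def padic_char_def)

text \<open>
  The truncation takes countably many values, each on a ball or nowhere.
\<close>

lemma trunc_measurable:
  assumes q: "q \<ge> 2" shows "(\<lambda>x. padic_trunc q x n) \<in> borel_measurable (haar q)"
proof -
  have "(\<lambda>x. padic_trunc q x n) \<in> measurable (haar q) (count_space (range (\<lambda>(z::int, k::int). z * real q powi k)))"
  proof (subst measurable_count_space_eq_countable)
    show "countable (range (\<lambda>(z::int, k::int). z * real q powi k))" by simp
    show "(\<lambda>x. padic_trunc q x n) \<in> space (haar q) \<rightarrow> range (\<lambda>(z::int, k::int). z * real q powi k) \<and>
      (\<forall>a\<in>range (\<lambda>(z::int, k::int). z * real q powi k). (\<lambda>x. padic_trunc q x n) -` {a} \<inter> space (haar q) \<in> sets (haar q))"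
    proof (intro conjI ballI funcsetI)
      fix x assume "x \<in> space (haar q)"
      then have "x \<in> padics q" by (simp add: haar_props[OF q])
      then obtain k where "\<forall>j<k. x j = 0" using lo by blast
      then have "padic_trunc q x n = real_of_int \<lfloor>padic_trunc q x n / real q powi k\<rfloor> * real q powi k"
        using pintegral_floor[OF q trunc_fin[OF q]] by (metis mult.commute)
      then show "padic_trunc q x n \<in> range (\<lambda>(z::int, k::int). z * real q powi k)"
        by (metis (mono_tags, lifting) case_prod_conv rangeI)
    next
      fix a assume "a \<in> range (\<lambda>(z::int, k::int). z * real q powi k)"
      show "(\<lambda>x. padic_trunc q x n) -` {a} \<inter> space (haar q) \<in> sets (haar q)"
      proof (cases "\<exists>c\<in>padics q. padic_trunc q c n = a")
        case True
        then obtain c where c: "c \<in> padics q" "padic_trunc q c n = a" by blast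
        have "(\<lambda>x. padic_trunc q x n) -` {a} \<inter> space (haar q) = padic_cball q c n"
        proof (intro equalityI subsetI)
          fix x assume "x \<in> (\<lambda>x. padic_trunc q x n) -` {a} \<inter> space (haar q)"
          then have x: "x \<in> padics q" "padic_trunc q x n = padic_trunc q c n" using c by (auto simp: haar_props[OF q])
          then have "x j = c j" if "j < n" for j using digit_trunc[OF q x(1) that] digit_trunc[OF q c(1) that] by simp
          then show "x \<in> padic_cball q c n" using x by (simp add: ball_eq[OF q c(1)])
        next
          fix x assume "x \<in> padic_cball q c n"
          then have "x \<in> padics q" "\<forall>j<n. x j = c j" by (simp_all add: ball_eq[OF q c(1)])
          then show "x \<in> (\<lambda>x. padic_trunc q x n) -` {a} \<inter> space (haar q)"
            using c(2) trunc_local[of n x c q] by (auto simp: haar_props[OF q])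
        qed
        then show ?thesis using haar_ball_sets[OF q c(1)] by simp
      next
        case False
        then have "(\<lambda>x. padic_trunc q x n) -` {a} \<inter> space (haar q) = {}" by (auto simp: haar_props[OF q])
        then show ?thesis by simp
      qed
    qed
  qed
  then show ?thesis by (rule measurable_compose) (simp add: measurable_count_space)
qed

text \<open>
  For a fixed point the approximations by truncations are eventually constant, and every one of them is
  measurable.
\<close>

lemma dual_char_measurable:
  assumes q: "q \<ge> 2" and \<xi>: "\<xi> \<in> Qp2 q"
  shows "(\<lambda>x. dual_char q x \<xi>) \<in> borel_measurable (haar2 q)"
proof -
  let ?a = "\<lambda>n x. echar (- (padic_trunc q (fst x) n * padic_trunc q (fst \<xi>) n + padic_trunc q (snd x) n * padic_trunc q (snd \<xi>) n))"
  have in_xi: "fst \<xi> \<in> padics q" "snd \<xi> \<in> padics q" using \<xi> by (auto simp: Qp2_def Qp_simps)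
  show ?thesis
  proof (rule borel_measurable_LIMSEQ_metric)
    fix i :: nat
    have [measurable]: "(\<lambda>x. padic_trunc q x (int i)) \<in> borel_measurable (haar q)" by (rule trunc_measurable[OF q])
    have "echar \<in> borel_measurable borel"
      unfolding echar_def[abs_def] cis_conv_exp by (intro borel_measurable_continuous_onI continuous_intros)
    then have [measurable]: "(\<lambda>x. echar (g x)) \<in> borel_measurable N" if "g \<in> borel_measurable N" for N :: "(padic \<times> padic) measure" and g
      using that by measurable
    show "?a (int i) \<in> borel_measurable (haar2 q)" unfolding haar2_def by measurable
  next
    fix x assume "x \<in> space (haar2 q)"
    then have x: "x \<in> Qp2 q" by (simp add: space_haar2[OF q])
    then have in_x: "fst x \<in> padics q" "snd x \<in> padics q" by (auto simp: Qp2_def Qp_simps)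
    obtain k1 k2 where k12: "k1 \<le> 0" "k2 \<le> 0" "zero_below x k1" "zero_below \<xi> k2" using zero_below_ex[OF x] zero_below_ex[OF \<xi>] by blast
    define k where "k = min k1 k2"
    have k: "k \<le> 0" "zero_below x k" "zero_below \<xi> k" using k12 by (auto simp: k_def intro: zero_below_mono)
    have "?a (int i) x = dual_char q x \<xi>" if "i \<ge> nat (- k)" for i
    proof -
      have "0 \<le> int i + k" "k \<le> int i" using that k(1) by linarith+
      from dual_char_papprox[OF q x \<xi> k(2,3) this] show ?thesis
        using papprox_trunc[OF q _ order_refl] in_x in_xi by metis
    qed
    then show "(\<lambda>i. ?a (int i) x) \<longlonglongrightarrow> dual_char q x \<xi>"
      by (intro tendsto_eventually) (auto simp: eventually_sequentially)
  qed
qed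

section \<open>Schwartz functions\<close>

abbreviation square :: "nat \<Rightarrow> padic \<Rightarrow> padic \<Rightarrow> int \<Rightarrow> (padic \<times> padic) set" where
  "square q c d b \<equiv> padic_cball q c b \<times> padic_cball q d b"

lemma schwartz_zero: "schwartz q (\<lambda>x. 0)"
  unfolding schwartz_def by (rule exI[of _ 0]) simp

lemma schwartz_add_square:
  assumes "schwartz q F" "c' \<in> padics q" "d' \<in> padics q"
  shows "schwartz q (\<lambda>x. F x + a' * indicator (square q c' d' b') x)"
proof -
  obtain n a c d b where cd: "\<forall>i<n. c i \<in> carrier (Qp q) \<and> d i \<in> carrier (Qp q)"
    and F: "F = (\<lambda>x. \<Sum>i<(n::nat). a i * indicator (square q (c i) (d i) (b i)) x)"
    using assms(1) unfolding schwartz_def by blast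
  show ?thesis unfolding schwartz_def
  proof (intro exI conjI)
    show "\<forall>i<Suc n. (c(n := c')) i \<in> carrier (Qp q) \<and> (d(n := d')) i \<in> carrier (Qp q)"
      using cd assms(2,3) by (auto simp: Qp_simps less_Suc_eq)
    show "(\<lambda>x. F x + a' * indicator (square q c' d' b') x) =
      (\<lambda>x. \<Sum>i<Suc n. (a(n := a')) i * indicator (square q ((c(n := c')) i) ((d(n := d')) i) ((b(n := b')) i)) x)"
      unfolding F by (rule ext) simp
  qed
qed

text \<open>
  Adding one square at a time replaces the indexed sum in the definition.
\<close>

lemma schwartz_induct [consumes 1, case_names zero add_square]:
  assumes "schwartz q F" and z: "P (\<lambda>x. 0)"
    and s: "\<And>F a c d b. schwartz q F \<Longrightarrow> P F \<Longrightarrow> c \<in> padics q \<Longrightarrow> d \<in> padics q \<Longrightarrow> P (\<lambda>x. F x + a * indicator (square q c d b) x)"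
  shows "P F"
proof -
  obtain n a c d b where cd: "\<forall>i<n. c i \<in> carrier (Qp q) \<and> d i \<in> carrier (Qp q)"
    and F: "F = (\<lambda>x. \<Sum>i<(n::nat). a i * indicator (square q (c i) (d i) (b i)) x)"
    using assms(1) unfolding schwartz_def by blast
  have "m \<le> n \<Longrightarrow> schwartz q (\<lambda>x. \<Sum>i<m. a i * indicator (square q (c i) (d i) (b i)) x) \<and> P (\<lambda>x. \<Sum>i<m. a i * indicator (square q (c i) (d i) (b i)) x)" for m
  proof (induction m)
    case 0 then show ?case using z schwartz_zero by simp
  next
    case (Suc m)
    then have "c m \<in> padics q" "d m \<in> padics q" using cd by (auto simp: Qp_simps)
    then show ?case using Suc by (simp add: s schwartz_add_square)
  qed
  then show ?thesis unfolding F by simp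
qed

lemma schwartz_add: "schwartz q G \<Longrightarrow> schwartz q F \<Longrightarrow> schwartz q (\<lambda>x. F x + G x)"
proof (induction G rule: schwartz_induct)
  case (add_square G a c d b)
  then have "schwartz q (\<lambda>x. (F x + G x) + a * indicator (square q c d b) x)" by (intro schwartz_add_square)
  then show ?case by (simp add: add.assoc)
qed simp

lemma schwartz_cmult: "schwartz q F \<Longrightarrow> schwartz q (\<lambda>x. k * F x)"
proof (induction F rule: schwartz_induct)
  case (add_square F a c d b)
  then have "schwartz q (\<lambda>x. k * F x + (k * a) * indicator (square q c d b) x)" by (intro schwartz_add_square)
  then show ?case by (simp add: algebra_simps)
qed (simp add: schwartz_zero)

lemma schwartz_sum: "(\<And>i. i \<in> A \<Longrightarrow> schwartz q (F i)) \<Longrightarrow> schwartz q (\<lambda>x. \<Sum>i\<in>A. F i x)"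
  by (induction A rule: infinite_finite_induct) (simp_all add: schwartz_zero schwartz_add)

lemma add_in_ball_iff:
  assumes q: "q \<ge> 2" and a: "a \<in> padics q" and c: "c \<in> padics q" and x: "x \<in> padics q"
  shows "padic_add q a x \<in> padic_cball q c b \<longleftrightarrow> x \<in> padic_cball q (padic_add q (pneg q a) c) b"
proof -
  have n: "pneg q a \<in> padics q" using neg_props[OF q a] by simp
  have "padic_add q a -` padic_cball q c b \<inter> padics q = padic_cball q (padic_add q (pneg q a) c) b"
    using vimage_add[OF q n ball_subset] add_ball[OF q n c] by (simp add: pneg_pneg[OF q a])
  then show ?thesis using x by blast
qed

lemma schwartz_translate:
  assumes q: "q \<ge> 2" and h: "qfrac q h1" "qfrac q h2" and F: "schwartz q F"
  shows "schwartz q (\<lambda>x. F (translate q h1 h2 x))"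
  using F
proof (induction F rule: schwartz_induct)
  case zero then show ?case by (simp add: schwartz_zero)
next
  case (add_square F a c d b)
  let ?a1 = "digit q h1" and ?a2 = "digit q h2"
  have a: "?a1 \<in> padics q" "?a2 \<in> padics q" using digit_in[OF q] h by auto
  let ?c = "padic_add q (pneg q ?a1) c" and ?d = "padic_add q (pneg q ?a2) d"
  have cd: "?c \<in> padics q" "?d \<in> padics q"
    using add_square a by (auto intro!: add_props(1)[OF q] neg_props(1)[OF q])
  have "translate q h1 h2 x \<in> square q c d b \<longleftrightarrow> x \<in> square q ?c ?d b" for x
  proof (cases "x \<in> Qp2 q")
    case True
    then show ?thesis using add_in_ball_iff[OF q a(1) add_square.hyps(2)] add_in_ball_iff[OF q a(2) add_square.hyps(3)]
      by (auto simp: translate_def Qp2_def Qp_simps mem_Times_iff)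
  next
    case False
    then have "x \<notin> square q c d b" "x \<notin> square q ?c ?d b" using ball_subset by (auto simp: Qp2_def Qp_simps)
    then show ?thesis using False by (simp add: translate_def)
  qed
  then have "(\<lambda>x. F (translate q h1 h2 x) + a * indicator (square q c d b) (translate q h1 h2 x))
     = (\<lambda>x. F (translate q h1 h2 x) + a * indicator (square q ?c ?d b) x)" by (auto simp: indicator_def)
  then show ?case using schwartz_add_square[OF add_square.IH cd] by simp
qed

definition same_digits :: "int \<Rightarrow> padic \<times> padic \<Rightarrow> padic \<times> padic \<Rightarrow> bool" where
  "same_digits b x y \<longleftrightarrow> (\<forall>j<b. fst x j = fst y j \<and> snd x j = snd y j)"

lemma square_same_digits:
  assumes "q \<ge> 2" "x \<in> Qp2 q" shows "y \<in> square q (fst x) (snd x) b \<longleftrightarrow> y \<in> Qp2 q \<and> same_digits b y x"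
  using assms by (auto simp: Qp2_def Qp_simps mem_Times_iff ball_eq same_digits_def)

lemma schwartz_outside: "schwartz q F \<Longrightarrow> x \<notin> Qp2 q \<Longrightarrow> F x = 0"
proof (induction F rule: schwartz_induct)
  case (add_square F a c d b)
  then have "x \<notin> square q c d b" using ball_subset by (auto simp: Qp2_def Qp_simps)
  then show ?case using add_square by simp
qed simp

lemma schwartz_bddint:
  assumes q: "q \<ge> 2" shows "schwartz q F \<Longrightarrow> bddint (haar2 q) F"
proof (induction F rule: schwartz_induct)
  case (add_square F a c d b)
  have s: "square q c d b \<in> sets (haar2 q)" unfolding haar2_def using add_square haar_ball_sets[OF q] by (intro pair_measureI) auto
  have "integrable (haar2 q) (\<lambda>x. complex_of_real (indicator (square q c d b) x))"
    using s emeasure_square[OF q add_square.hyps(2,3), of b] by (intro integrable_of_real integrable_real_indicator) auto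
  moreover have "(\<lambda>x. complex_of_real (indicator (square q c d b) x)) = indicator (square q c d b)"
    by (auto simp: indicator_def)
  ultimately have "integrable (haar2 q) (indicator (square q c d b) :: _ \<Rightarrow> complex)" by metis
  then have "bddint (haar2 q) (indicator (square q c d b))" unfolding bddint_def by (auto intro!: exI[of _ 1] simp: indicator_def)
  then show ?case using add_square by (intro bddint_add bddint_cmult)
qed simp

lemma schwartz_locally_constant:
  assumes q: "q \<ge> 2" and F: "schwartz q F"
  shows "\<exists>b. \<forall>x\<in>Qp2 q. \<forall>y\<in>Qp2 q. same_digits b x y \<longrightarrow> F x = F y"
  using F
proof (induction F rule: schwartz_induct)
  case (add_square F a c d b)
  from add_square.IH obtain b' where b': "\<forall>x\<in>Qp2 q. \<forall>y\<in>Qp2 q. same_digits b' x y \<longrightarrow> F x = F y" by blast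
  show ?case
  proof (intro exI[of _ "max b b'"] ballI impI)
    fix x y assume xy: "x \<in> Qp2 q" "y \<in> Qp2 q" "same_digits (max b b') x y"
    then have "same_digits b' x y" "same_digits b x y" by (auto simp: same_digits_def)
    then have "F x = F y" using b' xy by blast
    moreover have "x \<in> square q c d b \<longleftrightarrow> y \<in> square q c d b"
      using \<open>same_digits b x y\<close> xy add_square.hyps(2,3) by (auto simp: ball_eq[OF q] mem_Times_iff same_digits_def Qp2_def Qp_simps)
    ultimately show "F x + a * indicator (square q c d b) x = F y + a * indicator (square q c d b) y" by (simp add: indicator_def)
  qed
qed simp

lemma schwartz_bounded_support:
  assumes q: "q \<ge> 2" and F: "schwartz q F" shows "\<exists>k. \<forall>x. F x \<noteq> 0 \<longrightarrow> zero_below x k"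
  using F
proof (induction F rule: schwartz_induct)
  case (add_square F a c d b)
  from add_square.IH obtain k where k: "\<forall>x. F x \<noteq> 0 \<longrightarrow> zero_below x k" by blast
  have "(c, d) \<in> Qp2 q" using add_square by (simp add: Qp2_def Qp_simps)
  then obtain k' where k': "zero_below (c, d) k'" using zero_below_ex by blast
  show ?case
  proof (intro exI[of _ "min k (min k' b)"] allI impI)
    fix x assume "F x + a * indicator (square q c d b) x \<noteq> 0"
    then have "F x \<noteq> 0 \<or> x \<in> square q c d b" by (cases "x \<in> square q c d b") auto
    then consider "F x \<noteq> 0" | "x \<in> square q c d b" by blast
    then show "zero_below x (min k (min k' b))"
    proof cases
      case 1 then show ?thesis using k zero_below_mono by (metis min.cobounded1)
    next
      case 2 then show ?thesis using k' add_square.hyps(2,3) by (auto simp: zero_below_def ball_eq[OF q] mem_Times_iff)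
    qed
  qed
qed simp

section \<open>The Fourier transform\<close>

lemma fourier_integrand_bddint:
  assumes q: "q \<ge> 2" and F: "schwartz q F" and \<xi>: "\<xi> \<in> Qp2 q" shows "bddint (haar2 q) (\<lambda>x. F x * dual_char q x \<xi>)"
  using bddint_bdd_mult[OF schwartz_bddint[OF q F] dual_char_measurable[OF q \<xi>], of 1]
  by (simp add: cmod_dual_char mult.commute)

lemma fourier_cmult: "fourier q (\<lambda>x. k * F x) \<xi> = k * fourier q F \<xi>"
  by (simp add: fourier_dual_char mult.assoc)

lemma fourier_sum:
  assumes q: "q \<ge> 2" and F: "\<And>i. i \<in> A \<Longrightarrow> schwartz q (F i)" and \<xi>: "\<xi> \<in> Qp2 q"
  shows "fourier q (\<lambda>x. \<Sum>i\<in>A. F i x) \<xi> = (\<Sum>i\<in>A. fourier q (F i) \<xi>)"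
  unfolding fourier_dual_char sum_distrib_right
  by (intro Bochner_Integration.integral_sum bddint_integrable fourier_integrand_bddint[OF q F \<xi>])

lemma fourier_diff:
  assumes q: "q \<ge> 2" and F: "schwartz q F" "schwartz q G" and \<xi>: "\<xi> \<in> Qp2 q"
  shows "fourier q (\<lambda>x. F x - G x) \<xi> = fourier q F \<xi> - fourier q G \<xi>"
  unfolding fourier_dual_char left_diff_distrib
  by (intro Bochner_Integration.integral_diff bddint_integrable fourier_integrand_bddint[OF q _ \<xi>] F)

lemma schwartz_diff:
  assumes "schwartz q F" "schwartz q G" shows "schwartz q (\<lambda>x. F x - G x)"
  using schwartz_add[OF schwartz_cmult[OF assms(2), of "-1"] assms(1)] by simp

lemma fourier_translate:
  assumes q: "q \<ge> 2" and F: "schwartz q F" and \<xi>: "\<xi> \<in> Qp2 q"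
    and N: "h1 * real q ^ N \<in> \<int>" "h2 * real q ^ N \<in> \<int>"
  shows "fourier q (\<lambda>x. F (translate q h1 h2 x)) \<xi>
    = echar (h1 * padic_trunc q (fst \<xi>) (int N) + h2 * padic_trunc q (snd \<xi>) (int N)) * fourier q F \<xi>"
proof -
  have h: "qfrac q h1" "qfrac q h2" using N by (auto simp: qfrac_def)
  let ?r = "h1 * padic_trunc q (fst \<xi>) (int N) + h2 * padic_trunc q (snd \<xi>) (int N)"
  let ?T = "translate q h1 h2"
  have "fourier q (\<lambda>x. F (?T x)) \<xi> = (LINT x|haar2 q. echar ?r * (F (?T x) * dual_char q (?T x) \<xi>))"
    unfolding fourier_dual_char
  proof (rule Bochner_Integration.integral_cong[OF refl])
    fix x assume "x \<in> space (haar2 q)"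
    then have x: "x \<in> Qp2 q" by (simp add: space_haar2[OF q])
    have "echar ?r * echar (- ?r) = 1" unfolding echar_add[symmetric] by simp
    then show "F (?T x) * dual_char q x \<xi> = echar ?r * (F (?T x) * dual_char q (?T x) \<xi>)"
      unfolding dual_char_translate[OF q x \<xi> N] by (simp add: mult_ac)
  qed
  also have "\<dots> = echar ?r * (LINT x|haar2 q. F (?T x) * dual_char q (?T x) \<xi>)" by simp
  also have "(LINT x|haar2 q. F (?T x) * dual_char q (?T x) \<xi>) = (LINT x|distr (haar2 q) (haar2 q) ?T. F x * dual_char q x \<xi>)"
    by (rule integral_distr[symmetric, OF translate_haar2(1)[OF q h] bddint_meas[OF fourier_integrand_bddint[OF q F \<xi>]]])
  also have "\<dots> = fourier q F \<xi>" by (simp add: translate_haar2(2)[OF q h] fourier_dual_char)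
  finally show ?thesis .
qed

lemma echar_power: "echar r ^ u = echar (real u * r)"
  by (induction u) (simp_all add: echar_add[symmetric] algebra_simps)

text \<open>
  Orthogonality of the characters of the integers modulo \<open>Q\<close>, as a geometric sum.
\<close>

lemma sum_echar:
  assumes Q: "Q > 0"
  shows "(\<Sum>u<Q. echar (real_of_int z * real u / real Q)) = (if int Q dvd z then of_nat Q else 0)"
proof -
  define w where "w = echar (of_int z / real Q)"
  have p: "echar (real_of_int z * real u / real Q) = w ^ u" for u
    unfolding w_def echar_power by (simp add: mult_ac)
  show ?thesis
  proof (cases "int Q dvd z")
    case True
    then obtain y where "z = int Q * y" by blast
    then have "w = 1" unfolding w_def echar_eq_1_iff using Q by simp
    then show ?thesis using True by (simp add: p)
  next
    case False
    then have w1: "w \<noteq> 1" unfolding w_def echar_eq_1_iff using not_dvd_imp_frac[OF _ Q] by blast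
    have "w ^ Q = 1" unfolding w_def echar_power echar_eq_1_iff using Q by simp
    then show ?thesis using False w1 geometric_sum[of w Q] by (simp add: p)
  qed
qed

text \<open>
  Fourier inversion with finitely many frequencies. If \<open>G\<close> is supported where digits below \<open>-K\<close> vanish and
  depends on digits below \<open>K\<close> only, then summing its Fourier transform over the frequencies
  \<open>(u q^(-K), v q^(-K))\<close> with \<open>u, v < q^(2 K)\<close> against the character at \<open>x\<close> integrates \<open>G\<close> over the square of side
  \<open>q^(-K)\<close> at \<open>x\<close>, on which it is constant.
\<close>

theorem fourier_injective:
  assumes q: "q \<ge> 2" and G: "schwartz q G" and z: "\<And>\<xi>. \<xi> \<in> Qp2 q \<Longrightarrow> fourier q G \<xi> = 0"
  shows "G x = 0"
proof (rule ccontr)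
  assume Gx: "G x \<noteq> 0"
  have x: "x \<in> Qp2 q" using schwartz_outside[OF G, of x] Gx by blast
  obtain b where b: "\<forall>x\<in>Qp2 q. \<forall>y\<in>Qp2 q. same_digits b x y \<longrightarrow> G x = G y"
    using schwartz_locally_constant[OF q G] by blast
  obtain k where k: "\<forall>x. G x \<noteq> 0 \<longrightarrow> zero_below x k" using schwartz_bounded_support[OF q G] by blast
  \<comment> \<open>One number for both the scale of constancy and the size of the support.\<close>
  define K where "K = nat (max b (- k))"
  have K: "b \<le> int K" "- int K \<le> k" by (auto simp: K_def)
  have Gc: "G y = G x" if "y \<in> Qp2 q" "same_digits (int K) y x" for y
  proof -
    have "same_digits b y x" using that(2) K(1) by (auto simp: same_digits_def)
    then show ?thesis using b that(1) x by blast
  qed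
  have Gl: "zero_below y (- int K)" if "G y \<noteq> 0" for y using k that K(2) zero_below_mono by blast
  define Q where "Q = q ^ (2 * K)"
  have Q0: "Q > 0" using q by (simp add: Q_def)
  have Qr: "real Q = real q ^ K * real q ^ K" by (simp add: Q_def pow_double)
  define \<xi> where "\<xi> u v = (digit q (real u / real q ^ K), digit q (real v / real q ^ K))" for u v :: nat
  have qr: "(real u / real q ^ K) * real q ^ K \<in> \<int>" for u :: nat using q by simp
  have pi: "pintegral q (- int K) (real u / real q ^ K)" for u :: nat by (rule qfrac_pintegral[OF qr])
  have qr': "qfrac q (real u / real q ^ K)" for u :: nat unfolding qfrac_def using qr by blast
  have \<xi>_in: "\<xi> u v \<in> Qp2 q" for u v using digit_in[OF q qr'] by (simp add: \<xi>_def Qp2_def Qp_simps)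
  have \<xi>_low: "zero_below (\<xi> u v) (- int K)" for u v using digit_fin[OF q pi] by (simp add: \<xi>_def zero_below_def)
  define \<tau> where "\<tau> y = \<lfloor>padic_trunc q y (int K) * real q ^ K\<rfloor>" for y
  have \<tau>: "padic_trunc q y (int K) = of_int (\<tau> y) / real q ^ K" "0 \<le> \<tau> y" "\<tau> y < int Q"
    if "y \<in> padics q" "\<forall>j<(- int K). y j = 0" for y
  proof -
    have e: "real q powi (- int K) * of_int \<lfloor>padic_trunc q y (int K) / real q powi (- int K)\<rfloor> = padic_trunc q y (int K)"
      by (rule pintegral_floor[OF q trunc_fin[OF q that(2)]])
    then have e': "of_int (\<tau> y) / real q ^ K = padic_trunc q y (int K)" unfolding \<tau>_def by (simp add: power_int_minus divide_inverse mult_ac)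
    then show "padic_trunc q y (int K) = of_int (\<tau> y) / real q ^ K" by simp
    have q0: "real q ^ K > 0" using q by simp
    have "of_int (\<tau> y) = padic_trunc q y (int K) * real q ^ K" using e' q0 by (simp add: field_simps)
    moreover have "0 \<le> padic_trunc q y (int K)" "padic_trunc q y (int K) < real q ^ K" using trunc_range[OF q that(1), of "int K"] by auto
    ultimately have "0 \<le> real_of_int (\<tau> y)" "real_of_int (\<tau> y) < real Q" unfolding Qr using q0 by auto
    then show "0 \<le> \<tau> y" "\<tau> y < int Q" by linarith+
  qed
  have char: "dual_char q y (\<xi> u v) = echar (- (of_int (\<tau> (fst y)) * real u / real Q + of_int (\<tau> (snd y)) * real v / real Q))"
    if y: "y \<in> Qp2 q" "zero_below y (- int K)" for y u v
  proof -
    have in_y: "fst y \<in> padics q" "snd y \<in> padics q" using y by (auto simp: Qp2_def Qp_simps)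
    have l: "\<forall>j<(- int K). fst y j = 0" "\<forall>j<(- int K). snd y j = 0" using y(2) by (auto simp: zero_below_def)
    have ap: "papprox q (fst (\<xi> u v)) (real u / real q ^ K) (int K)" "papprox q (snd (\<xi> u v)) (real v / real q ^ K) (int K)"
      unfolding \<xi>_def by (simp_all add: papprox_digit[OF q qr'])
    have "dual_char q y (\<xi> u v) = echar (- (padic_trunc q (fst y) (int K) * (real u / real q ^ K) + padic_trunc q (snd y) (int K) * (real v / real q ^ K)))"
      by (rule dual_char_papprox[OF q y(1) \<xi>_in y(2) \<xi>_low _ _ papprox_trunc[OF q in_y(1) order_refl] papprox_trunc[OF q in_y(2) order_refl] ap]) auto
    then show ?thesis unfolding \<tau>(1)[OF in_y(1) l(1)] \<tau>(1)[OF in_y(2) l(2)] Qr by simp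
  qed
  have xl: "zero_below x (- int K)" by (rule Gl[OF Gx])
  have in_x: "fst x \<in> padics q" "snd x \<in> padics q" using x by (auto simp: Qp2_def Qp_simps)
  have lx: "\<forall>j<(- int K). fst x j = 0" "\<forall>j<(- int K). snd x j = 0" using xl by (auto simp: zero_below_def)
  let ?c = "\<lambda>u v. echar (of_int (\<tau> (fst x)) * real u / real Q + of_int (\<tau> (snd x)) * real v / real Q)"
  have point: "(\<Sum>u<Q. \<Sum>v<Q. ?c u v * (G y * dual_char q y (\<xi> u v))) = of_nat Q ^ 2 * G x * indicator (square q (fst x) (snd x) (int K)) y" for y
  proof (cases "G y = 0")
    case True
    then have "y \<notin> square q (fst x) (snd x) (int K)" using Gc[of y] Gx unfolding square_same_digits[OF q x] by auto
    then show ?thesis using True by simp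
  next
    case False
    have y: "y \<in> Qp2 q" using schwartz_outside[OF G, of y] False by blast
    have yl: "zero_below y (- int K)" by (rule Gl[OF False])
    have in_y: "fst y \<in> padics q" "snd y \<in> padics q" using y by (auto simp: Qp2_def Qp_simps)
    have ly: "\<forall>j<(- int K). fst y j = 0" "\<forall>j<(- int K). snd y j = 0" using yl by (auto simp: zero_below_def)
    have eq: "int Q dvd \<tau> a - \<tau> c \<longleftrightarrow> (\<forall>j<int K. c j = a j)"
      if "a \<in> padics q" "\<forall>j<(- int K). a j = 0" "c \<in> padics q" "\<forall>j<(- int K). c j = 0" for a c
    proof
      assume "int Q dvd \<tau> a - \<tau> c"
      then have "\<tau> a = \<tau> c" using \<tau>(2,3)[OF that(1,2)] \<tau>(2,3)[OF that(3,4)] by (metis mod_eq_dvd_iff mod_pos_pos_trivial)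
      then have "padic_trunc q a (int K) = padic_trunc q c (int K)" unfolding \<tau>(1)[OF that(1,2)] \<tau>(1)[OF that(3,4)] by simp
      then show "\<forall>j<int K. c j = a j" using digit_trunc[OF q that(1)] digit_trunc[OF q that(3)] by metis
    next
      assume "\<forall>j<int K. c j = a j"
      then have "padic_trunc q c (int K) = padic_trunc q a (int K)" by (rule trunc_local)
      then show "int Q dvd \<tau> a - \<tau> c" by (simp add: \<tau>_def)
    qed
    let ?p = "\<lambda>u::nat. echar (of_int (\<tau> (fst x) - \<tau> (fst y)) * real u / real Q)" and ?r = "\<lambda>v::nat. echar (of_int (\<tau> (snd x) - \<tau> (snd y)) * real v / real Q)"
    have "(\<Sum>u<Q. \<Sum>v<Q. ?c u v * (G y * dual_char q y (\<xi> u v)))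
      = (\<Sum>u<Q. \<Sum>v<Q. G y * (?p u * ?r v))"
    proof (intro sum.cong refl)
      fix u v
      have "?c u v * echar (- (of_int (\<tau> (fst y)) * real u / real Q + of_int (\<tau> (snd y)) * real v / real Q))
        = ?p u * ?r v"
        unfolding echar_add[symmetric] by (rule arg_cong[of _ _ echar]) (simp add: algebra_simps diff_divide_distrib)
      then show "?c u v * (G y * dual_char q y (\<xi> u v)) = G y * (?p u * ?r v)"
        unfolding char[OF y yl] mult.left_commute[of _ "G y"] by (rule arg_cong)
    qed
    also have "\<dots> = G y * ((\<Sum>u<Q. ?p u) * (\<Sum>v<Q. ?r v))"
      unfolding sum_product by (simp only: sum_distrib_left)
    also have "\<dots> = G y * of_nat Q ^ 2 * of_bool (same_digits (int K) y x)"
      unfolding sum_echar[OF Q0] eq[OF in_x(1) lx(1) in_y(1) ly(1)] eq[OF in_x(2) lx(2) in_y(2) ly(2)]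
      by (auto simp: same_digits_def power2_eq_square)
    also have "\<dots> = of_nat Q ^ 2 * G x * indicator (square q (fst x) (snd x) (int K)) y"
      using Gc[OF y] square_same_digits[OF q x, of y "int K"] y by (auto simp: indicator_def)
    finally show ?thesis .
  qed
  have sb: "square q (fst x) (snd x) (int K) \<in> sets (haar2 q)"
    unfolding haar2_def using in_x haar_ball_sets[OF q] by (intro pair_measureI) auto
  have i: "integrable (haar2 q) (\<lambda>y. ?c u v * (G y * dual_char q y (\<xi> u v)))" for u v
    by (intro bddint_integrable bddint_cmult fourier_integrand_bddint[OF q G \<xi>_in])
  have "0 = (\<Sum>u<Q. \<Sum>v<Q. ?c u v * fourier q G (\<xi> u v))" using z[OF \<xi>_in] by simp
  also have "\<dots> = (\<Sum>u<Q. \<Sum>v<Q. LINT y|haar2 q. ?c u v * (G y * dual_char q y (\<xi> u v)))"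
    unfolding fourier_dual_char by simp
  also have "\<dots> = (LINT y|haar2 q. (\<Sum>u<Q. \<Sum>v<Q. ?c u v * (G y * dual_char q y (\<xi> u v))))"
    by (simp add: Bochner_Integration.integral_sum Bochner_Integration.integrable_sum i)
  also have "\<dots> = (LINT y|haar2 q. of_nat Q ^ 2 * G x * indicator (square q (fst x) (snd x) (int K)) y)" unfolding point ..
  also have "\<dots> = of_nat Q ^ 2 * G x * of_real (measure (haar2 q) (square q (fst x) (snd x) (int K)))"
  proof -
    have ind: "indicator B y = complex_of_real (indicator B y)" for B and y :: "padic \<times> padic" by (simp add: indicator_def)
    show ?thesis unfolding ind Bochner_Integration.integral_mult_right_zero integral_complex_of_real
      using sets.Int_space_eq2[OF sb] by simp
  qed
  also have "measure (haar2 q) (square q (fst x) (snd x) (int K)) = real q powi (- 2 * int K)"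
    using emeasure_square[OF q in_x, of "int K"] q by (intro measure_eq_emeasure_eq_ennreal) auto
  finally show False using Gx Q0 q by simp
qed

section \<open>Restricting the frequency to an interval\<close>

text \<open>
  The interval of length \<open>q^(-n)\<close> around the integer \<open>t\<close>. Integers below \<open>q^n\<close> represent all of these intervals.
\<close>

definition interval :: "nat \<Rightarrow> nat \<Rightarrow> nat \<Rightarrow> padic set" where
  "interval q n t = {\<xi> \<in> Zp q. \<forall>j<int n. \<xi> j = digit q (real t) j}"

text \<open>
  For an integral frequency \<open>z\<close> the average over \<open>i\<close> of \<open>echar (i (z - t) / q^n)\<close> is \<open>1\<close> or \<open>0\<close> according to
  whether \<open>z\<close> is congruent to \<open>t\<close> modulo \<open>q^n\<close>. So this average of translates of \<open>F\<close>, which is visibly a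
  Schwartz function, is the restriction of \<open>F\<close> to the interval around \<open>t\<close>.
\<close>

definition arc_part :: "nat \<Rightarrow> nat \<Rightarrow> (padic \<times> padic \<Rightarrow> complex) \<Rightarrow> nat \<Rightarrow> padic \<times> padic \<Rightarrow> complex" where
  "arc_part q n F t x = (1 / of_nat (q ^ n)) *
     (\<Sum>i<q ^ n. echar (- (real t * real i / real (q ^ n))) * F (translate q (real i / real q ^ n) 0 x))"

lemma qfrac_nat: "qfrac q (real t)"
  unfolding qfrac_def by (rule exI[of _ 0]) simp

lemma qfrac_frac: "q \<ge> 2 \<Longrightarrow> qfrac q (real i / real q ^ n)"
  unfolding qfrac_def by (rule exI[of _ n]) simp

lemma qfrac_0: "qfrac q 0"
  unfolding qfrac_def by simp

lemma schwartz_arc_part: "q \<ge> 2 \<Longrightarrow> schwartz q F \<Longrightarrow> schwartz q (arc_part q n F t)"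
  unfolding arc_part_def[abs_def]
  by (intro schwartz_cmult schwartz_sum schwartz_translate qfrac_frac qfrac_0)

lemma Zp_iff: "q \<ge> 2 \<Longrightarrow> \<xi> \<in> Zp q \<longleftrightarrow> \<xi> \<in> padics q \<and> (\<forall>j<0. \<xi> j = 0)"
  by (simp add: Zp_eq ball_eq) (simp add: padic_zero_def)

lemma trunc_Zp:
  assumes q: "q \<ge> 2" and x: "\<xi> \<in> Zp q" shows "\<exists>z. padic_trunc q \<xi> n = of_int z"
proof -
  have "pintegral q 0 (padic_trunc q \<xi> n)" using x trunc_fin[OF q] by (simp add: Zp_iff[OF q])
  then show ?thesis by (auto simp: pintegral_def elim: Ints_cases)
qed

lemma pcong_of_int:
  assumes "q \<ge> 2" shows "pcong q (int n) (real_of_int z) (real_of_int y) \<longleftrightarrow> int (q ^ n) dvd z - y"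
proof
  assume "pcong q (int n) (real_of_int z) (real_of_int y)"
  then have "real_of_int (z - y) / real (q ^ n) \<in> \<int>" by (simp add: pcong_def)
  then show "int (q ^ n) dvd z - y" using not_dvd_imp_frac[of "q ^ n" "z - y"] assms by auto
next
  assume "int (q ^ n) dvd z - y"
  then obtain w where "z - y = int (q ^ n) * w" by blast
  then have "real_of_int z - real_of_int y = real q ^ n * of_int w" by (metis of_int_diff of_int_mult of_int_of_nat_eq of_nat_power)
  then show "pcong q (int n) (real_of_int z) (real_of_int y)" using assms by (simp add: pcong_def)
qed

lemma interval_iff:
  assumes q: "q \<ge> 2" and \<xi>: "\<xi> \<in> Zp q" and nm: "n \<le> m"
  shows "\<xi> \<in> interval q n t \<longleftrightarrow> pcong q (int n) (padic_trunc q \<xi> (int m)) (real t)"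
proof
  have x: "\<xi> \<in> padics q" using \<xi> by (simp add: Zp_iff[OF q])
  {
    assume "\<xi> \<in> interval q n t"
    then have "padic_trunc q \<xi> (int n) = padic_trunc q (digit q (real t)) (int n)"
      by (intro trunc_local) (simp add: interval_def)
    then have "pcong q (int n) (padic_trunc q \<xi> (int n)) (real t)"
      using papprox_digit[OF q qfrac_nat, of t "int n"] by (simp add: papprox_def)
    then show "pcong q (int n) (padic_trunc q \<xi> (int m)) (real t)"
      using trunc_le_cg[OF q x, of "int n" "int m"] nm pcong_trans by simp
  next
    assume p: "pcong q (int n) (padic_trunc q \<xi> (int m)) (real t)"
    have "\<xi> j = digit q (real t) j" if j: "j < int n" for j
      using digit_cong[OF q p j] digit_trunc[OF q x, of j "int m"] j nm by simp
    then show "\<xi> \<in> interval q n t" using \<xi> by (simp add: interval_def)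
  }
qed

text \<open>
  Membership in the neighbourhood of the parabola, in terms of truncations, which are rational numbers.
\<close>

lemma parabola_trunc:
  assumes q: "q \<ge> 2" and \<xi>: "\<xi> \<in> parabola_nbhd q (1 / real q ^ (2 * n))"
  shows "fst \<xi> \<in> Zp q"
    and "pcong q (int (2 * n)) (padic_trunc q (snd \<xi>) (int (2 * n))) ((padic_trunc q (fst \<xi>) (int (2 * n)))\<^sup>2)"
proof -
  obtain x y where xy: "\<xi> = (x, y)" by fastforce
  interpret cring "Qp q" by (rule cring_Qp[OF q])
  have x: "x \<in> padics q" "x \<in> Zp q" and y: "y \<in> padics q"
    and le: "padic_norm q (y \<ominus>\<^bsub>Qp q\<^esub> (x [^]\<^bsub>Qp q\<^esub> (2::nat))) \<le> 1 / real q ^ (2 * n)"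
    using \<xi> by (auto simp: xy parabola_nbhd_def Qp2_def Qp_simps)
  show "fst \<xi> \<in> Zp q" using x by (simp add: xy)
  have lx: "\<forall>j<0. x j = 0" using x(2) by (simp add: Zp_iff[OF q])
  let ?s = "padic_trunc q x (int (2 * n))" and ?r = "padic_trunc q y (int (2 * n))"
  have sq: "x [^]\<^bsub>Qp q\<^esub> (2::nat) = padic_mult q x x"
    using x(1) l_one[of x] by (simp add: numeral_2_eq_2 Qp_def)
  note m = mult_props[OF q x(1) x(1) lx lx]
  have ap: "papprox q (padic_mult q x x) (?s * ?s) (int (2 * n))"
    using m(3)[of "int (2 * n)" ?s ?s] papprox_trunc[OF q x(1) order_refl] by simp
  let ?z = "padic_add q y (pneg q (padic_mult q x x))"
  have z: "?z \<in> padics q" by (rule add_props(1)[OF q y neg_props(1)[OF q m(1)]])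
  have "y \<ominus>\<^bsub>Qp q\<^esub> (x [^]\<^bsub>Qp q\<^esub> (2::nat)) = ?z"
    unfolding sq a_minus_def uminus_Qp[OF q m(1)] by (simp add: Qp_def)
  then have "padic_norm q ?z \<le> real q powi (- int (2 * n))"
    using le by (simp only: power_int_minus power_int_of_nat inverse_eq_divide)
  then have "\<forall>j<int (2 * n). ?z j = 0" using norm_le_iff[OF q z] by blast
  then have "padic_trunc q ?z (int (2 * n)) = 0" using trunc_alt[of "int (2 * n)" ?z q "int (2 * n)"] by simp
  moreover have "papprox q ?z (?r + - (?s * ?s)) (int (2 * n))"
    by (intro add_props(2)[OF q y neg_props(1)[OF q m(1)]] neg_props(2)[OF q m(1)] ap papprox_trunc[OF q y order_refl])
  ultimately have "pcong q (int (2 * n)) 0 (?r + - (?s * ?s))" by (simp add: papprox_def)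
  then have "pcong q (int (2 * n)) (?r + - (?s * ?s)) 0" by (rule pcong_sym)
  then have "pcong q (int (2 * n)) (?r + - (?s * ?s) + ?s * ?s) (0 + ?s * ?s)" by (intro pcong_add pcong_refl)
  then show "pcong q (int (2 * n)) (padic_trunc q (snd \<xi>) (int (2 * n))) ((padic_trunc q (fst \<xi>) (int (2 * n)))\<^sup>2)"
    by (simp add: xy power2_eq_square)
qed

lemma fourier_arc_part:
  assumes q: "q \<ge> 2" and F: "schwartz q F" and \<xi>: "\<xi> \<in> Qp2 q"
    and Z: "fourier q F \<xi> \<noteq> 0 \<Longrightarrow> fst \<xi> \<in> Zp q"
  shows "fourier q (arc_part q n F t) \<xi> = fourier q F \<xi> * indicator (interval q n t \<times> carrier (Qp q)) \<xi>"
proof (cases "fourier q F \<xi> = 0")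
  have q0: "real q ^ n > 0" using q by simp
  let ?s = "padic_trunc q (fst \<xi>) (int n)"
  have N: "real i / real q ^ n * real q ^ n \<in> \<int>" "0 * real q ^ n \<in> \<int>" for i using q by simp_all
  have eq: "fourier q (arc_part q n F t) \<xi> = (1 / of_nat (q ^ n)) *
      (\<Sum>i<q ^ n. echar (- (real t * real i / real (q ^ n))) * (echar (real i / real q ^ n * ?s + 0 * padic_trunc q (snd \<xi>) (int n)) * fourier q F \<xi>))"
    unfolding arc_part_def fourier_cmult
    by (subst fourier_sum[OF q _ \<xi>])
      (simp_all only: fourier_cmult fourier_translate[OF q F \<xi> N] schwartz_cmult schwartz_translate[OF q qfrac_frac[OF q] qfrac_0 F])
  {
    case True
    then show ?thesis unfolding eq by simp
  next
    case False
    then have xi1: "fst \<xi> \<in> Zp q" by (rule Z)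
    obtain z where z: "?s = of_int z" using trunc_Zp[OF q xi1] by blast
    have "fourier q (arc_part q n F t) \<xi> = (1 / of_nat (q ^ n)) * (\<Sum>i<q ^ n. echar (of_int (z - int t) * real i / real (q ^ n)) * fourier q F \<xi>)"
      unfolding eq z mult.assoc[symmetric] echar_add[symmetric]
      by (intro arg_cong2[of _ _ _ _ "(*)"] sum.cong refl arg_cong[of _ _ echar]) (simp add: diff_divide_distrib algebra_simps)
    also have "\<dots> = (if int (q ^ n) dvd z - int t then 1 else 0) * fourier q F \<xi>"
      unfolding sum_distrib_right[symmetric] using q by (subst sum_echar) auto
    also have "int (q ^ n) dvd z - int t \<longleftrightarrow> fst \<xi> \<in> interval q n t"
      using interval_iff[OF q xi1 order_refl, of n t] pcong_of_int[OF q, of n z "int t"] z by simp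
    finally show ?thesis using \<xi> by (auto simp: indicator_def mem_Times_iff Qp2_def)
  }
qed

lemma freq_restrict_arc_part:
  assumes q: "q \<ge> 2" and F: "schwartz q F" and Z: "\<And>\<xi>. \<xi> \<in> Qp2 q \<Longrightarrow> fourier q F \<xi> \<noteq> 0 \<Longrightarrow> fst \<xi> \<in> Zp q"
  shows "freq_restrict q (interval q n t) F = arc_part q n F t"
  unfolding freq_restrict_def
proof (rule the_equality)
  show "schwartz q (arc_part q n F t) \<and> (\<forall>\<xi>\<in>Qp2 q. fourier q (arc_part q n F t) \<xi> = fourier q F \<xi> * indicator (interval q n t \<times> carrier (Qp q)) \<xi>)"
    using schwartz_arc_part[OF q F] fourier_arc_part[OF q F _ Z] by blast
next
  fix G assume G: "schwartz q G \<and> (\<forall>\<xi>\<in>Qp2 q. fourier q G \<xi> = fourier q F \<xi> * indicator (interval q n t \<times> carrier (Qp q)) \<xi>)"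
  have "G x - arc_part q n F t x = 0" for x
  proof (rule fourier_injective[OF q])
    show "schwartz q (\<lambda>x. G x - arc_part q n F t x)" using G schwartz_arc_part[OF q F] by (intro schwartz_diff) auto
    show "fourier q (\<lambda>x. G x - arc_part q n F t x) \<xi> = 0" if "\<xi> \<in> Qp2 q" for \<xi>
      using G that fourier_arc_part[OF q F that Z[OF that]]
      by (subst fourier_diff[OF q _ schwartz_arc_part[OF q F] that]) auto
  qed
  then show "G = arc_part q n F t" by (intro ext) simp
qed

lemma translate_0:
  assumes q: "q \<ge> 2" shows "translate q 0 0 x = x"
proof -
  interpret cring "Qp q" by (rule cring_Qp[OF q])
  have d: "digit q 0 = padic_zero" by (auto simp: digit_def padic_zero_def)
  have "padic_add q padic_zero y = y" if "y \<in> padics q" for y using l_zero[of y] that by (simp add: Qp_simps)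
  then show ?thesis by (auto simp: translate_def d Qp2_def Qp_simps)
qed

lemma sum_arc_part:
  assumes q: "q \<ge> 2" shows "(\<Sum>t<q ^ n. arc_part q n F t x) = F x"
proof -
  have Q: "q ^ n > 0" using q by simp
  let ?F = "\<lambda>i. F (translate q (real i / real q ^ n) 0 x)"
  have "(\<Sum>t<q ^ n. arc_part q n F t x) = (1 / of_nat (q ^ n)) * (\<Sum>i<q ^ n. \<Sum>t<q ^ n. echar (- (real t * real i / real (q ^ n))) * ?F i)"
    unfolding arc_part_def sum_distrib_left[symmetric] by (subst sum.swap) (rule refl)
  also have "\<dots> = (1 / of_nat (q ^ n)) * (\<Sum>i<q ^ n. (if i = 0 then of_nat (q ^ n) * F x else 0))"
  proof (intro arg_cong2[of _ _ _ _ "(*)"] refl sum.cong)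
    fix i assume i: "i \<in> {..<q ^ n}"
    have "(\<Sum>t<q ^ n. echar (- (real t * real i / real (q ^ n))) * ?F i) = (\<Sum>t<q ^ n. echar (of_int (- int i) * real t / real (q ^ n))) * ?F i"
      by (subst sum_distrib_right) (simp add: mult.commute)
    also have "\<dots> = (if int (q ^ n) dvd - int i then of_nat (q ^ n) else 0) * ?F i" by (simp only: sum_echar[OF Q])
    also have "int (q ^ n) dvd - int i \<longleftrightarrow> i = 0"
      using i by (auto dest: nat_dvd_not_less simp flip: of_nat_power)
    finally show "(\<Sum>t<q ^ n. echar (- (real t * real i / real (q ^ n))) * ?F i) = (if i = 0 then of_nat (q ^ n) * F x else 0)"
      using translate_0[OF q] by simp
  qed
  also have "\<dots> = F x" using Q by (simp del: of_nat_power)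
  finally show ?thesis .
qed

text \<open>
  Both sides are Schwartz functions of \<open>x\<close>, so by injectivity of the Fourier transform it suffices to compare
  the phases on the support. There \<open>\<xi>\<close> is \<open>(s, s^2)\<close> up to \<open>q^(2 n)\<close> in the second coordinate, with \<open>s\<close>
  congruent to \<open>t\<close> modulo \<open>q^n\<close>, and the plank is made to ignore these deviations.
\<close>

lemma arc_part_translate:
  assumes q: "q \<ge> 2" and F: "schwartz q F" and supp: "has_fourier_support q F (parabola_nbhd q (1 / real q ^ (2 * n)))"
    and h: "plank q n t h1 h2"
  shows "arc_part q n F t (translate q h1 h2 x) = echar (real t * h1 + real t ^ 2 * h2) * arc_part q n F t x"
proof -
  let ?G = "arc_part q n F t" and ?e = "echar (real t * h1 + real t ^ 2 * h2)"
  have G: "schwartz q ?G" by (rule schwartz_arc_part[OF q F])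
  have p: "h2 * real q ^ (2 * n) \<in> \<int>" "(h1 + 2 * real t * h2) * real q ^ n \<in> \<int>" using h by (auto simp: plank_def)
  have "(h1 + 2 * real t * h2) * real q ^ n * real q ^ n - of_nat (2 * t) * (h2 * real q ^ (2 * n)) \<in> \<int>"
    by (rule Ints_diff[OF Ints_mult[OF p(2) Ints_power[OF Ints_of_nat]] Ints_mult[OF Ints_of_nat p(1)]])
  also have "(h1 + 2 * real t * h2) * real q ^ n * real q ^ n - of_nat (2 * t) * (h2 * real q ^ (2 * n)) = h1 * real q ^ (2 * n)"
    unfolding pow_double by (simp add: algebra_simps)
  finally have p1: "h1 * real q ^ (2 * n) \<in> \<int>" .
  have qr: "qfrac q h1" "qfrac q h2" using p1 p(1) unfolding qfrac_def by blast+
  have "?G (translate q h1 h2 x) - ?e * ?G x = 0"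
  proof (rule fourier_injective[OF q])
    show "schwartz q (\<lambda>x. ?G (translate q h1 h2 x) - ?e * ?G x)"
      by (intro schwartz_diff schwartz_translate[OF q qr] schwartz_cmult G)
    fix \<xi> assume \<xi>: "\<xi> \<in> Qp2 q"
    let ?s1 = "padic_trunc q (fst \<xi>) (int (2 * n))" and ?s2 = "padic_trunc q (snd \<xi>) (int (2 * n))"
    have Z: "fst \<xi> \<in> Zp q" if "fourier q F \<xi> \<noteq> 0"
      using supp \<xi> that parabola_trunc(1)[OF q] unfolding has_fourier_support_def by blast
    have "fourier q (\<lambda>x. ?G (translate q h1 h2 x) - ?e * ?G x) \<xi> = (echar (h1 * ?s1 + h2 * ?s2) - ?e) * fourier q ?G \<xi>"
      by (subst fourier_diff[OF q schwartz_translate[OF q qr G] schwartz_cmult[OF G] \<xi>])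
        (simp only: fourier_translate[OF q G \<xi> p1 p(1)] fourier_cmult left_diff_distrib)
    also have "\<dots> = 0"
    proof (cases "fourier q F \<xi> \<noteq> 0 \<and> fst \<xi> \<in> interval q n t")
      case False
      have "fourier q ?G \<xi> = fourier q F \<xi> * indicator (interval q n t \<times> carrier (Qp q)) \<xi>"
        by (rule fourier_arc_part[OF q F \<xi> Z])
      then have "fourier q ?G \<xi> = 0" using False by (auto simp: indicator_def)
      then show ?thesis by simp
    next
      case True
      have par: "\<xi> \<in> parabola_nbhd q (1 / real q ^ (2 * n))"
        using supp \<xi> True unfolding has_fourier_support_def by blast
      note P = parabola_trunc[OF q par]
      have q0: "real q ^ n \<noteq> 0" using q by simp
      have "pcong q (int n) ?s1 (real t)" using interval_iff[OF q P(1), of n "2 * n" t] True by simp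
      then obtain z where "(?s1 - real t) / real q ^ n = of_int z" by (auto simp: pcong_def elim: Ints_cases)
      then have z: "?s1 = real t + real q ^ n * of_int z" using q0 by (simp add: field_simps)
      obtain w where "(?s2 - ?s1\<^sup>2) / real q ^ (2 * n) = of_int w"
        using P(2) by (auto simp: pcong_def power_int_of_nat simp del: of_nat_mult elim: Ints_cases)
      then have w: "?s2 = ?s1\<^sup>2 + real q ^ (2 * n) * of_int w" using q by (simp add: field_simps)
      have "(h1 * ?s1 + h2 * ?s2) - (real t * h1 + real t ^ 2 * h2)
          = ((h1 + 2 * real t * h2) * real q ^ n) * of_int z + (h2 * real q ^ (2 * n)) * of_int (z ^ 2 + w)"
        unfolding w z pow_double by (simp add: algebra_simps power2_eq_square)
      also have "\<dots> \<in> \<int>" by (intro Ints_add Ints_mult[OF p(2) Ints_of_int] Ints_mult[OF p(1) Ints_of_int])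
      finally have "echar (h1 * ?s1 + h2 * ?s2) = ?e" by (rule echar_cong)
      then show ?thesis by simp
    qed
    finally show "fourier q (\<lambda>x. ?G (translate q h1 h2 x) - ?e * ?G x) \<xi> = 0" .
  qed
  then show ?thesis by simp
qed

text \<open>
  A value of a locally constant function is attained on a square, which has positive measure.
\<close>

lemma schwartz_le_Linf_norm:
  assumes q: "q \<ge> 2" and G: "schwartz q G" shows "cmod (G x) \<le> Linf_norm q G"
proof -
  let ?f = "\<lambda>x. ennreal (cmod (G x))"
  let ?E = "esssup (haar2 q) ?f"
  have b: "bddint (haar2 q) G" by (rule schwartz_bddint[OF q G])
  have fm: "?f \<in> borel_measurable (haar2 q)" using bddint_meas[OF b] by measurable
  obtain B where B: "\<And>x. cmod (G x) \<le> B" using b by (auto simp: bddint_def)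
  have "?E \<le> ennreal B" by (rule esssup_I[OF fm]) (intro AE_I2 ennreal_leI B)
  note fin = le_less_trans[OF this ennreal_less_top]
  have "?f x \<le> ?E"
  proof (rule ccontr)
    assume "\<not> ?f x \<le> ?E"
    then have gt: "?f x > ?E" by simp
    then have "G x \<noteq> 0" by auto
    then have x: "x \<in> Qp2 q" using schwartz_outside[OF G] by blast
    obtain b where b: "\<forall>x\<in>Qp2 q. \<forall>y\<in>Qp2 q. same_digits b x y \<longrightarrow> G x = G y"
      using schwartz_locally_constant[OF q G] by blast
    have in_x: "fst x \<in> padics q" "snd x \<in> padics q" using x by (auto simp: Qp2_def Qp_simps)
    have sub: "square q (fst x) (snd x) b \<subseteq> {y \<in> space (haar2 q). ?f y > ?E}"
    proof
      fix y assume "y \<in> square q (fst x) (snd x) b"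
      then have y: "y \<in> Qp2 q" "same_digits b y x" using square_same_digits[OF q x] by auto
      then have "G y = G x" using b x by blast
      then show "y \<in> {y \<in> space (haar2 q). ?f y > ?E}" using y gt by (simp add: space_haar2[OF q])
    qed
    have "emeasure (haar2 q) (square q (fst x) (snd x) b) \<le> emeasure (haar2 q) {y \<in> space (haar2 q). ?f y > ?E}"
      by (intro emeasure_mono sub borel_measurable_less borel_measurable_const fm)
    then have "emeasure (haar2 q) (square q (fst x) (snd x) b) = 0" by (simp add: esssup_zero_measure)
    then show False unfolding emeasure_square[OF q in_x] using q by simp
  qed
  then have "enn2real (?f x) \<le> enn2real ?E" using fin by (intro enn2real_mono)
  then show ?thesis by (simp add: Linf_norm_def)
qed

lemma inj_interval: "q \<ge> 2 \<Longrightarrow> inj_on (interval q n) {..<q ^ n}"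
proof (rule inj_onI)
  fix t s assume q: "q \<ge> 2" and ts: "t \<in> {..<q ^ n}" "s \<in> {..<q ^ n}" and eq: "interval q n t = interval q n s"
  have pi: "pintegral q 0 (real t)" by (simp add: pintegral_def)
  have Z: "digit q (real t) \<in> Zp q" using digit_in[OF q qfrac_nat] digit_fin[OF q pi] by (simp add: Zp_iff[OF q])
  then have "digit q (real t) \<in> interval q n t" by (simp add: interval_def)
  then have "pcong q (int n) (padic_trunc q (digit q (real t)) (int n)) (real s)"
    using interval_iff[OF q Z order_refl, of n s] eq by simp
  moreover have "pcong q (int n) (padic_trunc q (digit q (real t)) (int n)) (real t)"
    using papprox_digit[OF q qfrac_nat] by (simp add: papprox_def)
  ultimately have "pcong q (int n) (real t) (real s)" using pcong_sym pcong_trans by blast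
  then have "int (q ^ n) dvd int t - int s" using pcong_of_int[OF q, of n "int t" "int s"] by simp
  then have "int t mod int (q ^ n) = int s mod int (q ^ n)" by (simp add: mod_eq_dvd_iff)
  then show "t = s" using ts by (simp flip: of_nat_mod of_nat_power)
qed

lemma padic_intervals_eq:
  assumes q: "q \<ge> 2" shows "padic_intervals q (real q powi (- int n)) = interval q n ` {..<q ^ n}"
proof -
  have iv: "{\<xi> \<in> Zp q. padic_norm q (\<xi> \<ominus>\<^bsub>Qp q\<^esub> a) \<le> real q powi (- int n)} = {\<xi> \<in> Zp q. \<forall>j<int n. \<xi> j = a j}"
    if "a \<in> Zp q" for a
  proof -
    have a: "a \<in> padics q" using that by (simp add: Zp_iff[OF q])
    have "\<xi> \<in> padic_cball q a (int n) \<longleftrightarrow> \<xi> \<in> padics q \<and> (\<forall>j<int n. \<xi> j = a j)" for \<xi>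
      by (simp add: ball_eq[OF q a])
    moreover have "\<xi> \<in> padic_cball q a (int n) \<longleftrightarrow> \<xi> \<in> padics q \<and> padic_norm q (\<xi> \<ominus>\<^bsub>Qp q\<^esub> a) \<le> real q powi (- int n)" for \<xi>
      by (simp add: padic_cball_def Qp_simps)
    ultimately show ?thesis by (auto simp: Zp_iff[OF q])
  qed
  have inj: "b = n" if "real q powi (- int n) = real q powi (- int b)" for b
    using that q power_int_strict_increasing[of "- int n" "- int b" "real q"] power_int_strict_increasing[of "- int b" "- int n" "real q"]
    by (cases "b < n"; cases "n < b") auto
  show ?thesis
  proof (intro equalityI subsetI)
    fix \<tau> assume "\<tau> \<in> padic_intervals q (real q powi (- int n))"
    then obtain a where a: "a \<in> Zp q" "\<tau> = {\<xi> \<in> Zp q. padic_norm q (\<xi> \<ominus>\<^bsub>Qp q\<^esub> a) \<le> real q powi (- int n)}"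
      unfolding padic_intervals_def using inj by auto
    have ap: "a \<in> padics q" using a(1) by (simp add: Zp_iff[OF q])
    obtain z where z: "padic_trunc q a (int n) = of_int z" using trunc_Zp[OF q a(1)] by blast
    have "0 \<le> real_of_int z" "real_of_int z < real_of_int (int (q ^ n))" using trunc_range[OF q ap, of "int n"] by (simp_all add: z)
    then have z0: "0 \<le> z" "z < int (q ^ n)" by linarith+
    define t where "t = nat z"
    have t: "t < q ^ n" "real t = padic_trunc q a (int n)" using z0 z by (auto simp: t_def nat_less_iff)
    have "a j = digit q (real t) j" if "j < int n" for j unfolding t(2) using digit_trunc[OF q ap that] by simp
    then have "\<tau> = interval q n t" unfolding a(2) iv[OF a(1)] interval_def by auto
    then show "\<tau> \<in> interval q n ` {..<q ^ n}" using t(1) by blast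
  next
    fix \<tau> assume "\<tau> \<in> interval q n ` {..<q ^ n}"
    then obtain t where t: "\<tau> = interval q n t" by blast
    have pi: "pintegral q 0 (real t)" by (simp add: pintegral_def)
    have Z: "digit q (real t) \<in> Zp q" using digit_in[OF q qfrac_nat] digit_fin[OF q pi] by (simp add: Zp_iff[OF q])
    show "\<tau> \<in> padic_intervals q (real q powi (- int n))"
      unfolding padic_intervals_def t interval_def using Z iv[OF Z] by blast
  qed
qed

theorem theorem1p2:
  fixes q :: nat and \<epsilon> :: real
  assumes "prime q" and "odd q" and "\<epsilon> > 0"
  shows "\<exists>C::real. \<forall>(R::real) F.
    (\<exists>n::nat. n \<ge> 1 \<and> R = real q ^ (2 * n)) \<longrightarrow>
    schwartz q F \<longrightarrow>
    has_fourier_support q F (parabola_nbhd q (1 / R)) \<longrightarrow>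
    (LINT x|haar2 q. cmod (F x) ^ 6) \<le>
      C * ln R powr (12 + \<epsilon>) *
      (\<Sum>\<tau>\<in>padic_intervals q (R powr (- 1 / 2)). (Linf_norm q (freq_restrict q \<tau> F))\<^sup>2)\<^sup>2 *
      (\<Sum>\<tau>\<in>padic_intervals q (R powr (- 1 / 2)). (L2_norm q (freq_restrict q \<tau> F))\<^sup>2)"
proof (intro exI allI impI)
  interpret A: qtranslations "haar2 q" q "translate q" using assms(1,2) by (rule qtranslations_haar2)
  have q: "q \<ge> 2" using A.q_gt_1 by simp
  let ?C = "64 * (1 + real q ^ 8 * (81 + 4096 * real q ^ 8))"
  fix R :: real and F
  assume "\<exists>n::nat. n \<ge> 1 \<and> R = real q ^ (2 * n)" and F: "schwartz q F"
    and supp: "has_fourier_support q F (parabola_nbhd q (1 / R))"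
  then obtain n :: nat where n: "n \<ge> 1" "R = real q ^ (2 * n)" by blast
  note supp' = supp[unfolded n(2)]
  have Z: "fst \<xi> \<in> Zp q" if "\<xi> \<in> Qp2 q" "fourier q F \<xi> \<noteq> 0" for \<xi>
    using supp' that parabola_trunc(1)[OF q] unfolding has_fourier_support_def by blast
  let ?f = "arc_part q n F" and ?b = "\<lambda>t. Linf_norm q (arc_part q n F t)"
  have fs: "schwartz q (?f t)" for t by (rule schwartz_arc_part[OF q F])
  interpret W: wave_family "haar2 q" q "translate q" n ?f ?b
  proof
    fix t x
    show "A.wave n t (?f t)" unfolding A.wave_def
      using schwartz_bddint[OF q fs] arc_part_translate[OF q F supp'] by blast
    show "cmod (?f t x) \<le> ?b t" by (rule schwartz_le_Linf_norm[OF q fs])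
  qed
  have "R powr (- 1 / 2) = real q powi (- int n)"
  proof -
    have "R powr (- 1 / 2) = (real q powr (2 * real n)) powr (- 1 / 2)"
      unfolding n(2) using q by (simp add: powr_realpow[symmetric])
    also have "\<dots> = real q powr (- real n)" by (simp add: powr_powr)
    also have "\<dots> = real q powi (- int n)" using q by (simp add: powr_minus powr_realpow power_int_minus)
    finally show ?thesis .
  qed
  then have iv: "padic_intervals q (R powr (- 1 / 2)) = interval q n ` {..<q ^ n}" by (simp only: padic_intervals_eq[OF q])
  have fr: "freq_restrict q (interval q n t) F = ?f t" for t
    by (rule freq_restrict_arc_part[OF q F Z])
  have re: "(\<Sum>\<tau>\<in>padic_intervals q (R powr (- 1 / 2)). \<phi> (freq_restrict q \<tau> F)) = (\<Sum>t<q ^ n. \<phi> (?f t))" for \<phi> :: "_ \<Rightarrow> real"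
    unfolding iv sum.reindex[OF inj_interval[OF q]] o_def fr ..
  have sup_sum: "(\<Sum>\<tau>\<in>padic_intervals q (R powr (- 1 / 2)). (Linf_norm q (freq_restrict q \<tau> F))\<^sup>2) = W.sup_sum"
    unfolding re[of "\<lambda>G. (Linf_norm q G)\<^sup>2"] W.sup_sum_def ..
  have L2: "(L2_norm q G)\<^sup>2 = (LINT x|haar2 q. (cmod (G x))\<^sup>2)" for G
    unfolding L2_norm_def by simp
  have mass: "(\<Sum>\<tau>\<in>padic_intervals q (R powr (- 1 / 2)). (L2_norm q (freq_restrict q \<tau> F))\<^sup>2) = W.mass"
    unfolding re[of "\<lambda>G. (L2_norm q G)\<^sup>2"] unfolding W.mass_def L2 ..
  have log: "real n ^ 12 \<le> ln R powr (12 + \<epsilon>)"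
  proof -
    \<comment> \<open>\<open>q \<ge> 3 > exp 1\<close>, so \<open>ln R = 2 n ln q\<close> is at least \<open>n\<close>.\<close>
    have "exp 1 \<le> real q" using A.q_ge3 exp_le by linarith
    then have "1 \<le> ln (real q)" using q by (subst ln_ge_iff) auto
    then have "real n * 1 \<le> (2 * real n) * ln (real q)" by (intro mult_mono) auto
    also have "\<dots> = ln R" unfolding n(2) using q by (simp add: ln_realpow)
    finally have le: "real n \<le> ln R" by simp
    then have ln1: "1 \<le> ln R" using n(1) by linarith
    have "real n ^ 12 \<le> ln R ^ 12" using le by (intro power_mono) auto
    also have "\<dots> = ln R powr 12" using ln1 by (simp add: powr_numeral)
    also have "\<dots> \<le> ln R powr (12 + \<epsilon>)" using ln1 assms(3) by (intro powr_mono) auto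
    finally show ?thesis .
  qed
  have "(LINT x|haar2 q. cmod (F x) ^ 6) \<le> ?C * real n ^ 12 * W.sup_sum\<^sup>2 * W.mass"
    using W.sixth_moment[OF n(1)] unfolding sum_arc_part[OF q] .
  also have "\<dots> \<le> ?C * ln R powr (12 + \<epsilon>) * W.sup_sum\<^sup>2 * W.mass"
    by (intro mult_right_mono mult_left_mono log W.mass_nonneg) auto
  finally show "(LINT x|haar2 q. cmod (F x) ^ 6) \<le>
      ?C * ln R powr (12 + \<epsilon>) *
      (\<Sum>\<tau>\<in>padic_intervals q (R powr (- 1 / 2)). (Linf_norm q (freq_restrict q \<tau> F))\<^sup>2)\<^sup>2 *
      (\<Sum>\<tau>\<in>padic_intervals q (R powr (- 1 / 2)). (L2_norm q (freq_restrict q \<tau> F))\<^sup>2)"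
    unfolding sup_sum mass .
qed

end
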